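(* Let $p\in P^{Log}(\mathbb{R})$, $r\in\mathbb{N}$, $\sigma>0$ and $f\in L_{p(\cdot)}$. Then $$A_\sigma(f)_{p(\cdot)}\le c_{11}\,\|(I-T_{1/\sigma})^rf\|_{p(\cdot)}$$ with $c_{11}=30\pi\,8^r\,c_5\,c_7\,c_8(r)$.
   Context: For a measurable function $p:\mathbb{R}\to[1,\infty)$ let $p^-=\operatorname{ess\,inf}_{\mathbb{R}}p$ and $p^+=\operatorname{ess\,sup}_{\mathbb{R}}p$. The class $P^{Log}(\mathbb{R})$ consists of all measurable $p:\mathbb{R}\to[1,\infty)$ with $1\le p^-$, $p^+<\infty$ for which there are positive constants $c_1(p),c_2(p)$ and a number $p_\infty>1$ such that, for all $x,y\in\mathbb{R}$, $|\frac1{p(x)}-\frac1{p(y)}|\log(e+1/|x-y|)\le c_1(p)$ (for $x\neq y$) and $|\frac1{p(x)}-\frac1{p_\infty}|\log(e+|x|)\le c_2(p)$. Put $c_3(p)=\max\{c_1(p),c_2(p)\}$. $L_{p(\cdot)}$ is the set of measurable $f:\mathbb{R}\to\mathbb{R}$ with $\int_{\mathbb{R}}|f(y)/\lambda|^{p(y)}dy<\infty$ for some $\lambda>0$, with norm $\|f\|_{p(\cdot)}=\inf\{\eta>0:\int_{\mathbb{R}}|f(y)/\eta|^{p(y)}dy<1\}$. An entire function $f$ is of exponential type $\sigma$ if $\limsup_{\rho\to\infty}\rho^{-1}\ln\max_{|z|=\rho}|f(z)|\le\sigma$. $\mathcal{G}_{\sigma,p(\cdot)}$ is the set of entire functions of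 exponential type $\sigma$ whose restriction to $\mathbb{R}$ belongs to $L_{p(\cdot)}$, and $A_\sigma(f)_{p(\cdot)}=\inf\{\|f-g\|_{p(\cdot)}:g\in\mathcal{G}_{\sigma,p(\cdot)}\}$. $T_\delta f(x)=\frac1\delta\int_0^\delta f(x+t)\,dt$ and $I$ is the identity operator. Constants: $c_5=2^{p^++1}3^{p^+}\big(1+2\cdot3^{p^+}\big[\sum_{k=2}^\infty2^{-k}+2\big]\big)\exp(8c_3(p))$, $c_7=2\exp(8c_3(p))$, $c_8(1)=36$ and $c_8(r)=2^r(r^r+34^r)$ for $r>1$. *)

theory Defs
  imports "HOL-Complex_Analysis.Complex_Analysis" "HOL-Probability.Essential_Supremum"
begin

definition ess_inf_exponent :: "(real \<Rightarrow> real) \<Rightarrow> ereal" where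
  "ess_inf_exponent p = Sup {a. AE x in lebesgue. a \<le> ereal (p x)}"

definition ess_sup_exponent :: "(real \<Rightarrow> real) \<Rightarrow> ereal" where
  "ess_sup_exponent p = esssup lebesgue (\<lambda>x. ereal (p x))"

definition log_constants :: "(real \<Rightarrow> real) \<Rightarrow> real \<Rightarrow> real \<Rightarrow> bool" where
  "log_constants p c\<^sub>1 c\<^sub>2 \<longleftrightarrow> c\<^sub>1 > 0 \<and> c\<^sub>2 > 0 \<and>
     (\<forall>x y. x \<noteq> y \<longrightarrow> \<bar>1 / p x - 1 / p y\<bar> * ln (exp 1 + 1 / \<bar>x - y\<bar>) \<le> c\<^sub>1) \<and>
     (\<exists>p_inf>1. \<forall>x. \<bar>1 / p x - 1 / p_inf\<bar> * ln (exp 1 + \<bar>x\<bar>) \<le> c\<^sub>2)"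

definition P_Log :: "(real \<Rightarrow> real) set" where
  "P_Log = {p. p \<in> borel_measurable lebesgue \<and> (\<forall>x. p x \<ge> 1) \<and>
     1 \<le> ess_inf_exponent p \<and> ess_sup_exponent p < \<infinity> \<and>
     (\<exists>c\<^sub>1 c\<^sub>2. log_constants p c\<^sub>1 c\<^sub>2)}"

definition var_modular :: "(real \<Rightarrow> real) \<Rightarrow> (real \<Rightarrow> real) \<Rightarrow> ennreal" where
  "var_modular p f = (\<integral>\<^sup>+ y. ennreal (\<bar>f y\<bar> powr p y) \<partial>lebesgue)"

definition Lp_var :: "(real \<Rightarrow> real) \<Rightarrow> (real \<Rightarrow> real) set" where
  "Lp_var p = {f. f \<in> borel_measurable lebesgue \<and>
     (\<exists>l>0. var_modular p (\<lambda>y. f y / l) < \<infinity>)}"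

text \<open>The infimum is taken in the reals, so the value is meaningful only for
  \<open>f \<in> Lp_var p\<close>; for \<open>p \<in> P_Log\<close> and such \<open>f\<close> the set is nonempty.\<close>

definition var_norm :: "(real \<Rightarrow> real) \<Rightarrow> (real \<Rightarrow> real) \<Rightarrow> real" where
  "var_norm p f = Inf {\<eta>. \<eta> > 0 \<and> var_modular p (\<lambda>y. f y / \<eta>) < 1}"

text \<open>The maximum modulus on a circle is attained, hence written as a supremum.
  Since \<open>ln 0 = 0\<close> here, the zero function has type \<open>\<sigma>\<close> for every \<open>\<sigma> \<ge> 0\<close>, as it should.\<close>

definition exponential_type :: "real \<Rightarrow> (complex \<Rightarrow> complex) \<Rightarrow> bool" where
  "exponential_type \<sigma> g \<longleftrightarrow>
     Limsup at_top (\<lambda>\<rho>::real. ereal (ln (SUP z\<in>sphere 0 \<rho>. cmod (g z)) / \<rho>)) \<le> ereal \<sigma>"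

text \<open>\<open>Lp_var p\<close> consists of real-valued functions, so the members of the class
  below are real on the real axis.\<close>

definition exp_type_class :: "real \<Rightarrow> (real \<Rightarrow> real) \<Rightarrow> (complex \<Rightarrow> complex) set" where
  "exp_type_class \<sigma> p = {g. g holomorphic_on UNIV \<and> exponential_type \<sigma> g \<and>
     (\<forall>x::real. g (of_real x) \<in> \<real>) \<and> (\<lambda>x. Re (g (of_real x))) \<in> Lp_var p}"

definition best_approx :: "real \<Rightarrow> (real \<Rightarrow> real) \<Rightarrow> (real \<Rightarrow> real) \<Rightarrow> real" where
  "best_approx \<sigma> p f = (INF g\<in>exp_type_class \<sigma> p. var_norm p (\<lambda>x. f x - Re (g (of_real x))))"

definition steklov :: "real \<Rightarrow> (real \<Rightarrow> real) \<Rightarrow> real \<Rightarrow> real" where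
  "steklov \<delta> f x = 1 / \<delta> * (LINT t:{0..\<delta>}|lebesgue. f (x + t))"

definition id_minus_steklov :: "real \<Rightarrow> (real \<Rightarrow> real) \<Rightarrow> real \<Rightarrow> real" where
  "id_minus_steklov \<delta> f x = f x - steklov \<delta> f x"

text \<open>Below, \<open>q\<close> stands for \<open>p\<^sup>+\<close> and \<open>c\<^sub>3\<close> for the larger of the two constants
  of \<open>log_constants\<close>.\<close>

definition const5 :: "real \<Rightarrow> real \<Rightarrow> real" where
  "const5 q c\<^sub>3 = 2 powr (q + 1) * 3 powr q *
     (1 + 2 * 3 powr q * ((\<Sum>k. 1 / 2 ^ (k + 2)) + 2)) * exp (8 * c\<^sub>3)"

definition const7 :: "real \<Rightarrow> real" where
  "const7 c\<^sub>3 = 2 * exp (8 * c\<^sub>3)"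

definition const8 :: "nat \<Rightarrow> real" where
  "const8 r = (if r = 1 then 36 else 2 ^ r * (real r ^ r + 34 ^ r))"

definition const11 :: "nat \<Rightarrow> real \<Rightarrow> real \<Rightarrow> real" where
  "const11 r q c\<^sub>3 = 30 * pi * 8 ^ r * const5 q c\<^sub>3 * const7 c\<^sub>3 * const8 r"

end

theory Submission
  imports Defs "HOL-Real_Asymp.Real_Asymp" "HOL-Probability.Probability_Measure"
begin

text \<open>
  After rescaling by \<open>1 / \<sigma>\<close> let \<open>T f x\<close> be the mean of \<open>f\<close> over \<open>[x, x + 1]\<close>
  (\<open>avg\<close>) and \<open>\<phi> = f - T f\<close> (\<open>defect\<close>). The proof constructs a linear operator \<open>V\<close> whose values
  extend to entire functions of exponential type 1 and for which, pointwise,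
  \<open>\<bar>f - V f\<bar> \<le> \<bar>\<phi>\<bar> + 54 K \<phi>\<close>, where \<open>K \<phi> x\<close> is the integral of
  \<open>\<kappa> t * \<bar>\<phi> (x + t)\<bar>\<close> with \<open>\<kappa> t = 1 / (1 + \<bar>t\<bar>)\<^sup>2\<close>. All the operators involved commute, so the bound
  iterates: \<open>(I - V)^r f\<close> is dominated by \<open>(I - T)^r f\<close>. The domination is kept at the level of kernels,
  where \<open>\<kappa> * \<kappa> \<le> 8 \<kappa>\<close> makes the constant at most \<open>433 ^ r\<close> (\<open>iterated_residual_bound\<close>); the norm
  of \<open>K\<close> on the variable exponent space, which depends on \<open>p\<close>, then enters only once. Since
  \<open>(I - V)^r f = f - V (\<dots>)\<close>, this yields the approximating entire function
  (\<open>entire_approximation\<close>).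

  In Fourier terms \<open>V\<close> exists because the symbol of \<open>I - T\<close> vanishes only at the origin, and
  to first order. The following makes this explicit. The triangular mean \<open>S\<close>, with weight
  \<open>2 (1 - t)\<close> on \<open>[0, 1]\<close>, satisfies \<open>(S f)' = - 2 \<phi>\<close>, so the increments of \<open>S f\<close>
  are controlled by \<open>\<phi>\<close>. Moreover \<open>T - S\<close> has the kernel \<open>2 t - 1\<close> on \<open>[0, 1]\<close>, whose
  \<open>L\<^sup>1\<close> norm is one half. Hence \<open>G = f - S f\<close> solves \<open>G = (T - S) G + (terms in \<phi>)\<close>
  (\<open>remainder_equation\<close>), and a Neumann series bounds it by \<open>\<phi>\<close> (\<open>remainder_bound\<close>). Finally
  \<open>V = J S\<close>, where \<open>J\<close> is the mean with the kernel \<open>(sin (t / 4) / (t / 4))^4\<close>, normalised;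
  \<open>S f - J S f\<close> is bounded by the tails of \<open>J\<close> (\<open>jackson_bound\<close>).

  It remains to bound \<open>K\<close>, uniformly under dilations, on the variable exponent space
  (\<open>modular_of_pointwise\<close>). The kernel \<open>\<kappa>\<close> is a mixture of uniform distributions on centred
  intervals. If \<open>f\<close> has modular at most 1, then for one interval
  \<open>(\<beta> avg \<bar>f\<bar>)\<close> raised to the power \<open>p y\<close> at its centre \<open>y\<close> is at
  most the average of \<open>\<bar>f x\<bar>\<close> to the power \<open>p x\<close> plus an integrable error
  (\<open>average_powr_le\<close>): where \<open>\<bar>f\<bar> > 1\<close> this follows from the local log-Hoelder condition, where
  \<open>\<bar>f\<bar> \<le> 1\<close> from Jensen's inequality and the decay condition. Jensen's inequality for the
  mixture and integration in \<open>y\<close> give the bound, with a constant \<open>80 exp (4 c)\<close>, far below the constant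
  claimed.
\<close>

section \<open>A quadratically decaying majorant kernel\<close>

text \<open>The square is a compromise: it decays fast enough to be integrable and almost stable under
  convolution (\<open>nn_integral_kappa_kappa\<close>), and slowly enough to dominate the tails of the Jackson kernel.\<close>

definition kappa :: "real \<Rightarrow> real" where
  "kappa t = 1 / (1 + \<bar>t\<bar>)\<^sup>2"

lemma kappa_measurable [measurable]: "kappa \<in> borel_measurable borel"
  unfolding kappa_def by measurable

lemma kappa_pos: "kappa t > 0"
  unfolding kappa_def by (simp add: add_pos_nonneg)

lemma kappa_nonneg [simp]: "kappa t \<ge> 0"
  using kappa_pos[of t] by simp

lemma kappa_le_1: "kappa t \<le> 1"
  unfolding kappa_def by simp

lemma kappa_uminus [simp]: "kappa (- t) = kappa t"
  by (simp add: kappa_def)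

lemma nn_integral_tail_cube:
  fixes u :: real
  assumes "u \<ge> 0"
  shows "(\<integral>\<^sup>+h. ennreal (2 / (1 + h) ^ 3) * indicator {u..} h \<partial>lborel) = ennreal (kappa u)"
proof -
  have "(\<integral>\<^sup>+h. ennreal (2 / (1 + h) ^ 3) * indicator {u..} h \<partial>lborel)
      = ennreal (0 - (- 1 / (1 + u)\<^sup>2))"
  proof (rule nn_integral_FTC_atLeast)
    fix x assume x: "u \<le> x"
    then have "1 + x \<noteq> 0" using assms by simp
    then show "DERIV (\<lambda>x. - 1 / (1 + x)\<^sup>2) x :> 2 / (1 + x) ^ 3"
      by (auto intro!: derivative_eq_intros simp: divide_simps) algebra
    show "0 \<le> 2 / (1 + x) ^ 3" using x assms by simp
  next
    show "((\<lambda>x::real. - 1 / (1 + x)\<^sup>2) \<longlongrightarrow> 0) at_top"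
      by real_asymp
  qed measurable
  then show ?thesis using assms by (simp add: kappa_def)
qed

text \<open>A decreasing function of \<open>\<bar>t\<bar>\<close> is a superposition of indicators of centred intervals, with
  minus its derivative as density. This turns estimates for interval averages into estimates for
  \<open>kappa\<close>.\<close>

lemma kappa_eq_mixture:
  "ennreal (kappa t) = (\<integral>\<^sup>+h. ennreal (2 / (1 + h) ^ 3) * indicator {\<bar>t\<bar>..} h \<partial>lborel)"
  by (subst nn_integral_tail_cube) (auto simp: kappa_def)

lemma nn_integral_mixing_density:
  "(\<integral>\<^sup>+h. ennreal (2 * h / (1 + h) ^ 3) * indicator {0..} h \<partial>lborel) = 1"
proof -
  have "(\<integral>\<^sup>+h. ennreal (2 * h / (1 + h) ^ 3) * indicator {0..} h \<partial>lborel)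
      = ennreal (1 - ((0::real)\<^sup>2 / (1 + 0)\<^sup>2))"
  proof (rule nn_integral_FTC_atLeast)
    fix x :: real assume x: "0 \<le> x"
    then have "1 + x \<noteq> 0" by simp
    then show "DERIV (\<lambda>x. x\<^sup>2 / (1 + x)\<^sup>2) x :> 2 * x / (1 + x) ^ 3"
      by (auto intro!: derivative_eq_intros simp: divide_simps) algebra
    show "0 \<le> 2 * x / (1 + x) ^ 3" using x by simp
  next
    show "((\<lambda>x::real. x\<^sup>2 / (1 + x)\<^sup>2) \<longlongrightarrow> 1) at_top"
      by real_asymp
  qed measurable
  then show ?thesis by simp
qed

lemma nn_integral_shift:
  fixes g :: "real \<Rightarrow> ennreal"
  assumes [measurable]: "g \<in> borel_measurable borel"
  shows "(\<integral>\<^sup>+t. g (a + t) \<partial>lborel) = (\<integral>\<^sup>+t. g t \<partial>lborel)"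
  using nn_integral_real_affine[of g 1 a] by simp

lemma nn_integral_scale:
  fixes g :: "real \<Rightarrow> ennreal"
  assumes [measurable]: "g \<in> borel_measurable borel" and "d > 0"
  shows "ennreal d * (\<integral>\<^sup>+t. g (a + d * t) \<partial>lborel) = (\<integral>\<^sup>+t. g t \<partial>lborel)"
  using nn_integral_real_affine[of g d a] assms by simp

lemma nn_integral_reflect:
  fixes g :: "real \<Rightarrow> ennreal"
  assumes [measurable]: "g \<in> borel_measurable borel"
  shows "(\<integral>\<^sup>+t. g (a - t) \<partial>lborel) = (\<integral>\<^sup>+t. g t \<partial>lborel)"
  using nn_integral_real_affine[of g "-1" a] by simp

lemma nn_integral_kappa: "(\<integral>\<^sup>+t. ennreal (kappa t) \<partial>lborel) = 2"
proof -
  have "(\<integral>\<^sup>+t. ennreal (kappa t) \<partial>lborel)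
     = (\<integral>\<^sup>+t. (\<integral>\<^sup>+h. ennreal (2 / (1 + h) ^ 3) * indicator {\<bar>t\<bar>..} h \<partial>lborel) \<partial>lborel)"
    by (simp add: kappa_eq_mixture)
  also have "\<dots> = (\<integral>\<^sup>+h. (\<integral>\<^sup>+t. ennreal (2 / (1 + h) ^ 3) * indicator {\<bar>t\<bar>..} h \<partial>lborel) \<partial>lborel)"
  proof (rule lborel_pair.Fubini')
    have eq: "(\<lambda>(h, t). ennreal (2 / (1 + h) ^ 3) * indicator {\<bar>t\<bar>..} h)
       = (\<lambda>z::real\<times>real. ennreal (2 / (1 + fst z) ^ 3) * (if \<bar>snd z\<bar> \<le> fst z then 1 else 0))"
      by (auto simp: fun_eq_iff indicator_def)
    show "(\<lambda>(h, t). ennreal (2 / (1 + h) ^ 3) * indicator {\<bar>t\<bar>..} h)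
      \<in> borel_measurable (lborel \<Otimes>\<^sub>M lborel)"
      unfolding eq by measurable
  qed
  also have "\<dots> = (\<integral>\<^sup>+h. 2 * (ennreal (2 * h / (1 + h) ^ 3) * indicator {0..} h) \<partial>lborel)"
  proof (rule nn_integral_cong)
    fix h :: real
    have "(\<integral>\<^sup>+t. ennreal (2 / (1 + h) ^ 3) * indicator {\<bar>t\<bar>..} h \<partial>lborel)
        = (\<integral>\<^sup>+t. ennreal (2 / (1 + h) ^ 3) * indicator {-h..h} t \<partial>lborel)"
      by (rule nn_integral_cong) (auto simp: indicator_def)
    also have "\<dots> = ennreal (2 / (1 + h) ^ 3) * emeasure lborel {-h..h}"
      by (rule nn_integral_cmult_indicator) simp
    also have "\<dots> = 2 * (ennreal (2 * h / (1 + h) ^ 3) * indicator {0..} h)"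
    proof (cases "h \<ge> 0")
      case True
      then have "ennreal (2 / (1 + h) ^ 3) * ennreal (h + h) = ennreal (2 * (2 * h / (1 + h) ^ 3))"
        by (subst ennreal_mult[symmetric]) (auto simp: field_simps)
      also have "\<dots> = 2 * ennreal (2 * h / (1 + h) ^ 3)"
        using True by (subst ennreal_mult) auto
      finally show ?thesis using True by simp
    qed simp
    finally show "(\<integral>\<^sup>+t. ennreal (2 / (1 + h) ^ 3) * indicator {\<bar>t\<bar>..} h \<partial>lborel)
        = 2 * (ennreal (2 * h / (1 + h) ^ 3) * indicator {0..} h)" .
  qed
  also have "\<dots> = 2"
    by (subst nn_integral_cmult) (auto simp: nn_integral_mixing_density)
  finally show ?thesis .
qed

text \<open>From \<open>1 + \<bar>u\<bar> \<le> (1 + \<bar>s\<bar>) + (1 + \<bar>u - s\<bar>)\<close>, squared.\<close>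

lemma kappa_mult_le: "kappa s * kappa (u - s) \<le> 2 * kappa u * (kappa s + kappa (u - s))"
proof -
  define a b where "a = 1 + \<bar>s\<bar>" and "b = 1 + \<bar>u - s\<bar>"
  have ab: "a \<ge> 1" "b \<ge> 1" by (auto simp: a_def b_def)
  have "1 + \<bar>u\<bar> \<le> a + b" by (auto simp: a_def b_def)
  then have "(1 + \<bar>u\<bar>)\<^sup>2 \<le> (a + b)\<^sup>2" by (intro power_mono) auto
  also have "\<dots> \<le> 2 * (a\<^sup>2 + b\<^sup>2)" using sum_squares_bound[of a b] by (simp add: power2_sum)
  finally have "(1 + \<bar>u\<bar>)\<^sup>2 \<le> 2 * (a\<^sup>2 + b\<^sup>2)" .
  moreover have "(1 + \<bar>u\<bar>)\<^sup>2 > 0" by (simp add: add_pos_nonneg)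
  ultimately have "1 \<le> 2 * (1 / (1 + \<bar>u\<bar>)\<^sup>2) * (a\<^sup>2 + b\<^sup>2)"
    by (simp add: field_simps)
  then have "1 / (a\<^sup>2 * b\<^sup>2) \<le> 2 * (1 / (1 + \<bar>u\<bar>)\<^sup>2) * (a\<^sup>2 + b\<^sup>2) / (a\<^sup>2 * b\<^sup>2)"
    by (intro divide_right_mono) auto
  also have "\<dots> = 2 * (1 / (1 + \<bar>u\<bar>)\<^sup>2) * (1 / a\<^sup>2 + 1 / b\<^sup>2)"
    using ab by (simp add: field_simps)
  finally show ?thesis by (simp add: kappa_def a_def b_def)
qed

lemma nn_integral_kappa_kappa:
  "(\<integral>\<^sup>+s. ennreal (kappa s * kappa (u - s)) \<partial>lborel) \<le> ennreal (8 * kappa u)"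
proof -
  have "(\<integral>\<^sup>+s. ennreal (kappa s * kappa (u - s)) \<partial>lborel)
     \<le> (\<integral>\<^sup>+s. ennreal (2 * kappa u) * (ennreal (kappa s) + ennreal (kappa (u - s))) \<partial>lborel)"
    by (intro nn_integral_mono)
       (auto simp flip: ennreal_mult ennreal_plus intro!: ennreal_leI kappa_mult_le)
  also have "\<dots> = ennreal (2 * kappa u) * (2 + 2)"
    by (simp add: nn_integral_cmult nn_integral_add nn_integral_kappa
        nn_integral_reflect[of "\<lambda>t. ennreal (kappa t)"])
  also have "(2 + 2 :: ennreal) = ennreal 4" by simp
  also have "ennreal (2 * kappa u) * ennreal 4 = ennreal (8 * kappa u)"
    by (subst ennreal_mult[symmetric]) auto
  finally show ?thesis .
qed

text \<open>The majorant operator, valued in the extended nonnegative reals so that Tonelli's theorem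
  applies without integrability conditions.\<close>

definition kconv :: "(real \<Rightarrow> real) \<Rightarrow> real \<Rightarrow> ennreal" where
  "kconv f x = (\<integral>\<^sup>+t. ennreal (kappa t * \<bar>f (x + t)\<bar>) \<partial>lborel)"

lemma kconv_measurable [measurable]:
  assumes [measurable]: "f \<in> borel_measurable borel"
  shows "kconv f \<in> borel_measurable borel"
  unfolding kconv_def by measurable

lemma kconv_kconv_le:
  assumes [measurable]: "f \<in> borel_measurable borel"
  shows "(\<integral>\<^sup>+t. ennreal (kappa t) * kconv f (x + t) \<partial>lborel) \<le> 8 * kconv f x"
proof -
  have "(\<integral>\<^sup>+t. ennreal (kappa t) * kconv f (x + t) \<partial>lborel)
     = (\<integral>\<^sup>+t. (\<integral>\<^sup>+u. ennreal (kappa t * kappa (u - t) * \<bar>f (x + u)\<bar>) \<partial>lborel) \<partial>lborel)"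
  proof (rule nn_integral_cong)
    fix t
    have "kconv f (x + t) = (\<integral>\<^sup>+s. ennreal (kappa (t + s - t) * \<bar>f (x + (t + s))\<bar>) \<partial>lborel)"
      unfolding kconv_def by (simp add: add.assoc)
    also have "\<dots> = (\<integral>\<^sup>+u. ennreal (kappa (u - t) * \<bar>f (x + u)\<bar>) \<partial>lborel)"
      by (rule nn_integral_shift[of "\<lambda>u. ennreal (kappa (u - t) * \<bar>f (x + u)\<bar>)"]) measurable
    finally show "ennreal (kappa t) * kconv f (x + t)
        = (\<integral>\<^sup>+u. ennreal (kappa t * kappa (u - t) * \<bar>f (x + u)\<bar>) \<partial>lborel)"
      by (simp add: nn_integral_cmult[symmetric] ennreal_mult mult.assoc)
  qed
  also have "\<dots> = (\<integral>\<^sup>+u. (\<integral>\<^sup>+t. ennreal (kappa t * kappa (u - t) * \<bar>f (x + u)\<bar>) \<partial>lborel) \<partial>lborel)"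
    by (rule lborel_pair.Fubini') measurable
  also have "\<dots> \<le> (\<integral>\<^sup>+u. ennreal (8 * kappa u) * ennreal \<bar>f (x + u)\<bar> \<partial>lborel)"
  proof (rule nn_integral_mono)
    fix u
    have "(\<integral>\<^sup>+t. ennreal (kappa t * kappa (u - t) * \<bar>f (x + u)\<bar>) \<partial>lborel)
       = (\<integral>\<^sup>+t. ennreal (kappa t * kappa (u - t)) \<partial>lborel) * ennreal \<bar>f (x + u)\<bar>"
      by (simp add: nn_integral_multc[symmetric] ennreal_mult)
    then show "(\<integral>\<^sup>+t. ennreal (kappa t * kappa (u - t) * \<bar>f (x + u)\<bar>) \<partial>lborel)
       \<le> ennreal (8 * kappa u) * ennreal \<bar>f (x + u)\<bar>"
      using nn_integral_kappa_kappa[of u] by (simp add: mult_right_mono)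
  qed
  also have "\<dots> = 8 * kconv f x"
    unfolding kconv_def
    by (subst nn_integral_cmult[symmetric]) (auto intro!: nn_integral_cong simp: ennreal_mult mult.assoc)
  finally show ?thesis .
qed

section \<open>Correlation with dominated kernels\<close>

text \<open>Equivalently, the integrals of \<open>\<bar>f\<bar>\<close> over intervals of length one are bounded. This space
  contains all bounded functions and all \<open>L\<^sup>1\<close> functions, hence every function of finite
  modular, and it is preserved by every operator used below.\<close>

definition unif_loc_int :: "(real \<Rightarrow> real) \<Rightarrow> bool" where
  "unif_loc_int f \<longleftrightarrow> f \<in> borel_measurable borel \<and> (\<exists>C::real. \<forall>x. kconv f x \<le> ennreal C)"

lemma unif_loc_int_measurable [measurable_dest]: "unif_loc_int f \<Longrightarrow> f \<in> borel_measurable borel"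
  by (simp add: unif_loc_int_def)

lemma kconv_finite: "unif_loc_int f \<Longrightarrow> kconv f x < \<infinity>"
  unfolding unif_loc_int_def using ennreal_less_top le_less_trans infinity_ennreal_def by metis

definition kappa_kernel :: "real \<Rightarrow> (real \<Rightarrow> real) \<Rightarrow> bool" where
  "kappa_kernel C k \<longleftrightarrow> k \<in> borel_measurable borel \<and> (\<forall>t. \<bar>k t\<bar> \<le> C * kappa t)"

lemma kernel_measurable [measurable_dest]: "kappa_kernel C k \<Longrightarrow> k \<in> borel_measurable borel"
  by (simp add: kappa_kernel_def)

lemma kernel_nonneg_const: "kappa_kernel C k \<Longrightarrow> C \<ge> 0"
proof -
  assume "kappa_kernel C k"
  then have "\<bar>k 0\<bar> \<le> C * kappa 0" by (simp add: kappa_kernel_def)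
  then show ?thesis by (simp add: kappa_def)
qed

text \<open>Correlation rather than convolution, to match the forward Steklov mean.\<close>

definition corr :: "(real \<Rightarrow> real) \<Rightarrow> (real \<Rightarrow> real) \<Rightarrow> real \<Rightarrow> real" where
  "corr k f x = (\<integral>t. k t * f (x + t) \<partial>lborel)"

lemma nn_integral_kernel_le:
  assumes k: "kappa_kernel C k" and [measurable]: "f \<in> borel_measurable borel"
  shows "(\<integral>\<^sup>+t. ennreal \<bar>k t * f (x + t)\<bar> \<partial>lborel) \<le> ennreal C * kconv f x"
proof -
  note [measurable] = kernel_measurable[OF k]
  have "(\<integral>\<^sup>+t. ennreal \<bar>k t * f (x + t)\<bar> \<partial>lborel)
      \<le> (\<integral>\<^sup>+t. ennreal C * ennreal (kappa t * \<bar>f (x + t)\<bar>) \<partial>lborel)"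
    using k kernel_nonneg_const[OF k]
    by (intro nn_integral_mono)
       (auto simp: kappa_kernel_def abs_mult mult.assoc[symmetric] simp flip: ennreal_mult
             intro!: ennreal_leI mult_right_mono)
  then show ?thesis by (simp add: nn_integral_cmult kconv_def)
qed

lemma kernel_integrable:
  assumes k: "kappa_kernel C k" and f: "unif_loc_int f"
  shows "integrable lborel (\<lambda>t. k t * f (x + t))"
proof (rule integrableI_bounded)
  note [measurable] = kernel_measurable[OF k] unif_loc_int_measurable[OF f]
  show "(\<lambda>t. k t * f (x + t)) \<in> borel_measurable lborel" by measurable
  show "(\<integral>\<^sup>+t. ennreal (norm (k t * f (x + t))) \<partial>lborel) < \<infinity>"
    using nn_integral_kernel_le[OF k, of f x] kconv_finite[OF f, of x]
    by (auto simp: ennreal_mult_less_top intro: le_less_trans)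
qed

lemma abs_corr_le_nn_integral: "ennreal \<bar>corr k f x\<bar> \<le> (\<integral>\<^sup>+t. ennreal \<bar>k t * f (x + t)\<bar> \<partial>lborel)"
proof (cases "integrable lborel (\<lambda>t. k t * f (x + t))")
  case True
  then show ?thesis
    unfolding corr_def using integral_norm_bound_ennreal[OF True] by simp
next
  case False
  then show ?thesis by (simp add: corr_def not_integrable_integral_eq)
qed

lemma abs_corr_le:
  assumes "kappa_kernel C k" and "unif_loc_int f"
  shows "ennreal \<bar>corr k f x\<bar> \<le> ennreal C * kconv f x"
  using abs_corr_le_nn_integral nn_integral_kernel_le[OF assms(1) unif_loc_int_measurable[OF assms(2)]]
  by (rule order_trans)

lemma corr_measurable [measurable]:
  assumes [measurable]: "k \<in> borel_measurable borel" "f \<in> borel_measurable borel"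
  shows "corr k f \<in> borel_measurable borel"
  unfolding corr_def by measurable

text \<open>The step that iterates: pointwise domination survives an application of \<open>kconv\<close>, at the
  price of the factor 8 from \<open>kappa * kappa \<le> 8 kappa\<close>.\<close>

lemma kconv_le_of_pointwise:
  assumes [measurable]: "f \<in> borel_measurable borel" "g \<in> borel_measurable borel"
    and "a \<ge> 0" "b \<ge> 0"
    and le: "\<And>x. ennreal \<bar>g x\<bar> \<le> ennreal a * ennreal \<bar>f x\<bar> + ennreal b * kconv f x"
  shows "kconv g x \<le> ennreal (a + 8 * b) * kconv f x"
proof -
  have "kconv g x = (\<integral>\<^sup>+t. ennreal (kappa t) * ennreal \<bar>g (x + t)\<bar> \<partial>lborel)"
    by (simp add: kconv_def ennreal_mult)
  also have "\<dots> \<le> (\<integral>\<^sup>+t. ennreal (kappa t) * (ennreal a * ennreal \<bar>f (x + t)\<bar> + ennreal b * kconv f (x + t)) \<partial>lborel)"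
    by (intro nn_integral_mono mult_left_mono le) auto
  also have "\<dots> = (\<integral>\<^sup>+t. ennreal a * ennreal (kappa t * \<bar>f (x + t)\<bar>) + ennreal b * (ennreal (kappa t) * kconv f (x + t)) \<partial>lborel)"
    by (intro nn_integral_cong) (simp add: ennreal_mult distrib_left mult_ac)
  also have "\<dots> = ennreal a * kconv f x + ennreal b * (\<integral>\<^sup>+t. ennreal (kappa t) * kconv f (x + t) \<partial>lborel)"
    by (simp add: nn_integral_add nn_integral_cmult kconv_def[symmetric])
  also have "\<dots> \<le> ennreal a * kconv f x + ennreal b * (8 * kconv f x)"
    by (intro add_left_mono mult_left_mono kconv_kconv_le) auto
  also have "\<dots> = ennreal (a + 8 * b) * kconv f x"
    using assms(3,4) by (simp add: ennreal_mult distrib_left distrib_right mult_ac)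
  finally show ?thesis .
qed

lemma unif_loc_int_of_pointwise:
  assumes f: "unif_loc_int f" and g: "g \<in> borel_measurable borel" and ab: "a \<ge> 0" "b \<ge> 0"
    and le: "\<And>x. ennreal \<bar>g x\<bar> \<le> ennreal a * ennreal \<bar>f x\<bar> + ennreal b * kconv f x"
  shows "unif_loc_int g"
proof -
  from f obtain C where C: "\<And>x. kconv f x \<le> ennreal C" by (auto simp: unif_loc_int_def)
  have "kconv g x \<le> ennreal ((a + 8 * b) * C)" for x
  proof -
    have "kconv g x \<le> ennreal (a + 8 * b) * kconv f x"
      by (rule kconv_le_of_pointwise[OF unif_loc_int_measurable[OF f] g ab le])
    also have "\<dots> \<le> ennreal (a + 8 * b) * ennreal C"
      by (intro mult_left_mono C) auto
    also have "\<dots> = ennreal ((a + 8 * b) * C)"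
      using ab by (subst ennreal_mult') auto
    finally show ?thesis .
  qed
  then show ?thesis using g by (auto simp: unif_loc_int_def)
qed

lemma unif_loc_int_corr:
  assumes k: "kappa_kernel C k" and f: "unif_loc_int f"
  shows "unif_loc_int (corr k f)"
proof (rule unif_loc_int_of_pointwise[OF f, of _ 0 C])
  show "corr k f \<in> borel_measurable borel"
    using kernel_measurable[OF k] unif_loc_int_measurable[OF f] by measurable
qed (use kernel_nonneg_const[OF k] abs_corr_le[OF k f] in auto)

lemma kconv_add_le:
  assumes [measurable]: "f \<in> borel_measurable borel" "g \<in> borel_measurable borel"
  shows "kconv (\<lambda>x. f x + g x) x \<le> kconv f x + kconv g x"
proof -
  have "kconv (\<lambda>x. f x + g x) x \<le>
    (\<integral>\<^sup>+t. ennreal (kappa t * \<bar>f (x + t)\<bar>) + ennreal (kappa t * \<bar>g (x + t)\<bar>) \<partial>lborel)"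
    unfolding kconv_def
    by (intro nn_integral_mono)
       (auto simp flip: ennreal_plus distrib_left intro!: ennreal_leI mult_left_mono)
  then show ?thesis by (simp add: nn_integral_add kconv_def)
qed

lemma kconv_uminus: "kconv (\<lambda>x. - f x) = kconv f"
  by (simp add: kconv_def fun_eq_iff)

lemma unif_loc_int_add:
  assumes f: "unif_loc_int f" and g: "unif_loc_int g"
  shows "unif_loc_int (\<lambda>x. f x + g x)"
proof -
  note [measurable] = unif_loc_int_measurable[OF f] unif_loc_int_measurable[OF g]
  from f obtain C where C: "\<And>x. kconv f x \<le> ennreal C" by (auto simp: unif_loc_int_def)
  from g obtain D where D: "\<And>x. kconv g x \<le> ennreal D" by (auto simp: unif_loc_int_def)
  have "kconv (\<lambda>x. f x + g x) x \<le> ennreal (\<bar>C\<bar> + \<bar>D\<bar>)" for x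
  proof -
    have "kconv (\<lambda>x. f x + g x) x \<le> kconv f x + kconv g x" by (rule kconv_add_le) measurable
    also have "\<dots> \<le> ennreal \<bar>C\<bar> + ennreal \<bar>D\<bar>"
      by (intro add_mono order_trans[OF C] order_trans[OF D] ennreal_leI) auto
    finally show ?thesis by simp
  qed
  moreover have "(\<lambda>x. f x + g x) \<in> borel_measurable borel" by measurable
  ultimately show ?thesis unfolding unif_loc_int_def by blast
qed

lemma unif_loc_int_diff:
  assumes f: "unif_loc_int f" and g: "unif_loc_int g"
  shows "unif_loc_int (\<lambda>x. f x - g x)"
proof -
  have "unif_loc_int (\<lambda>x. - g x)"
    using g kconv_uminus[of g] by (auto simp: unif_loc_int_def)
  from unif_loc_int_add[OF f this] show ?thesis by simp
qed

lemma corr_add: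
  assumes "kappa_kernel C k" "unif_loc_int f" "unif_loc_int g"
  shows "corr k (\<lambda>x. f x + g x) x = corr k f x + corr k g x"
  using kernel_integrable[OF assms(1,2)] kernel_integrable[OF assms(1,3)]
  by (simp add: corr_def distrib_left)

lemma corr_diff:
  assumes "kappa_kernel C k" "unif_loc_int f" "unif_loc_int g"
  shows "corr k (\<lambda>x. f x - g x) x = corr k f x - corr k g x"
  using kernel_integrable[OF assms(1,2)] kernel_integrable[OF assms(1,3)]
  by (simp add: corr_def right_diff_distrib)

lemma corr_diff_kernel:
  assumes "kappa_kernel C k" "kappa_kernel D l" "unif_loc_int f"
  shows "corr (\<lambda>t. k t - l t) f x = corr k f x - corr l f x"
  using kernel_integrable[OF assms(1,3)] kernel_integrable[OF assms(2,3)]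
  by (simp add: corr_def left_diff_distrib)

lemma corr_cmult_kernel: "corr (\<lambda>t. c * k t) f x = c * corr k f x"
  by (simp add: corr_def mult.assoc)

text \<open>Fubini's theorem for a measurable family of kernels. Both the composition of two correlations
  and the telescoping of increments below are instances of it.\<close>

lemma corr_family:
  assumes m [measurable]: "(\<lambda>(t, u). m t u) \<in> borel_measurable (borel \<Otimes>\<^sub>M borel)"
    and f: "unif_loc_int f" and "C \<ge> 0"
    and bd: "\<And>u. (\<integral>\<^sup>+t. ennreal \<bar>m t u\<bar> \<partial>lborel) \<le> ennreal (C * kappa u)"
  shows "(\<integral>t. corr (m t) f x \<partial>lborel) = corr (\<lambda>u. \<integral>t. m t u \<partial>lborel) f x"
proof -
  note [measurable] = unif_loc_int_measurable[OF f]
  have m' [measurable]: "(\<lambda>(u, t). m t u) \<in> borel_measurable (borel \<Otimes>\<^sub>M borel)"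
    using measurable_compose[OF measurable_pair_swap' m] by (simp add: case_prod_beta)
  have int: "integrable (lborel \<Otimes>\<^sub>M lborel) (\<lambda>(u, t). m t u * f (x + u))"
  proof (rule integrableI_bounded)
    show "(\<lambda>(u, t). m t u * f (x + u)) \<in> borel_measurable (lborel \<Otimes>\<^sub>M lborel)"
      by measurable
    have "(\<integral>\<^sup>+ z. ennreal (norm (case z of (u, t) \<Rightarrow> m t u * f (x + u))) \<partial>(lborel \<Otimes>\<^sub>M lborel))
       = (\<integral>\<^sup>+u. (\<integral>\<^sup>+t. ennreal \<bar>m t u * f (x + u)\<bar> \<partial>lborel) \<partial>lborel)"
      by (subst lborel.nn_integral_fst[symmetric]) auto
    also have "\<dots> = (\<integral>\<^sup>+u. (\<integral>\<^sup>+t. ennreal \<bar>m t u\<bar> \<partial>lborel) * ennreal \<bar>f (x + u)\<bar> \<partial>lborel)"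
      by (simp add: abs_mult ennreal_mult nn_integral_multc)
    also have "\<dots> \<le> (\<integral>\<^sup>+u. ennreal C * ennreal (kappa u * \<bar>f (x + u)\<bar>) \<partial>lborel)"
    proof (rule nn_integral_mono)
      fix u
      have "(\<integral>\<^sup>+t. ennreal \<bar>m t u\<bar> \<partial>lborel) * ennreal \<bar>f (x + u)\<bar> \<le> ennreal (C * kappa u) * ennreal \<bar>f (x + u)\<bar>"
        by (intro mult_right_mono bd) auto
      then show "(\<integral>\<^sup>+t. ennreal \<bar>m t u\<bar> \<partial>lborel) * ennreal \<bar>f (x + u)\<bar> \<le> ennreal C * ennreal (kappa u * \<bar>f (x + u)\<bar>)"
        using \<open>C \<ge> 0\<close> by (simp add: ennreal_mult mult.assoc)
    qed
    also have "\<dots> = ennreal C * kconv f x"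
      by (simp add: nn_integral_cmult kconv_def)
    also have "\<dots> < \<infinity>"
      using kconv_finite[OF f, of x] by (simp add: ennreal_mult_less_top)
    finally show "(\<integral>\<^sup>+ z. ennreal (norm (case z of (u, t) \<Rightarrow> m t u * f (x + u))) \<partial>(lborel \<Otimes>\<^sub>M lborel)) < \<infinity>" .
  qed
  have "(\<integral>t. corr (m t) f x \<partial>lborel) = (\<integral>u. (\<integral>t. m t u * f (x + u) \<partial>lborel) \<partial>lborel)"
    unfolding corr_def using lborel_pair.Fubini_integral[OF int] by simp
  also have "\<dots> = corr (\<lambda>u. \<integral>t. m t u \<partial>lborel) f x"
    by (simp add: corr_def)
  finally show ?thesis .
qed

lemma corr_corr:
  assumes k: "kappa_kernel C k" and l: "kappa_kernel D l" and f: "unif_loc_int f"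
  shows "corr k (corr l f) x = corr (\<lambda>u. \<integral>t. k t * l (u - t) \<partial>lborel) f x"
proof -
  note [measurable] = kernel_measurable[OF k] kernel_measurable[OF l] unif_loc_int_measurable[OF f]
  have CD: "C \<ge> 0" "D \<ge> 0" using kernel_nonneg_const k l by auto
  have "k t * corr l f (x + t) = corr (\<lambda>u. k t * l (u - t)) f x" for t
  proof -
    have "(\<integral>u. l (u - t) * f (x + u) \<partial>lborel) = (\<integral>s. l (t + s - t) * f (x + (t + s)) \<partial>lborel)"
      using lborel_integral_real_affine[of 1 "\<lambda>u. l (u - t) * f (x + u)" t] by simp
    then show ?thesis by (simp add: corr_def mult.assoc add.assoc)
  qed
  then have "corr k (corr l f) x = (\<integral>t. corr (\<lambda>u. k t * l (u - t)) f x \<partial>lborel)"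
    unfolding corr_def[of k "corr l f" x] by simp
  also have "\<dots> = corr (\<lambda>u. \<integral>t. k t * l (u - t) \<partial>lborel) f x"
  proof (rule corr_family[OF _ f])
    show "0 \<le> C * D * 8" using CD by simp
    fix u
    have "(\<integral>\<^sup>+t. ennreal \<bar>k t * l (u - t)\<bar> \<partial>lborel)
       \<le> (\<integral>\<^sup>+t. ennreal (C * D) * ennreal (kappa t * kappa (u - t)) \<partial>lborel)"
    proof (rule nn_integral_mono)
      fix t
      have "\<bar>k t * l (u - t)\<bar> \<le> (C * kappa t) * (D * kappa (u - t))"
        using k l CD unfolding kappa_kernel_def abs_mult by (intro mult_mono) auto
      then show "ennreal \<bar>k t * l (u - t)\<bar> \<le> ennreal (C * D) * ennreal (kappa t * kappa (u - t))"
        using CD by (subst ennreal_mult[symmetric]) (auto intro!: ennreal_leI simp: mult_ac)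
    qed
    also have "\<dots> = ennreal (C * D) * (\<integral>\<^sup>+t. ennreal (kappa t * kappa (u - t)) \<partial>lborel)"
      by (rule nn_integral_cmult) measurable
    also have "\<dots> \<le> ennreal (C * D) * ennreal (8 * kappa u)"
      by (intro mult_left_mono nn_integral_kappa_kappa) auto
    also have "\<dots> = ennreal (C * D * 8 * kappa u)"
      using CD by (subst ennreal_mult[symmetric]) (auto simp: mult_ac)
    finally show "(\<integral>\<^sup>+t. ennreal \<bar>k t * l (u - t)\<bar> \<partial>lborel) \<le> ennreal (C * D * 8 * kappa u)" .
  qed measurable
  finally show ?thesis .
qed

lemma corr_commute:
  assumes k: "kappa_kernel C k" and l: "kappa_kernel D l" and f: "unif_loc_int f"
  shows "corr k (corr l f) x = corr l (corr k f) x"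
proof -
  have "(\<integral>t. k t * l (u - t) \<partial>lborel) = (\<integral>t. l t * k (u - t) \<partial>lborel)" for u
    using lborel_integral_real_affine[of "-1" "\<lambda>t. k t * l (u - t)" u] by (simp add: mult.commute)
  then show ?thesis
    using corr_corr[OF k l f] corr_corr[OF l k f] by simp
qed

section \<open>An equation for the triangular mean\<close>

lemma kernel_of_bounded_support:
  assumes [measurable]: "k \<in> borel_measurable borel"
    and bd: "\<And>t. \<bar>k t\<bar> \<le> M" and supp: "\<And>t. k t \<noteq> 0 \<Longrightarrow> \<bar>t\<bar> \<le> n"
  shows "kappa_kernel (M * (1 + n)\<^sup>2) k"
  unfolding kappa_kernel_def
proof (intro conjI allI)
  fix t
  have M: "M \<ge> 0" using bd[of 0] by simp
  show "\<bar>k t\<bar> \<le> M * (1 + n)\<^sup>2 * kappa t"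
  proof (cases "k t = 0")
    case False
    then have "\<bar>t\<bar> \<le> n" by (rule supp)
    then have "(1 + \<bar>t\<bar>)\<^sup>2 \<le> (1 + n)\<^sup>2" by (intro power_mono) auto
    moreover have "(1 + \<bar>t\<bar>)\<^sup>2 > 0" by (simp add: add_pos_nonneg)
    ultimately have "1 \<le> (1 + n)\<^sup>2 * kappa t" by (simp add: kappa_def field_simps)
    then have "M * 1 \<le> M * ((1 + n)\<^sup>2 * kappa t)" by (rule mult_left_mono[OF _ M])
    then show ?thesis using bd[of t] by (simp add: mult.assoc)
  qed (use M in simp)
qed measurable

definition unit_ind :: "real \<Rightarrow> real" where
  "unit_ind t = indicator {0..1} t"

definition tri :: "real \<Rightarrow> real" where
  "tri t = 2 * (1 - t) * indicator {0..1} t"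

lemma unit_ind_measurable [measurable]: "unit_ind \<in> borel_measurable borel"
  unfolding unit_ind_def[abs_def] by measurable

lemma tri_measurable [measurable]: "tri \<in> borel_measurable borel"
  unfolding tri_def[abs_def] by measurable

lemma kernel_unit_ind: "kappa_kernel 4 unit_ind"
  using kernel_of_bounded_support[of unit_ind 1 1] by (auto simp: unit_ind_def indicator_def)

lemma kernel_tri: "kappa_kernel 8 tri"
  using kernel_of_bounded_support[of tri 2 1] by (auto simp: tri_def indicator_def)

lemma kernel_indicator:
  assumes "A \<in> sets borel" "A \<subseteq> {-n..n}"
  shows "kappa_kernel ((1 + n)\<^sup>2) (indicator A)"
proof -
  have "kappa_kernel (1 * (1 + n)\<^sup>2) (indicator A)"
    by (rule kernel_of_bounded_support)
       (use assms(1) in \<open>auto simp: indicator_def abs_le_iff split: if_splits dest!: subsetD[OF assms(2)]\<close>)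
  then show ?thesis by simp
qed

lemma kernel_tri_shift: "kappa_kernel (2 * (1 + (1 + \<bar>t\<bar>))\<^sup>2) (\<lambda>u. tri (u - t))"
  by (rule kernel_of_bounded_support) (auto simp: tri_def indicator_def split: if_splits)

definition avg :: "(real \<Rightarrow> real) \<Rightarrow> real \<Rightarrow> real" where
  "avg = corr unit_ind"

definition smooth :: "(real \<Rightarrow> real) \<Rightarrow> real \<Rightarrow> real" where
  "smooth = corr tri"

definition defect :: "(real \<Rightarrow> real) \<Rightarrow> real \<Rightarrow> real" where
  "defect f x = f x - avg f x"

lemma unif_loc_int_avg: "unif_loc_int f \<Longrightarrow> unif_loc_int (avg f)"
  unfolding avg_def by (rule unif_loc_int_corr[OF kernel_unit_ind])

lemma unif_loc_int_smooth: "unif_loc_int f \<Longrightarrow> unif_loc_int (smooth f)"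
  unfolding smooth_def by (rule unif_loc_int_corr[OF kernel_tri])

lemma unif_loc_int_defect: "unif_loc_int f \<Longrightarrow> unif_loc_int (defect f)"
  unfolding defect_def[abs_def] by (intro unif_loc_int_diff unif_loc_int_avg)

lemma smooth_shift: "smooth f (x + t) = corr (\<lambda>u. tri (u - t)) f x"
  using lborel_integral_real_affine[of 1 "\<lambda>u. tri (u - t) * f (x + u)" t]
  by (simp add: smooth_def corr_def add.assoc)

text \<open>The kernel of the mean over \<open>[0, t)\<close> composed with the unit Steklov mean.\<close>

lemma overlap_length:
  assumes "t \<ge> 0"
  shows "(\<integral>s. indicator {0..<t} s * unit_ind (u - s) \<partial>lborel) = max 0 (min t u - max 0 (u - 1))"
proof -
  have "(\<integral>s. indicator {0..<t} s * unit_ind (u - s) \<partial>lborel)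
      = (\<integral>s. indicator ({0..<t} \<inter> {u - 1..u}) s \<partial>lborel)"
    by (intro Bochner_Integration.integral_cong) (auto simp: unit_ind_def indicator_def)
  also have "\<dots> = measure lborel ({0..<t} \<inter> {u - 1..u})"
    by simp
  also have "\<dots> = max 0 (min t u - max 0 (u - 1))"
  proof (cases "u < t")
    case True
    then have "{0..<t} \<inter> {u - 1..u} = {max 0 (u - 1)..u}" by auto
    then show ?thesis using True by (cases "max 0 (u - 1) \<le> u") auto
  next
    case False
    then have "{0..<t} \<inter> {u - 1..u} = {max 0 (u - 1)..<t}" by auto
    then show ?thesis using False by (cases "max 0 (u - 1) \<le> t") auto
  qed
  finally show ?thesis .
qed

lemma tri_difference:
  assumes "t \<ge> 0"
  shows "tri u - tri (u - t) = 2 * (indicator {0..<t} u - max 0 (min t u - max 0 (u - 1)))"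
  using assms by (auto simp: tri_def indicator_def max_def min_def)

text \<open>The derivative of the triangular mean is \<open>- 2\<close> times the defect, stated in integrated form
  because \<open>f\<close> is merely measurable. After Fubini it is the identity \<open>tri_difference\<close> between kernels.\<close>

lemma smooth_increment:
  assumes f: "unif_loc_int f" and t: "t \<ge> 0"
  shows "smooth f x - smooth f (x + t) = 2 * corr (indicator {0..<t}) (defect f) x"
proof -
  note [measurable] = unif_loc_int_measurable[OF f]
  have ki: "kappa_kernel ((1 + t)\<^sup>2) (indicator {0..<t})"
    by (rule kernel_indicator) auto
  define w where "w u = max 0 (min t u - max 0 (u - 1))" for u :: real
  have [measurable]: "w \<in> borel_measurable borel" unfolding w_def[abs_def] by measurable
  have kw: "kappa_kernel (t * (1 + (1 + t))\<^sup>2) w"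
    by (rule kernel_of_bounded_support) (use t in \<open>auto simp: w_def max_def min_def split: if_splits\<close>)
  have "smooth f x - smooth f (x + t) = corr (\<lambda>u. tri u - tri (u - t)) f x"
    using corr_diff_kernel[OF kernel_tri kernel_tri_shift f] by (simp add: smooth_shift) (simp add: smooth_def)
  also have "\<dots> = 2 * corr (\<lambda>u. indicator {0..<t} u - w u) f x"
    by (simp only: tri_difference[OF t] w_def corr_cmult_kernel)
  also have "corr (\<lambda>u. indicator {0..<t} u - w u) f x = corr (indicator {0..<t}) f x - corr w f x"
    by (rule corr_diff_kernel[OF ki kw f])
  also have "corr w f x = corr (indicator {0..<t}) (avg f) x"
    unfolding avg_def corr_corr[OF ki kernel_unit_ind f] overlap_length[OF t] w_def ..
  also have "corr (indicator {0..<t}) f x - corr (indicator {0..<t}) (avg f) x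
      = corr (indicator {0..<t}) (defect f) x"
    unfolding defect_def[abs_def] by (rule corr_diff[OF ki f unif_loc_int_avg[OF f], symmetric])
  finally show ?thesis .
qed

lemma nn_integral_tri_tail:
  "(\<integral>\<^sup>+t. ennreal \<bar>2 * tri t * indicator {0..<t} u\<bar> \<partial>lborel) = ennreal (2 * (1 - u)\<^sup>2 * unit_ind u)"
proof (cases "0 \<le> u \<and> u \<le> 1")
  case True
  have "(\<integral>\<^sup>+t. ennreal \<bar>2 * tri t * indicator {0..<t} u\<bar> \<partial>lborel)
     = (\<integral>\<^sup>+t. ennreal (4 * (1 - t)) * indicator {u..1} t \<partial>lborel)"
    by (intro nn_integral_cong_AE eventually_mono[OF AE_lborel_singleton[of u]])
       (use True in \<open>auto simp: tri_def indicator_def\<close>)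
  also have "\<dots> = ennreal ((- 2 * (1 - 1)\<^sup>2) - (- 2 * (1 - u)\<^sup>2))"
  proof (rule nn_integral_FTC_Icc)
    show "DERIV (\<lambda>t. - 2 * (1 - t)\<^sup>2) x :> 4 * (1 - x)" for x :: real
      by (auto intro!: derivative_eq_intros)
  qed (use True in auto)
  finally show ?thesis using True by (simp add: unit_ind_def)
next
  case False
  then have z: "2 * tri t * indicator {0..<t} u = 0" for t
    by (auto simp: tri_def indicator_def)
  show ?thesis unfolding z using False by (simp add: unit_ind_def)
qed

lemma integral_tri_tail:
  "(\<integral>t. 2 * tri t * indicator {0..<t} u \<partial>lborel) = 2 * (1 - u)\<^sup>2 * unit_ind u"
proof -
  have nn: "2 * tri t * indicator {0..<t} u \<ge> 0" for t
    by (auto simp: tri_def indicator_def)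
  have [measurable]: "(\<lambda>t. indicator {0..<t} u :: real) \<in> borel_measurable borel"
  proof -
    have "(\<lambda>t. indicator {0..<t} u :: real) = (if 0 \<le> u then indicator {u<..} else (\<lambda>_. 0))"
      by (auto simp: indicator_def fun_eq_iff)
    then show ?thesis by auto
  qed
  have "(\<integral>t. 2 * tri t * indicator {0..<t} u \<partial>lborel)
     = enn2real (\<integral>\<^sup>+t. ennreal (2 * tri t * indicator {0..<t} u) \<partial>lborel)"
    by (rule integral_eq_nn_integral) (use nn in auto)
  also have "\<dots> = enn2real (ennreal (2 * (1 - u)\<^sup>2 * unit_ind u))"
    using nn_integral_tri_tail[of u] nn by simp
  finally show ?thesis by (simp add: unit_ind_def)
qed

lemma integral_tri: "(\<integral>t. tri t \<partial>lborel) = 1"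
proof -
  have "(\<integral>t. tri t \<partial>lborel) = (\<integral>t. tri t * indicator {0..<t} 0 \<partial>lborel)"
    by (intro integral_cong_AE eventually_mono[OF AE_lborel_singleton[of 0]])
       (auto simp: tri_def indicator_def)
  also have "\<dots> = 1 / 2 * (\<integral>t. 2 * tri t * indicator {0..<t} 0 \<partial>lborel)"
    by (simp add: mult.assoc)
  finally show ?thesis unfolding integral_tri_tail by (simp add: unit_ind_def)
qed

text \<open>Write the left-hand side as the mean of the increments \<open>smooth f x - smooth f (x + t)\<close>, insert
  \<open>smooth_increment\<close> and exchange the integrals.\<close>

lemma smooth_minus_smooth_smooth:
  assumes f: "unif_loc_int f"
  shows "smooth f x - smooth (smooth f) x = corr (\<lambda>u. 2 * (1 - u)\<^sup>2 * unit_ind u) (defect f) x"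
proof -
  note S = unif_loc_int_smooth[OF f]
  have it: "integrable lborel tri"
    using integral_tri not_integrable_integral_eq by fastforce
  have "smooth f x - smooth (smooth f) x
      = (\<integral>t. tri t * smooth f x \<partial>lborel) - (\<integral>t. tri t * smooth f (x + t) \<partial>lborel)"
    using integral_tri by (simp add: smooth_def corr_def)
  also have "\<dots> = (\<integral>t. tri t * (smooth f x - smooth f (x + t)) \<partial>lborel)"
    using it kernel_integrable[OF kernel_tri S, of x] by (simp add: right_diff_distrib)
  also have "\<dots> = (\<integral>t. corr (\<lambda>u. 2 * tri t * indicator {0..<t} u) (defect f) x \<partial>lborel)"
  proof (rule Bochner_Integration.integral_cong)
    fix t :: real
    show "tri t * (smooth f x - smooth f (x + t)) = corr (\<lambda>u. 2 * tri t * indicator {0..<t} u) (defect f) x"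
    proof (cases "t \<ge> 0")
      case True
      then show ?thesis
        by (simp add: smooth_increment[OF f] corr_cmult_kernel mult.assoc)
    next
      case False
      then have "tri t = 0" by (simp add: tri_def)
      then show ?thesis by (simp add: corr_def)
    qed
  qed simp
  also have "\<dots> = corr (\<lambda>u. \<integral>t. 2 * tri t * indicator {0..<t} u \<partial>lborel) (defect f) x"
  proof (rule corr_family[OF _ unif_loc_int_defect[OF f], of _ 8])
    have eq: "(\<lambda>(t, u). 2 * tri t * indicator {0..<t} u)
        = (\<lambda>z::real\<times>real. 2 * tri (fst z) * (if 0 \<le> snd z \<and> snd z < fst z then 1 else 0))"
      by (auto simp: fun_eq_iff indicator_def)
    show "(\<lambda>(t, u). 2 * tri t * indicator {0..<t} u) \<in> borel_measurable (borel \<Otimes>\<^sub>M borel)"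
      unfolding eq by measurable
    fix u
    have "2 * (1 - u)\<^sup>2 * unit_ind u \<le> 2 * (4 * kappa u)"
    proof -
      have "(1 - u)\<^sup>2 * unit_ind u \<le> 1 * unit_ind u"
        by (auto simp: unit_ind_def indicator_def power_le_one)
      also have "\<dots> \<le> 4 * kappa u"
        using kernel_unit_ind by (simp add: kappa_kernel_def abs_le_iff)
      finally show ?thesis by (simp add: mult_ac)
    qed
    then show "(\<integral>\<^sup>+t. ennreal \<bar>2 * tri t * indicator {0..<t} u\<bar> \<partial>lborel) \<le> ennreal (8 * kappa u)"
      unfolding nn_integral_tri_tail by (intro ennreal_leI) simp
  qed simp
  also have "\<dots> = corr (\<lambda>u. 2 * (1 - u)\<^sup>2 * unit_ind u) (defect f) x"
    unfolding integral_tri_tail ..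
  finally show ?thesis .
qed

text \<open>Decompose \<open>G\<close> as \<open>(avg G - smooth G) + (G - avg G) + smooth G\<close>. The second summand equals
  \<open>defect f - smooth (defect f)\<close> because the two means commute, the third is given by
  \<open>smooth_minus_smooth_smooth\<close>, and their kernels combine to \<open>2 t (1 - t)\<close>. What makes the equation useful is that the kernel \<open>2 t - 1\<close> in front of \<open>G\<close> has \<open>L\<^sup>1\<close> norm one half.\<close>

lemma remainder_equation:
  assumes f: "unif_loc_int f"
  defines "G \<equiv> \<lambda>x. f x - smooth f x"
  shows "G x = corr (\<lambda>t. (2 * t - 1) * unit_ind t) G x + defect f x
     - corr (\<lambda>t. 2 * t * (1 - t) * unit_ind t) (defect f) x"
proof -
  note S = unif_loc_int_smooth[OF f] and T = unif_loc_int_avg[OF f] and D = unif_loc_int_defect[OF f]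
  have G: "unif_loc_int G" unfolding G_def by (rule unif_loc_int_diff[OF f S])
  have kq: "kappa_kernel (2 * (1 + 1)\<^sup>2) (\<lambda>u. 2 * (1 - u)\<^sup>2 * unit_ind u)"
    by (rule kernel_of_bounded_support) (auto simp: unit_ind_def indicator_def power_le_one)
  have e: "(\<lambda>t. (2 * t - 1) * unit_ind t) = (\<lambda>t. unit_ind t - tri t)"
    by (auto simp: fun_eq_iff unit_ind_def tri_def algebra_simps)
  have l: "(\<lambda>t. 2 * t * (1 - t) * unit_ind t) = (\<lambda>t. tri t - 2 * (1 - t)\<^sup>2 * unit_ind t)"
    by (auto simp: fun_eq_iff unit_ind_def tri_def indicator_def algebra_simps power2_eq_square)
  have "corr (\<lambda>t. (2 * t - 1) * unit_ind t) G x = avg G x - smooth G x"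
    unfolding e avg_def smooth_def by (rule corr_diff_kernel[OF kernel_unit_ind kernel_tri G])
  moreover have "avg G x = avg f x - avg (smooth f) x"
    unfolding G_def avg_def by (rule corr_diff[OF kernel_unit_ind f S])
  moreover have "smooth G x = smooth f x - smooth (smooth f) x"
    unfolding G_def by (subst (1 2 3) smooth_def) (rule corr_diff[OF kernel_tri f S])
  moreover have "avg (smooth f) x = smooth (avg f) x"
    unfolding avg_def smooth_def by (rule corr_commute[OF kernel_unit_ind kernel_tri f])
  moreover have "smooth (defect f) x = smooth f x - smooth (avg f) x"
    unfolding defect_def[abs_def] smooth_def by (rule corr_diff[OF kernel_tri f T])
  moreover have "corr (\<lambda>t. 2 * t * (1 - t) * unit_ind t) (defect f) x
      = smooth (defect f) x - corr (\<lambda>u. 2 * (1 - u)\<^sup>2 * unit_ind u) (defect f) x"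
    unfolding l smooth_def by (rule corr_diff_kernel[OF kernel_tri kq D])
  moreover note smooth_minus_smooth_smooth[OF f, of x]
  ultimately show ?thesis unfolding G_def defect_def by simp
qed

section \<open>Inverting the equation by contraction\<close>

text \<open>A kernel supported in \<open>[0, 1]\<close> moves mass by at most one unit, so its \<open>n\<close>-fold iterate is
  controlled by integrals over \<open>[0, n]\<close>; these are the majorants that the Neumann series needs.\<close>

definition run :: "nat \<Rightarrow> (real \<Rightarrow> ennreal) \<Rightarrow> real \<Rightarrow> ennreal" where
  "run n h x = (\<integral>\<^sup>+t. h (x + t) * indicator {0..real n} t \<partial>lborel)"

lemma run_measurable [measurable]:
  assumes [measurable]: "h \<in> borel_measurable borel"
  shows "run n h \<in> borel_measurable borel"
  unfolding run_def[abs_def] by measurable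

lemma run_shift_le:
  assumes [measurable]: "h \<in> borel_measurable borel" and s: "0 \<le> s" "s \<le> 1"
  shows "run n h (x + s) \<le> run (Suc n) h x"
proof -
  have "run n h (x + s) = (\<integral>\<^sup>+t. h (x + (s + t)) * indicator {0..real n} (s + t - s) \<partial>lborel)"
    by (simp add: run_def add.assoc)
  also have "\<dots> = (\<integral>\<^sup>+t. h (x + t) * indicator {0..real n} (t - s) \<partial>lborel)"
    by (rule nn_integral_shift[of "\<lambda>t. h (x + t) * indicator {0..real n} (t - s)"]) measurable
  also have "\<dots> \<le> run (Suc n) h x"
    unfolding run_def
    by (intro nn_integral_mono mult_left_mono) (use s in \<open>auto simp: indicator_def\<close>)
  finally show ?thesis .
qed

lemma run_le_kconv:
  assumes [measurable]: "f \<in> borel_measurable borel"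
  shows "run n (\<lambda>x. ennreal \<bar>f x\<bar>) x \<le> ennreal ((1 + real n)\<^sup>2) * kconv f x"
proof -
  have k: "kappa_kernel ((1 + real n)\<^sup>2) (indicator {0..real n})"
    by (rule kernel_indicator) auto
  have "run n (\<lambda>x. ennreal \<bar>f x\<bar>) x = (\<integral>\<^sup>+t. ennreal \<bar>indicator {0..real n} t * f (x + t)\<bar> \<partial>lborel)"
    unfolding run_def by (intro nn_integral_cong) (auto simp: indicator_def)
  also have "\<dots> \<le> ennreal ((1 + real n)\<^sup>2) * kconv f x"
    by (rule nn_integral_kernel_le[OF k]) measurable
  finally show ?thesis .
qed

lemma nn_integral_abs_mean_zero_kernel:
  "(\<integral>\<^sup>+t. ennreal \<bar>(2 * t - 1) * unit_ind t\<bar> \<partial>lborel) \<le> ennreal (1 / 2)"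
proof -
  have "(\<integral>\<^sup>+t. ennreal \<bar>(2 * t - 1) * unit_ind t\<bar> \<partial>lborel)
     \<le> (\<integral>\<^sup>+t. ennreal (1 - 2 * t) * indicator {0..1/2} t + ennreal (2 * t - 1) * indicator {1/2..1} t \<partial>lborel)"
    by (intro nn_integral_mono) (auto simp: unit_ind_def indicator_def abs_mult split: if_splits)
  also have "\<dots> = (\<integral>\<^sup>+t. ennreal (1 - 2 * t) * indicator {0..1/2} t \<partial>lborel)
     + (\<integral>\<^sup>+t. ennreal (2 * t - 1) * indicator {1/2..1} t \<partial>lborel)"
    by (rule nn_integral_add) measurable
  also have "(\<integral>\<^sup>+t. ennreal (1 - 2 * t) * indicator {0..1/2} t \<partial>lborel)
      = ennreal ((1/2 - (1/2)\<^sup>2) - (0 - 0\<^sup>2))"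
    by (rule nn_integral_FTC_Icc[where F="\<lambda>t. t - t\<^sup>2"]) (auto intro!: derivative_eq_intros)
  also have "(\<integral>\<^sup>+t. ennreal (2 * t - 1) * indicator {1/2..1} t \<partial>lborel)
      = ennreal ((1\<^sup>2 - 1) - ((1/2)\<^sup>2 - (1/2)))"
    by (rule nn_integral_FTC_Icc[where F="\<lambda>t. t\<^sup>2 - t"]) (auto intro!: derivative_eq_intros)
  finally show ?thesis
    by (simp add: power2_eq_square flip: ennreal_plus)
qed

text \<open>The \<open>N\<close>-th partial sum of the Neumann series, with its remainder. Each further application of
  the kernel \<open>w\<close> halves the coefficients and lengthens the window by one (\<open>run_shift_le\<close>); this
  fixes the coefficients \<open>3 / 2 / 2 ^ n\<close>, of which the first has to absorb the contributions
  \<open>1 / 2\<close> of the source term and \<open>1\<close> of \<open>w\<close>.\<close>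

lemma contraction_iterate:
  assumes [measurable]: "a \<in> borel_measurable borel" "g \<in> borel_measurable borel" "w \<in> borel_measurable borel"
    and w_supp: "\<And>s. w s \<noteq> 0 \<Longrightarrow> 0 \<le> s \<and> s \<le> 1" and w_le: "\<And>s. w s \<le> 1"
    and w_int: "(\<integral>\<^sup>+s. w s \<partial>lborel) \<le> ennreal (1 / 2)"
    and step: "\<And>x. g x \<le> a x + ennreal (1/2) * run 1 a x + (\<integral>\<^sup>+s. w s * g (x + s) \<partial>lborel)"
  shows "g x \<le> a x + (\<Sum>n<N. ennreal (3 / 2 / 2 ^ n) * run (Suc n) a x)
      + ennreal (1 / 2 ^ N) * (run (Suc N) a x + run (Suc N) g x)"
proof -
  have w1: "(\<integral>\<^sup>+s. w s * h (x + s) \<partial>lborel) \<le> run 1 h x" for h x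
    unfolding run_def
  proof (rule nn_integral_mono)
    fix s
    show "w s * h (x + s) \<le> h (x + s) * indicator {0..real 1} s"
      using w_supp[of s] mult_right_mono[OF w_le[of s], of "h (x + s)"]
      by (cases "w s = 0") (auto simp: mult.commute)
  qed
  show ?thesis
  proof (induction N arbitrary: x)
    case 0
    have "ennreal (1/2) * run 1 a x \<le> 1 * run 1 a x"
    proof (rule mult_right_mono)
      show "ennreal (1/2) \<le> 1" unfolding ennreal_le_1 by simp
    qed simp
    then show ?case
      using order_trans[OF step[of x] add_mono[OF add_left_mono w1]]
      by (simp add: add.assoc)
  next
    case (Suc N)
    have half: "(\<integral>\<^sup>+s. w s * run n h (x + s) \<partial>lborel) \<le> ennreal (1/2) * run (Suc n) h x"
      if [measurable]: "h \<in> borel_measurable borel" for n h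
    proof -
      have "(\<integral>\<^sup>+s. w s * run n h (x + s) \<partial>lborel) \<le> (\<integral>\<^sup>+s. w s * run (Suc n) h x \<partial>lborel)"
      proof (rule nn_integral_mono)
        fix s
        show "w s * run n h (x + s) \<le> w s * run (Suc n) h x"
        proof (cases "w s = 0")
          case False
          then show ?thesis using w_supp[of s] run_shift_le[of h s n x] by (intro mult_left_mono) auto
        qed simp
      qed
      also have "\<dots> = (\<integral>\<^sup>+s. w s \<partial>lborel) * run (Suc n) h x"
        by (rule nn_integral_multc) measurable
      also have "\<dots> \<le> ennreal (1/2) * run (Suc n) h x"
        by (intro mult_right_mono w_int) auto
      finally show ?thesis .
    qed
    have "(\<integral>\<^sup>+s. w s * g (x + s) \<partial>lborel) \<le> (\<integral>\<^sup>+s. w s * (a (x + s)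
        + (\<Sum>n<N. ennreal (3 / 2 / 2 ^ n) * run (Suc n) a (x + s))
        + ennreal (1 / 2 ^ N) * (run (Suc N) a (x + s) + run (Suc N) g (x + s))) \<partial>lborel)"
      by (intro nn_integral_mono mult_left_mono Suc.IH) auto
    also have "\<dots> = (\<integral>\<^sup>+s. w s * a (x + s)
        + (\<Sum>n<N. ennreal (3 / 2 / 2 ^ n) * (w s * run (Suc n) a (x + s)))
        + ennreal (1 / 2 ^ N) * (w s * run (Suc N) a (x + s) + w s * run (Suc N) g (x + s)) \<partial>lborel)"
      by (intro nn_integral_cong) (simp add: distrib_left sum_distrib_left mult_ac)
    also have "\<dots> = (\<integral>\<^sup>+s. w s * a (x + s) \<partial>lborel)
        + (\<Sum>n<N. ennreal (3 / 2 / 2 ^ n) * (\<integral>\<^sup>+s. w s * run (Suc n) a (x + s) \<partial>lborel))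
        + ennreal (1 / 2 ^ N) * ((\<integral>\<^sup>+s. w s * run (Suc N) a (x + s) \<partial>lborel) + (\<integral>\<^sup>+s. w s * run (Suc N) g (x + s) \<partial>lborel))"
      by (simp add: nn_integral_add nn_integral_sum nn_integral_cmult)
    also have "\<dots> \<le> run 1 a x
        + (\<Sum>n<N. ennreal (3 / 2 / 2 ^ n) * (ennreal (1/2) * run (Suc (Suc n)) a x))
        + ennreal (1 / 2 ^ N) * (ennreal (1/2) * run (Suc (Suc N)) a x + ennreal (1/2) * run (Suc (Suc N)) g x)"
      by (intro add_mono mult_left_mono sum_mono half w1) auto
    also have "\<dots> = run 1 a x
        + (\<Sum>n<N. ennreal (3 / 2 / 2 ^ Suc n) * run (Suc (Suc n)) a x)
        + ennreal (1 / 2 ^ Suc N) * (run (Suc (Suc N)) a x + run (Suc (Suc N)) g x)"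
    proof -
      have "ennreal (c / 2 ^ n) * (ennreal (1/2) * y) = ennreal (c / 2 ^ Suc n) * y" if "c \<ge> 0" for c n y
      proof -
        have "ennreal (c / 2 ^ Suc n) = ennreal (c / 2 ^ n * (1/2))" by (simp add: mult.commute)
        also have "\<dots> = ennreal (c / 2 ^ n) * ennreal (1/2)"
          by (rule ennreal_mult) (use that in auto)
        finally show ?thesis by (simp only: mult.assoc)
      qed
      note e = this[of "3/2"] this[of 1]
      show ?thesis by (simp only: distrib_left e zero_le_one)
    qed
    finally have "g x \<le> a x + ennreal (1/2) * run 1 a x + (run 1 a x
        + (\<Sum>n<N. ennreal (3 / 2 / 2 ^ Suc n) * run (Suc (Suc n)) a x)
        + ennreal (1 / 2 ^ Suc N) * (run (Suc (Suc N)) a x + run (Suc (Suc N)) g x))"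
      using order_trans[OF step[of x] add_left_mono] by blast
    also have "\<dots> = a x + ((ennreal (1/2) + 1) * run 1 a x
        + (\<Sum>n<N. ennreal (3 / 2 / 2 ^ Suc n) * run (Suc (Suc n)) a x))
        + ennreal (1 / 2 ^ Suc N) * (run (Suc (Suc N)) a x + run (Suc (Suc N)) g x)"
      by (simp only: distrib_right add_ac mult_1_left)
    also have "ennreal (1/2) + 1 = ennreal (3 / 2 / 2 ^ 0)"
      using ennreal_plus[of "1/2" 1] by (simp del: ennreal_half ennreal_plus)
    also have "ennreal (3 / 2 / 2 ^ 0) * run 1 a x + (\<Sum>n<N. ennreal (3 / 2 / 2 ^ Suc n) * run (Suc (Suc n)) a x)
       = (\<Sum>n<Suc N. ennreal (3 / 2 / 2 ^ n) * run (Suc n) a x)"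
      by (simp only: sum.lessThan_Suc_shift One_nat_def)
    finally show ?case .
  qed
qed

lemma sum_square_over_power2:
  "(\<Sum>n<N. 3 / 2 / 2 ^ n * (2 + real n)\<^sup>2) = 33 - 3 * (real N ^ 2 + 6 * real N + 11) / 2 ^ N"
  by (induction N) (auto simp: field_simps power2_eq_square)

text \<open>Let \<open>N\<close> tend to infinity in \<open>contraction_iterate\<close>. A window of length \<open>n + 1\<close> costs the
  factor \<open>(2 + n)\<^sup>2\<close> against \<open>kappa\<close>, which the geometric weights outweigh; 33 is the sum of the series.\<close>

lemma remainder_bound:
  assumes f: "unif_loc_int f"
  shows "ennreal \<bar>f x - smooth f x\<bar> \<le> ennreal \<bar>defect f x\<bar> + 33 * kconv (defect f) x"
proof -
  define G where "G = (\<lambda>x. f x - smooth f x)"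
  define e l where "e = (\<lambda>t. (2 * t - 1) * unit_ind t)" and "l = (\<lambda>t. 2 * t * (1 - t) * unit_ind t)"
  note D = unif_loc_int_defect[OF f]
  have G: "unif_loc_int G" unfolding G_def by (rule unif_loc_int_diff[OF f unif_loc_int_smooth[OF f]])
  note [measurable] = unif_loc_int_measurable[OF D] unif_loc_int_measurable[OF G]
  have [measurable]: "e \<in> borel_measurable borel" "l \<in> borel_measurable borel"
    unfolding e_def l_def by measurable
  define a g where "a = (\<lambda>x. ennreal \<bar>defect f x\<bar>)" and "g = (\<lambda>x. ennreal \<bar>G x\<bar>)"
  have [measurable]: "a \<in> borel_measurable borel" "g \<in> borel_measurable borel"
    unfolding a_def g_def by measurable
  have step: "g x \<le> a x + ennreal (1/2) * run 1 a x + (\<integral>\<^sup>+s. ennreal \<bar>e s\<bar> * g (x + s) \<partial>lborel)" for x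
  proof -
    have "\<bar>G x\<bar> \<le> \<bar>defect f x\<bar> + \<bar>corr l (defect f) x\<bar> + \<bar>corr e G x\<bar>"
      using remainder_equation[OF f, of x] unfolding G_def e_def l_def by linarith
    then have "g x \<le> a x + ennreal \<bar>corr l (defect f) x\<bar> + ennreal \<bar>corr e G x\<bar>"
      unfolding g_def a_def by (simp flip: ennreal_plus)
    also have "ennreal \<bar>corr e G x\<bar> \<le> (\<integral>\<^sup>+s. ennreal \<bar>e s\<bar> * g (x + s) \<partial>lborel)"
      using abs_corr_le_nn_integral[of e G x] by (simp add: g_def abs_mult ennreal_mult)
    also have "ennreal \<bar>corr l (defect f) x\<bar> \<le> (\<integral>\<^sup>+t. ennreal \<bar>l t * defect f (x + t)\<bar> \<partial>lborel)"
      by (rule abs_corr_le_nn_integral)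
    also have "\<dots> \<le> (\<integral>\<^sup>+t. ennreal (1/2) * (a (x + t) * indicator {0..real 1} t) \<partial>lborel)"
    proof (rule nn_integral_mono)
      fix t
      show "ennreal \<bar>l t * defect f (x + t)\<bar> \<le> ennreal (1/2) * (a (x + t) * indicator {0..real 1} t)"
      proof (cases "0 \<le> t \<and> t \<le> 1")
        case True
        have "0 \<le> (2 * t - 1)\<^sup>2" by simp
        then have "l t \<le> 1/2" using True by (simp add: l_def unit_ind_def power2_eq_square algebra_simps)
        moreover have "0 \<le> l t" using True by (simp add: l_def unit_ind_def)
        ultimately have "\<bar>l t * defect f (x + t)\<bar> \<le> 1/2 * \<bar>defect f (x + t)\<bar>"
          unfolding abs_mult by (intro mult_right_mono) auto
        then show ?thesis using True
          by (simp add: a_def ennreal_mult[symmetric] del: ennreal_half)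
      qed (auto simp: l_def unit_ind_def)
    qed
    also have "\<dots> = ennreal (1/2) * run 1 a x"
      unfolding run_def by (rule nn_integral_cmult) measurable
    finally show ?thesis by (simp add: add_left_mono add_right_mono)
  qed
  have iter: "g x \<le> a x + (\<Sum>n<N. ennreal (3 / 2 / 2 ^ n) * run (Suc n) a x)
      + ennreal (1 / 2 ^ N) * (run (Suc N) a x + run (Suc N) g x)" for N
  proof (rule contraction_iterate[OF _ _ _ _ _ _ step])
    show "(\<integral>\<^sup>+s. ennreal \<bar>e s\<bar> \<partial>lborel) \<le> ennreal (1 / 2)"
      unfolding e_def by (rule nn_integral_abs_mean_zero_kernel)
    show "ennreal \<bar>e s\<bar> \<noteq> 0 \<Longrightarrow> 0 \<le> s \<and> s \<le> 1" for s
      by (auto simp: e_def unit_ind_def indicator_def split: if_splits)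
    show "ennreal \<bar>e s\<bar> \<le> 1" for s
      by (auto simp: e_def unit_ind_def indicator_def ennreal_le_1)
  qed measurable
  obtain A where A: "kconv (defect f) x = ennreal A" "A \<ge> 0"
    using kconv_finite[OF D, of x] by (cases "kconv (defect f) x") auto
  obtain B where B: "kconv G x = ennreal B" "B \<ge> 0"
    using kconv_finite[OF G, of x] by (cases "kconv G x") auto
  (* the last summand vanishes in the limit, since kconv is finite at x for both functions *)
  have bound: "\<bar>G x\<bar> \<le> \<bar>defect f x\<bar> + 33 * A + (2 + real N)\<^sup>2 / 2 ^ N * (A + B)" for N
  proof -
    have ra: "run (Suc n) a x \<le> ennreal ((2 + real n)\<^sup>2 * A)" for n
      using run_le_kconv[OF unif_loc_int_measurable[OF D], of "Suc n" x] A
      by (simp add: a_def ennreal_mult)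
    have rg: "run (Suc n) g x \<le> ennreal ((2 + real n)\<^sup>2 * B)" for n
      using run_le_kconv[OF unif_loc_int_measurable[OF G], of "Suc n" x] B
      by (simp add: g_def ennreal_mult)
    have "g x \<le> a x + (\<Sum>n<N. ennreal (3 / 2 / 2 ^ n) * ennreal ((2 + real n)\<^sup>2 * A))
      + ennreal (1 / 2 ^ N) * (ennreal ((2 + real N)\<^sup>2 * A) + ennreal ((2 + real N)\<^sup>2 * B))"
      by (rule order_trans[OF iter[of N]]) (intro add_mono sum_mono mult_left_mono ra rg order_refl zero_le)
    also have "\<dots> = ennreal (\<bar>defect f x\<bar> + (\<Sum>n<N. 3 / 2 / 2 ^ n * ((2 + real n)\<^sup>2 * A))
      + 1 / 2 ^ N * ((2 + real N)\<^sup>2 * A + (2 + real N)\<^sup>2 * B))"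
    proof -
      have "(\<Sum>n<N. ennreal (3 / 2 / 2 ^ n) * ennreal ((2 + real n)\<^sup>2 * A))
          = (\<Sum>n<N. ennreal (3 / 2 / 2 ^ n * ((2 + real n)\<^sup>2 * A)))"
        by (intro sum.cong refl ennreal_mult[symmetric]) (use A in auto)
      also have "\<dots> = ennreal (\<Sum>n<N. 3 / 2 / 2 ^ n * ((2 + real n)\<^sup>2 * A))"
        by (rule sum_ennreal) (use A in auto)
      finally have 1: "(\<Sum>n<N. ennreal (3 / 2 / 2 ^ n) * ennreal ((2 + real n)\<^sup>2 * A))
          = ennreal (\<Sum>n<N. 3 / 2 / 2 ^ n * ((2 + real n)\<^sup>2 * A))" .
      have "ennreal (1 / 2 ^ N) * (ennreal ((2 + real N)\<^sup>2 * A) + ennreal ((2 + real N)\<^sup>2 * B))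
          = ennreal (1 / 2 ^ N) * ennreal ((2 + real N)\<^sup>2 * A + (2 + real N)\<^sup>2 * B)"
        using A B by (subst ennreal_plus) auto
      also have "\<dots> = ennreal (1 / 2 ^ N * ((2 + real N)\<^sup>2 * A + (2 + real N)\<^sup>2 * B))"
        by (rule ennreal_mult[symmetric]) (use A B in auto)
      finally show ?thesis
        unfolding a_def 1 using A B
        by (simp only: ennreal_plus abs_ge_zero sum_nonneg add_nonneg_nonneg mult_nonneg_nonneg
              divide_nonneg_nonneg zero_le_power zero_le_numeral zero_le_one of_nat_0_le_iff)
    qed
    finally have "\<bar>G x\<bar> \<le> \<bar>defect f x\<bar> + (\<Sum>n<N. 3 / 2 / 2 ^ n * ((2 + real n)\<^sup>2 * A))
      + 1 / 2 ^ N * ((2 + real N)\<^sup>2 * A + (2 + real N)\<^sup>2 * B)"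
      unfolding g_def using A B by (subst (asm) ennreal_le_iff) (auto intro!: add_nonneg_nonneg sum_nonneg)
    also have "(\<Sum>n<N. 3 / 2 / 2 ^ n * ((2 + real n)\<^sup>2 * A)) = (\<Sum>n<N. 3 / 2 / 2 ^ n * (2 + real n)\<^sup>2) * A"
      by (simp add: sum_distrib_right mult.assoc)
    also have "\<dots> \<le> 33 * A"
      unfolding sum_square_over_power2 using A by (intro mult_right_mono) auto
    finally show ?thesis by (simp add: algebra_simps add_divide_distrib)
  qed
  have "\<bar>G x\<bar> \<le> \<bar>defect f x\<bar> + 33 * A + 0 * (A + B)"
  proof (rule LIMSEQ_le_const)
    show "(\<lambda>N. \<bar>defect f x\<bar> + 33 * A + (2 + real N)\<^sup>2 / 2 ^ N * (A + B))
        \<longlonglongrightarrow> \<bar>defect f x\<bar> + 33 * A + 0 * (A + B)"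
    proof (intro tendsto_intros)
      show "(\<lambda>N. (2 + real N)\<^sup>2 / 2 ^ N) \<longlonglongrightarrow> 0" by real_asymp
    qed
  qed (use bound in auto)
  then have "ennreal \<bar>G x\<bar> \<le> ennreal (\<bar>defect f x\<bar> + 33 * A)" by (intro ennreal_leI) simp
  also have "\<dots> = ennreal \<bar>defect f x\<bar> + 33 * kconv (defect f) x"
    using A by (simp add: ennreal_mult)
  finally show ?thesis by (simp add: G_def)
qed

section \<open>The residual of a Jackson-type mean\<close>

text \<open>Polymorphic, so that the real kernel and its entire extension are instances of one function.\<close>

definition sincf :: "'a::{real_normed_field, banach} \<Rightarrow> 'a" where
  "sincf z = (if z = 0 then 1 else sin z / z)"

lemma sincf_of_real: "sincf (of_real x :: complex) = of_real (sincf x)"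
  by (simp add: sincf_def sin_of_real)

lemma sincf_measurable [measurable]: "(sincf :: real \<Rightarrow> real) \<in> borel_measurable borel"
  unfolding sincf_def[abs_def] by measurable

lemma abs_sincf_le_1: "\<bar>sincf (u::real)\<bar> \<le> 1"
  using abs_sin_x_le_abs_x[of u] by (simp add: sincf_def abs_divide divide_le_eq)

lemma abs_sincf_decay: "\<bar>u\<bar> * \<bar>sincf (u::real)\<bar> \<le> 1"
  by (simp add: sincf_def abs_divide)

lemma one_minus_half_square_le_cos: "1 - x\<^sup>2 / 2 \<le> cos (x::real)"
proof -
  have "\<bar>sin (x/2)\<bar> \<le> \<bar>x/2\<bar>" by (rule abs_sin_x_le_abs_x)
  then have "(sin (x/2))\<^sup>2 \<le> (x/2)\<^sup>2" by (simp only: abs_le_square_iff)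
  moreover have "cos x = 1 - 2 * (sin (x/2))\<^sup>2" using cos_double_sin[of "x/2"] by simp
  ultimately show ?thesis by (simp add: power2_eq_square)
qed

lemma cubic_le_sin:
  assumes "x \<ge> 0"
  shows "x - x ^ 3 / 6 \<le> sin (x::real)"
proof -
  have "sin 0 - 0 + 0 ^ 3 / 6 \<le> sin x - x + x ^ 3 / 6"
  proof (rule DERIV_nonneg_imp_nondecreasing[OF assms])
    fix y :: real
    have "DERIV (\<lambda>x. sin x - x + x ^ 3 / 6) y :> cos y - 1 + y\<^sup>2 / 2"
      by (auto intro!: derivative_eq_intros simp: power2_eq_square)
    then show "\<exists>d. DERIV (\<lambda>x. sin x - x + x ^ 3 / 6) y :> d \<and> 0 \<le> d"
      using one_minus_half_square_le_cos[of y] by (intro exI conjI) auto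
  qed
  then show ?thesis by simp
qed

lemma sincf_lower: "1 - u\<^sup>2 / 6 \<le> sincf (u::real)"
proof -
  have pos: "1 - u\<^sup>2 / 6 \<le> sin u / u" if "u > 0" for u :: real
  proof -
    have "(1 - u\<^sup>2 / 6) * u \<le> sin u"
      using cubic_le_sin[of u] that by (simp add: algebra_simps power2_eq_square power3_eq_cube)
    then show ?thesis using that by (simp add: le_divide_eq)
  qed
  show ?thesis using pos[of u] pos[of "-u"] by (cases u "0::real" rule: linorder_cases) (auto simp: sincf_def)
qed

definition fejer4 :: "'a::{real_normed_field, banach} \<Rightarrow> 'a" where
  "fejer4 z = sincf (z / 4) ^ 4"

lemma fejer4_measurable [measurable]: "(fejer4 :: real \<Rightarrow> real) \<in> borel_measurable borel"
  unfolding fejer4_def[abs_def] by measurable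

lemma fejer4_nonneg: "fejer4 (t::real) \<ge> 0"
  by (simp add: fejer4_def)

text \<open>Three of the four factors are spent on decay, so that the tails, being integrated once, are of
  the order of \<open>kappa\<close>.\<close>

lemma fejer4_le: "fejer4 (t::real) \<le> 125 / (1 + \<bar>t\<bar>) ^ 3"
proof -
  define u where "u = \<bar>t / 4\<bar>"
  define s where "s = \<bar>sincf (t / 4)\<bar>"
  have s: "0 \<le> s" "s \<le> 1" "u * s \<le> 1" and u: "u \<ge> 0"
    using abs_sincf_le_1[of "t/4"] abs_sincf_decay[of "t/4"] by (auto simp: s_def u_def)
  have "(1 + 4 * u) ^ 3 * s ^ 4 \<le> 125"
  proof -
    have "(1 + 4 * u) * s \<le> 5" using s by (simp add: algebra_simps)
    then have "((1 + 4 * u) * s) ^ 3 \<le> 5 ^ 3" using s u by (intro power_mono) auto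
    then have "((1 + 4 * u) * s) ^ 3 * s \<le> 5 ^ 3 * 1" using s u by (intro mult_mono) auto
    then show ?thesis by (simp add: power_mult_distrib power_Suc[of _ 3, simplified] numeral_eq_Suc mult_ac)
  qed
  moreover have "fejer4 t = s ^ 4" by (simp add: fejer4_def s_def power_even_abs)
  moreover have "1 + \<bar>t\<bar> = 1 + 4 * u" by (simp add: u_def)
  ultimately show ?thesis using u by (simp add: le_divide_eq mult.commute)
qed

lemma inverse_cube_le_kappa: "1 / (1 + \<bar>t\<bar>) ^ 3 \<le> kappa t"
  unfolding kappa_def by (intro divide_left_mono power_increasing) (auto intro!: mult_pos_pos zero_less_power add_pos_nonneg)

text \<open>Bernoulli's inequality applied to \<open>sin u / u \<ge> 1 - u\<^sup>2 / 6\<close>. It bounds the mass of the kernel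
  from below.\<close>

lemma fejer4_lower:
  assumes "\<bar>t\<bar> \<le> 4"
  shows "1 - t\<^sup>2 / 24 \<le> fejer4 (t::real)"
proof -
  (* here 4 * y is the term t^2 / 24 of the claim *)
  define y where "y = (t / 4)\<^sup>2 / 6"
  have "(t / 4)\<^sup>2 \<le> 1" using assms by (simp add: abs_square_le_1)
  then have y: "0 \<le> y" "y \<le> 1" by (auto simp: y_def)
  have "1 - t\<^sup>2 / 24 = 1 + real 4 * (- y)" by (simp add: y_def power2_eq_square)
  also have "\<dots> \<le> (1 + (- y)) ^ 4" by (rule Bernoulli_inequality) (use y in auto)
  also have "\<dots> \<le> fejer4 t"
    unfolding fejer4_def using sincf_lower[of "t/4"] y by (intro power_mono) (auto simp: y_def)
  finally show ?thesis .
qed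

lemma fejer4_integrable: "integrable lborel (fejer4 :: real \<Rightarrow> real)"
proof (rule integrableI_bounded)
  have "(\<integral>\<^sup>+t. ennreal (norm (fejer4 (t::real))) \<partial>lborel) \<le> (\<integral>\<^sup>+t. ennreal 125 * ennreal (kappa t) \<partial>lborel)"
  proof (rule nn_integral_mono)
    fix t :: real
    have "norm (fejer4 t) \<le> 125 * kappa t"
      using fejer4_le[of t] inverse_cube_le_kappa[of t] fejer4_nonneg[of t] by simp
    then show "ennreal (norm (fejer4 t)) \<le> ennreal 125 * ennreal (kappa t)"
      by (subst ennreal_mult[symmetric]) (auto intro: ennreal_leI)
  qed
  also have "\<dots> = ennreal 125 * 2" by (subst nn_integral_cmult) (auto simp: nn_integral_kappa)
  also have "\<dots> < \<infinity>" by (simp add: ennreal_mult_less_top)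
  finally show "(\<integral>\<^sup>+t. ennreal (norm (fejer4 (t::real))) \<partial>lborel) < \<infinity>" .
qed measurable

definition fejer4_mass :: real where
  "fejer4_mass = (\<integral>t. fejer4 t \<partial>lborel)"

lemma fejer4_mass_ge: "fejer4_mass \<ge> 56 / 9"
proof -
  have "56 / 9 = (4 - 4 ^ 3 / 72) - (- 4 - (- 4) ^ 3 / (72::real))" by simp
  also have "\<dots> = (\<integral>t. (1 - t\<^sup>2 / 24) * indicator {-4..4} t \<partial>lborel)"
    by (rule integral_FTC_Icc_real[where F="\<lambda>t. t - t ^ 3 / 72", symmetric])
       (auto intro!: derivative_eq_intros simp: power2_eq_square)
  also have "\<dots> \<le> fejer4_mass"
    unfolding fejer4_mass_def
  proof (rule integral_mono[OF _ fejer4_integrable])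
    show "integrable lborel (\<lambda>t::real. (1 - t\<^sup>2 / 24) * indicator {-4..4} t)"
      using borel_integrable_atLeastAtMost[of "-4" 4 "\<lambda>t::real. 1 - t\<^sup>2 / 24"]
      by (simp add: mult.commute)
  next
    fix t :: real
    show "(1 - t\<^sup>2 / 24) * indicator {-4..4} t \<le> fejer4 t"
      using fejer4_lower[of t] fejer4_nonneg[of t] by (auto simp: indicator_def abs_le_iff)
  qed
  finally show ?thesis .
qed

definition jackson :: "real \<Rightarrow> real" where
  "jackson t = fejer4 t / fejer4_mass"

lemma jackson_measurable [measurable]: "jackson \<in> borel_measurable borel"
  unfolding jackson_def[abs_def] by measurable

lemma jackson_nonneg: "jackson t \<ge> 0"
  using fejer4_mass_ge fejer4_nonneg[of t] by (simp add: jackson_def)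

lemma jackson_le: "jackson t \<le> 21 / (1 + \<bar>t\<bar>) ^ 3"
proof -
  have "jackson t \<le> (125 / (1 + \<bar>t\<bar>) ^ 3) / (56 / 9)"
    unfolding jackson_def using fejer4_mass_ge fejer4_nonneg by (intro frac_le fejer4_le) auto
  also have "\<dots> = (1125 / 56) / (1 + \<bar>t\<bar>) ^ 3" by simp
  also have "\<dots> \<le> 21 / (1 + \<bar>t\<bar>) ^ 3" by (intro divide_right_mono) auto
  finally show ?thesis .
qed

lemma kernel_jackson: "kappa_kernel 21 jackson"
proof -
  have "\<bar>jackson t\<bar> \<le> 21 * kappa t" for t
    using jackson_le[of t] inverse_cube_le_kappa[of t] jackson_nonneg[of t] by simp
  then show ?thesis by (simp add: kappa_kernel_def)
qed

lemma integrable_jackson: "integrable lborel jackson"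
  unfolding jackson_def[abs_def] using fejer4_integrable by simp

lemma integral_jackson: "(\<integral>t. jackson t \<partial>lborel) = 1"
  using fejer4_mass_ge by (simp add: jackson_def fejer4_mass_def)

text \<open>The interval between \<open>0\<close> and \<open>t\<close>, half-open as in \<open>smooth_increment\<close>. Keeping only the side on which
  \<open>t\<close> lies avoids a factor 2 in \<open>jackson_tail\<close>.\<close>

definition oriented :: "real \<Rightarrow> real set" where
  "oriented t = (if t \<ge> 0 then {0..<t} else {t..<0})"

lemma oriented_measurable [measurable]:
  assumes [measurable]: "f \<in> borel_measurable M" "g \<in> borel_measurable M"
  shows "(\<lambda>z. indicator (oriented (f z)) (g z) :: ennreal) \<in> borel_measurable M"
proof -
  have eq: "(\<lambda>z. indicator (oriented (f z)) (g z) :: ennreal)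
    = (\<lambda>z. if 0 \<le> f z then (if 0 \<le> g z \<and> g z < f z then 1 else 0)
        else (if f z \<le> g z \<and> g z < 0 then 1 else 0))"
    by (auto simp: oriented_def fun_eq_iff indicator_def)
  show ?thesis unfolding eq by measurable
qed

lemma jackson_tail:
  "(\<integral>\<^sup>+t. ennreal (jackson t) * indicator (oriented t) u \<partial>lborel) \<le> ennreal (21 / 2 * kappa u)"
proof -
  have half: "(\<integral>\<^sup>+t. ennreal (21 / (1 + t) ^ 3) * indicator {w..} t \<partial>lborel) = ennreal (21 / 2 * kappa w)" if "w \<ge> 0" for w
  proof -
    have "(\<integral>\<^sup>+t. ennreal (21 / (1 + t) ^ 3) * indicator {w..} t \<partial>lborel)
       = (\<integral>\<^sup>+t. ennreal (21 / 2) * (ennreal (2 / (1 + t) ^ 3) * indicator {w..} t) \<partial>lborel)"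
    proof (rule nn_integral_cong)
      fix t
      show "ennreal (21 / (1 + t) ^ 3) * indicator {w..} t = ennreal (21 / 2) * (ennreal (2 / (1 + t) ^ 3) * indicator {w..} t)"
        using that by (cases "t \<ge> w") (auto simp: ennreal_mult[symmetric])
    qed
    also have "\<dots> = ennreal (21 / 2) * ennreal (kappa w)"
      by (subst nn_integral_cmult) (auto simp: nn_integral_tail_cube[OF that])
    finally show ?thesis by (simp add: ennreal_mult[symmetric])
  qed
  show ?thesis
  proof (cases "u \<ge> 0")
    case True
    have "(\<integral>\<^sup>+t. ennreal (jackson t) * indicator (oriented t) u \<partial>lborel)
        \<le> (\<integral>\<^sup>+t. ennreal (21 / (1 + t) ^ 3) * indicator {u..} t \<partial>lborel)"
    proof (rule nn_integral_mono)
      fix t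
      show "ennreal (jackson t) * indicator (oriented t) u \<le> ennreal (21 / (1 + t) ^ 3) * indicator {u..} t"
        using jackson_le[of t] True by (auto simp: oriented_def indicator_def intro!: ennreal_leI)
    qed
    then show ?thesis using half[OF True] by simp
  next
    case False
    have "(\<integral>\<^sup>+t. ennreal (jackson t) * indicator (oriented t) u \<partial>lborel)
        = (\<integral>\<^sup>+t. ennreal (jackson (0 - t)) * indicator (oriented (0 - t)) u \<partial>lborel)"
      by (rule nn_integral_reflect[symmetric]) measurable
    also have "\<dots> \<le> (\<integral>\<^sup>+t. ennreal (21 / (1 + t) ^ 3) * indicator {-u..} t \<partial>lborel)"
    proof (rule nn_integral_mono)
      fix t
      show "ennreal (jackson (0 - t)) * indicator (oriented (0 - t)) u \<le> ennreal (21 / (1 + t) ^ 3) * indicator {-u..} t"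
        using jackson_le[of "-t"] False by (auto simp: oriented_def indicator_def intro!: ennreal_leI)
    qed
    finally show ?thesis using half[of "-u"] False by simp
  qed
qed

lemma smooth_increment_abs:
  assumes f: "unif_loc_int f"
  shows "ennreal \<bar>smooth f x - smooth f (x + t)\<bar>
    \<le> 2 * (\<integral>\<^sup>+u. indicator (oriented t) u * ennreal \<bar>defect f (x + u)\<bar> \<partial>lborel)"
proof -
  note [measurable] = unif_loc_int_measurable[OF unif_loc_int_defect[OF f]]
  have *: "ennreal \<bar>smooth f y - smooth f (y + s)\<bar>
      \<le> 2 * (\<integral>\<^sup>+u. indicator {0..<s} u * ennreal \<bar>defect f (y + u)\<bar> \<partial>lborel)" if "s \<ge> 0" for y s
  proof -
    have "ennreal \<bar>smooth f y - smooth f (y + s)\<bar> = 2 * ennreal \<bar>corr (indicator {0..<s}) (defect f) y\<bar>"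
      unfolding smooth_increment[OF f that] abs_mult by (simp add: ennreal_mult)
    also have "\<dots> \<le> 2 * (\<integral>\<^sup>+u. ennreal \<bar>indicator {0..<s} u * defect f (y + u)\<bar> \<partial>lborel)"
      by (intro mult_left_mono abs_corr_le_nn_integral) simp
    also have "(\<integral>\<^sup>+u. ennreal \<bar>indicator {0..<s} u * defect f (y + u)\<bar> \<partial>lborel)
        = (\<integral>\<^sup>+u. indicator {0..<s} u * ennreal \<bar>defect f (y + u)\<bar> \<partial>lborel)"
      by (intro nn_integral_cong) (auto simp: indicator_def)
    finally show ?thesis .
  qed
  show ?thesis
  proof (cases "t \<ge> 0")
    case True
    then show ?thesis using *[OF True] by (simp add: oriented_def)
  next
    case False
    then have "ennreal \<bar>smooth f x - smooth f (x + t)\<bar>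
        \<le> 2 * (\<integral>\<^sup>+u. indicator {0..<-t} u * ennreal \<bar>defect f (x + t + u)\<bar> \<partial>lborel)"
      using *[of "-t" "x + t"] by (simp add: abs_minus_commute)
    also have "(\<integral>\<^sup>+u. indicator {0..<-t} u * ennreal \<bar>defect f (x + t + u)\<bar> \<partial>lborel)
       = (\<integral>\<^sup>+u. indicator {t..<0} (t + u) * ennreal \<bar>defect f (x + (t + u))\<bar> \<partial>lborel)"
      by (intro nn_integral_cong) (auto simp: indicator_def add.assoc)
    also have "\<dots> = (\<integral>\<^sup>+u. indicator {t..<0} u * ennreal \<bar>defect f (x + u)\<bar> \<partial>lborel)"
      by (rule nn_integral_shift[of "\<lambda>u. indicator {t..<0} u * ennreal \<bar>defect f (x + u)\<bar>"]) measurable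
    finally show ?thesis using False by (simp add: oriented_def)
  qed
qed

text \<open>As the kernel has mass one, the left-hand side averages increments of \<open>smooth f\<close>, which are
  integrals of the defect; exchanging the integrals leaves the tails of the kernel as weights.\<close>

lemma jackson_bound:
  assumes f: "unif_loc_int f"
  shows "ennreal \<bar>smooth f x - corr jackson (smooth f) x\<bar> \<le> 21 * kconv (defect f) x"
proof -
  let ?m = "\<lambda>t u. 2 * (ennreal (jackson t) * indicator (oriented t) u * ennreal \<bar>defect f (x + u)\<bar>)"
  note S = unif_loc_int_smooth[OF f]
  note [measurable] = unif_loc_int_measurable[OF unif_loc_int_defect[OF f]]
  have i1: "integrable lborel (\<lambda>t. jackson t * smooth f x)" using integrable_jackson by simp
  have i2: "integrable lborel (\<lambda>t. jackson t * smooth f (x + t))" by (rule kernel_integrable[OF kernel_jackson S])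
  have i3: "integrable lborel (\<lambda>t. jackson t * (smooth f x - smooth f (x + t)))"
    using Bochner_Integration.integrable_diff[OF i1 i2] by (simp add: right_diff_distrib)
  have "smooth f x - corr jackson (smooth f) x
      = (\<integral>t. jackson t * smooth f x \<partial>lborel) - (\<integral>t. jackson t * smooth f (x + t) \<partial>lborel)"
    using integral_jackson by (simp add: corr_def)
  also have "\<dots> = (\<integral>t. jackson t * (smooth f x - smooth f (x + t)) \<partial>lborel)"
    using i1 i2 by (simp add: right_diff_distrib)
  finally have "ennreal \<bar>smooth f x - corr jackson (smooth f) x\<bar>
     \<le> (\<integral>\<^sup>+t. ennreal \<bar>jackson t * (smooth f x - smooth f (x + t))\<bar> \<partial>lborel)"
    using integral_norm_bound_ennreal[OF i3] by simp
  also have "\<dots> \<le> (\<integral>\<^sup>+t. (\<integral>\<^sup>+u. ?m t u \<partial>lborel) \<partial>lborel)"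
  proof (rule nn_integral_mono)
    fix t
    have [measurable]: "oriented t \<in> sets borel" by (simp add: oriented_def)
    have "ennreal \<bar>jackson t * (smooth f x - smooth f (x + t))\<bar>
        = ennreal (jackson t) * ennreal \<bar>smooth f x - smooth f (x + t)\<bar>"
      using jackson_nonneg[of t] by (simp add: abs_mult ennreal_mult)
    also have "\<dots> \<le> ennreal (jackson t) * (2 * (\<integral>\<^sup>+u. indicator (oriented t) u * ennreal \<bar>defect f (x + u)\<bar> \<partial>lborel))"
      by (intro mult_left_mono smooth_increment_abs[OF f]) simp
    also have "\<dots> = (\<integral>\<^sup>+u. ?m t u \<partial>lborel)"
      by (simp add: nn_integral_cmult mult_ac)
    finally show "ennreal \<bar>jackson t * (smooth f x - smooth f (x + t))\<bar>
        \<le> (\<integral>\<^sup>+u. ?m t u \<partial>lborel)" .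
  qed
  also have "\<dots> = (\<integral>\<^sup>+u. (\<integral>\<^sup>+t. ?m t u \<partial>lborel) \<partial>lborel)"
    by (rule lborel_pair.Fubini') measurable
  also have "\<dots> \<le> (\<integral>\<^sup>+u. 2 * (ennreal (21 / 2 * kappa u) * ennreal \<bar>defect f (x + u)\<bar>) \<partial>lborel)"
  proof (rule nn_integral_mono)
    fix u
    have "(\<integral>\<^sup>+t. ?m t u \<partial>lborel)
       = 2 * ((\<integral>\<^sup>+t. ennreal (jackson t) * indicator (oriented t) u \<partial>lborel) * ennreal \<bar>defect f (x + u)\<bar>)"
      by (simp add: nn_integral_cmult nn_integral_multc)
    also have "\<dots> \<le> 2 * (ennreal (21 / 2 * kappa u) * ennreal \<bar>defect f (x + u)\<bar>)"
      by (intro mult_left_mono mult_right_mono jackson_tail) auto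
    finally show "(\<integral>\<^sup>+t. ?m t u \<partial>lborel)
        \<le> 2 * (ennreal (21 / 2 * kappa u) * ennreal \<bar>defect f (x + u)\<bar>)" .
  qed
  also have "\<dots> = (\<integral>\<^sup>+u. 21 * ennreal (kappa u * \<bar>defect f (x + u)\<bar>) \<partial>lborel)"
  proof (rule nn_integral_cong)
    fix u
    have "2 * (ennreal (21 / 2 * kappa u) * ennreal \<bar>defect f (x + u)\<bar>) = ennreal (2 * (21 / 2 * kappa u * \<bar>defect f (x + u)\<bar>))"
      by (simp only: ennreal_mult' ennreal_mult'' abs_ge_zero zero_le_numeral ennreal_numeral mult_nonneg_nonneg)
    also have "\<dots> = ennreal (21 * (kappa u * \<bar>defect f (x + u)\<bar>))" by simp
    also have "\<dots> = 21 * ennreal (kappa u * \<bar>defect f (x + u)\<bar>)" by (subst ennreal_mult) auto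
    finally show "2 * (ennreal (21 / 2 * kappa u) * ennreal \<bar>defect f (x + u)\<bar>) = 21 * ennreal (kappa u * \<bar>defect f (x + u)\<bar>)" .
  qed
  also have "\<dots> = 21 * kconv (defect f) x"
    unfolding kconv_def by (rule nn_integral_cmult) measurable
  finally show ?thesis .
qed

text \<open>The operator \<open>I - V\<close> of the introduction.\<close>

definition residual :: "(real \<Rightarrow> real) \<Rightarrow> real \<Rightarrow> real" where
  "residual f x = f x - corr jackson (smooth f) x"

lemma residual_bound:
  assumes f: "unif_loc_int f"
  shows "ennreal \<bar>residual f x\<bar> \<le> ennreal \<bar>defect f x\<bar> + 54 * kconv (defect f) x"
proof -
  have "ennreal \<bar>residual f x\<bar> \<le> ennreal (\<bar>f x - smooth f x\<bar> + \<bar>smooth f x - corr jackson (smooth f) x\<bar>)"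
    unfolding residual_def by (intro ennreal_leI) linarith
  also have "\<dots> = ennreal \<bar>f x - smooth f x\<bar> + ennreal \<bar>smooth f x - corr jackson (smooth f) x\<bar>"
    by simp
  also have "\<dots> \<le> ennreal \<bar>defect f x\<bar> + 33 * kconv (defect f) x + 21 * kconv (defect f) x"
    by (intro add_mono remainder_bound jackson_bound f)
  also have "\<dots> = ennreal \<bar>defect f x\<bar> + (33 + 21) * kconv (defect f) x"
    by (simp only: distrib_right add.assoc)
  finally show ?thesis by simp
qed

lemma unif_loc_int_residual: "unif_loc_int f \<Longrightarrow> unif_loc_int (residual f)"
  unfolding residual_def[abs_def]
  by (intro unif_loc_int_diff unif_loc_int_corr[OF kernel_jackson] unif_loc_int_smooth)

lemma defect_residual_commute:
  assumes f: "unif_loc_int f"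
  shows "defect (residual f) = residual (defect f)"
proof
  fix x
  note S = unif_loc_int_smooth[OF f] and T = unif_loc_int_avg[OF f]
  note J = unif_loc_int_corr[OF kernel_jackson S]
  have comm: "avg (smooth f) = smooth (avg f)"
    unfolding avg_def smooth_def by (intro ext corr_commute[OF kernel_unit_ind kernel_tri f])
  have "avg (residual f) x = avg f x - avg (corr jackson (smooth f)) x"
    unfolding residual_def[abs_def] avg_def by (rule corr_diff[OF kernel_unit_ind f J])
  also have "avg (corr jackson (smooth f)) x = corr jackson (smooth (avg f)) x"
    unfolding comm[symmetric] unfolding avg_def by (rule corr_commute[OF kernel_unit_ind kernel_jackson S])
  finally have 1: "avg (residual f) x = avg f x - corr jackson (smooth (avg f)) x" .
  have "smooth (defect f) = (\<lambda>x. smooth f x - smooth (avg f) x)"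
    unfolding defect_def[abs_def] smooth_def by (intro ext corr_diff[OF kernel_tri f T])
  then have "corr jackson (smooth (defect f)) x = corr jackson (smooth f) x - corr jackson (smooth (avg f)) x"
    using corr_diff[OF kernel_jackson S unif_loc_int_smooth[OF T]] by simp
  with 1 show "defect (residual f) x = residual (defect f) x"
    by (simp add: defect_def residual_def)
qed

text \<open>For bounds of the form \<open>\<bar>f\<bar> + b * kconv f\<close> the quantity \<open>1 + 8 b\<close> is multiplicative under
  composition, by \<open>kconv_le_of_pointwise\<close>; for \<open>residual\<close> it is \<open>433 = 1 + 8 * 54\<close>. Commutation with \<open>defect\<close> lets the induction hypothesis act
  on \<open>defect f\<close>.\<close>

lemma iterated_residual_bound:
  assumes "unif_loc_int f"
  shows "ennreal \<bar>(residual ^^ r) f x\<bar>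
    \<le> ennreal \<bar>(defect ^^ r) f x\<bar> + ennreal ((433 ^ r - 1) / 8) * kconv ((defect ^^ r) f) x
    \<and> unif_loc_int ((residual ^^ r) f) \<and> unif_loc_int ((defect ^^ r) f)"
  using assms
proof (induction r arbitrary: f x)
  case 0
  then show ?case by simp
next
  case (Suc r)
  note f = Suc.prems and D = unif_loc_int_defect[OF Suc.prems]
  define h where "h = (residual ^^ r) f"
  have h: "unif_loc_int h" unfolding h_def using Suc.IH[OF f] by simp
  have comm: "defect ((residual ^^ n) f) = (residual ^^ n) (defect f) \<and> unif_loc_int ((residual ^^ n) f)" for n
    by (induction n) (auto simp: f defect_residual_commute unif_loc_int_residual)
  define Y where "Y = (residual ^^ r) (defect f)"
  define P where "P = (defect ^^ Suc r) f"
  have Peq: "P = (defect ^^ r) (defect f)" unfolding P_def by (simp only: funpow_Suc_right o_apply)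
  have P: "unif_loc_int P" unfolding Peq using Suc.IH[OF D] by simp
  have Y: "unif_loc_int Y" unfolding Y_def using Suc.IH[OF D] by simp
  have IH: "ennreal \<bar>Y y\<bar> \<le> ennreal 1 * ennreal \<bar>P y\<bar> + ennreal ((433 ^ r - 1) / 8) * kconv P y" for y
    using Suc.IH[OF D, of y] by (simp add: Y_def Peq)
  have pw: "(433 ^ r :: real) \<ge> 1" by simp
  have kY: "kconv Y x \<le> ennreal (1 + 8 * ((433 ^ r - 1) / 8)) * kconv P x"
    by (rule kconv_le_of_pointwise[OF unif_loc_int_measurable[OF P] unif_loc_int_measurable[OF Y] _ _ IH])
       (use pw in auto)
  have "ennreal \<bar>residual h x\<bar> \<le> ennreal \<bar>defect h x\<bar> + 54 * kconv (defect h) x"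
    by (rule residual_bound[OF h])
  also have "defect h = Y" unfolding h_def Y_def using comm by simp
  also have "ennreal \<bar>Y x\<bar> + 54 * kconv Y x
     \<le> (ennreal 1 * ennreal \<bar>P x\<bar> + ennreal ((433 ^ r - 1) / 8) * kconv P x)
        + 54 * (ennreal (1 + 8 * ((433 ^ r - 1) / 8)) * kconv P x)"
    by (intro add_mono IH mult_left_mono kY) auto
  also have "\<dots> = ennreal \<bar>P x\<bar> + (ennreal ((433 ^ r - 1) / 8) + ennreal 54 * ennreal (1 + 8 * ((433 ^ r - 1) / 8))) * kconv P x"
    by (simp add: distrib_right mult.assoc add.assoc)
  also have "ennreal ((433 ^ r - 1) / 8) + ennreal 54 * ennreal (1 + 8 * ((433 ^ r - 1) / 8))
      = ennreal ((433 ^ r - 1) / 8 + 54 * (1 + 8 * ((433 ^ r - 1) / 8)))"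
    using pw by (subst ennreal_mult[symmetric]) (auto simp flip: ennreal_plus)
  also have "(433 ^ r - 1) / 8 + 54 * (1 + 8 * ((433 ^ r - 1) / 8)) = ((433 ^ Suc r - 1) / 8 :: real)"
    by (simp add: field_simps)
  finally have "ennreal \<bar>(residual ^^ Suc r) f x\<bar> \<le> ennreal \<bar>P x\<bar> + ennreal ((433 ^ Suc r - 1) / 8) * kconv P x"
    by (simp only: h_def funpow.simps o_apply)
  moreover have "unif_loc_int ((residual ^^ Suc r) f)"
    using unif_loc_int_residual[OF h] by (simp add: h_def)
  ultimately show ?case using P unfolding P_def by blast
qed

text \<open>Keeping the Jackson mean outermost exhibits the approximant as a Jackson mean of a continuous
  function, to which \<open>entire_extension\<close> applies.\<close>

lemma iterated_residual_eq:
  assumes f: "unif_loc_int f"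
  shows "\<exists>h. unif_loc_int h \<and> (\<forall>x. (residual ^^ r) f x = f x - corr jackson (smooth h) x)"
proof (induction r)
  case 0
  have "unif_loc_int (\<lambda>_. 0)" by (auto simp: unif_loc_int_def kconv_def)
  moreover have "smooth (\<lambda>_. 0) = (\<lambda>_. 0)" by (simp add: smooth_def corr_def fun_eq_iff)
  ultimately show ?case by (intro exI[of _ "\<lambda>_. 0"]) (simp add: corr_def)
next
  case (Suc r)
  then obtain h where h: "unif_loc_int h" and eq: "\<And>x. (residual ^^ r) f x = f x - corr jackson (smooth h) x"
    by blast
  define u where "u = (residual ^^ r) f"
  have u: "unif_loc_int u" unfolding u_def using iterated_residual_bound[OF f] by blast
  have "smooth (\<lambda>x. h x + u x) = (\<lambda>x. smooth h x + smooth u x)"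
    unfolding smooth_def by (intro ext corr_add[OF kernel_tri h u])
  then have "corr jackson (smooth (\<lambda>x. h x + u x)) x = corr jackson (smooth h) x + corr jackson (smooth u) x" for x
    using corr_add[OF kernel_jackson unif_loc_int_smooth[OF h] unif_loc_int_smooth[OF u]] by simp
  moreover have "(residual ^^ Suc r) f x = u x - corr jackson (smooth u) x" for x
    by (simp add: u_def residual_def)
  moreover have "u x = f x - corr jackson (smooth h) x" for x by (simp add: u_def eq)
  ultimately show ?case
    using unif_loc_int_add[OF h u] by (intro exI[of _ "\<lambda>x. h x + u x"]) simp
qed

section \<open>Extension to entire functions of exponential type\<close>

text \<open>Dominated convergence: the kernel \<open>tri\<close> is continuous away from its jump at \<open>0\<close>.\<close>

lemma smooth_continuous:
  assumes f: "unif_loc_int f"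
  shows "continuous_on UNIV (smooth f)"
proof -
  note [measurable] = unif_loc_int_measurable[OF f]
  have "isCont (smooth f) x" for x
    unfolding continuous_at_sequentially
  proof (intro allI impI)
    fix X assume X: "X \<longlonglongrightarrow> x"
    define d where "d n = X n - x" for n
    have d: "d \<longlonglongrightarrow> 0" using tendsto_diff[OF X tendsto_const[of x]] by (simp add: d_def[abs_def])
    then obtain K where K: "\<And>n. \<bar>d n\<bar> \<le> K" using convergent_imp_Bseq[of d] unfolding convergent_def Bseq_def by auto
    then have K0: "K \<ge> 0" using abs_ge_zero order_trans by blast
    have kK: "kappa_kernel ((1 + (K + 1))\<^sup>2) (indicator {-(K + 1)..K + 1})"
      by (rule kernel_indicator) auto
    have "(\<lambda>n. \<integral>u. tri (u - d n) * f (x + u) \<partial>lborel) \<longlonglongrightarrow> (\<integral>u. tri u * f (x + u) \<partial>lborel)"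
    proof (rule integral_dominated_convergence[where w="\<lambda>u. 2 * \<bar>indicator {-(K + 1)..K + 1} u * f (x + u)\<bar>"])
      show "integrable lborel (\<lambda>u. 2 * \<bar>indicator {-(K + 1)..K + 1} u * f (x + u)\<bar>)"
        by (intro integrable_mult_right integrable_abs kernel_integrable[OF kK f])
      show "AE u in lborel. (\<lambda>n. tri (u - d n) * f (x + u)) \<longlonglongrightarrow> tri u * f (x + u)"
      proof (intro eventually_mono[OF AE_lborel_singleton[of 0]])
        fix u :: real assume u: "u \<noteq> 0"
        have "isCont tri u"
        proof -
          have "tri = (\<lambda>t. if t < 0 then 0 else max 0 (2 * (1 - t)))"
            by (auto simp: tri_def indicator_def fun_eq_iff)
          moreover have "isCont (\<lambda>t. if t < 0 then 0 else max 0 (2 * (1 - t))) u"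
          proof (cases "u < 0")
            case True
            then have "eventually (\<lambda>t. t \<in> {..<0::real}) (nhds u)" by (intro eventually_nhds_in_open) auto
            then have "eventually (\<lambda>t. (if t < 0 then 0 else max 0 (2 * (1 - t))) = (0::real)) (nhds u)"
              by eventually_elim auto
            then show ?thesis by (subst isCont_cong[where g="\<lambda>_. 0"]) auto
          next
            case False
            with u have "u \<in> {0<..}" by auto
            then have "eventually (\<lambda>t. t \<in> {0::real<..}) (nhds u)" by (intro eventually_nhds_in_open) auto
            then have "eventually (\<lambda>t. (if t < 0 then 0 else max 0 (2 * (1 - t))) = max 0 (2 * (1 - t))) (nhds u)"
              by eventually_elim auto
            then show ?thesis by (subst isCont_cong[where g="\<lambda>t. max 0 (2 * (1 - t))"]) (auto intro!: continuous_intros)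
          qed
          ultimately show ?thesis by simp
        qed
        moreover have "(\<lambda>n. u - d n) \<longlonglongrightarrow> u" using tendsto_diff[OF tendsto_const[of u] d] by simp
        ultimately have "(\<lambda>n. tri (u - d n)) \<longlonglongrightarrow> tri u" by (rule isCont_tendsto_compose)
        then show "(\<lambda>n. tri (u - d n) * f (x + u)) \<longlonglongrightarrow> tri u * f (x + u)"
          by (intro tendsto_intros)
      qed
      show "AE u in lborel. norm (tri (u - d n) * f (x + u)) \<le> 2 * \<bar>indicator {-(K + 1)..K + 1} u * f (x + u)\<bar>" for n
      proof (rule AE_I2)
        fix u
        have "\<bar>tri (u - d n)\<bar> \<le> 2 * indicator {-(K + 1)..K + 1} u"
          using K[of n] by (auto simp: tri_def indicator_def abs_le_iff)
        then have "\<bar>tri (u - d n)\<bar> * \<bar>f (x + u)\<bar> \<le> (2 * indicator {-(K + 1)..K + 1} u) * \<bar>f (x + u)\<bar>"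
          by (intro mult_right_mono) auto
        then show "norm (tri (u - d n) * f (x + u)) \<le> 2 * \<bar>indicator {-(K + 1)..K + 1} u * f (x + u)\<bar>"
          by (simp add: abs_mult)
      qed
    qed measurable
    moreover have "smooth f (X n) = (\<integral>u. tri (u - d n) * f (x + u) \<partial>lborel)" for n
      using smooth_shift[of f x "d n"] by (simp add: d_def corr_def)
    ultimately show "(smooth f \<circ> X) \<longlonglongrightarrow> smooth f x" by (simp add: o_def smooth_def corr_def)
  qed
  then show ?thesis by (simp add: continuous_on_eq_continuous_at)
qed

lemma smooth_bounded:
  assumes f: "unif_loc_int f"
  shows "\<exists>M\<ge>0. \<forall>x. \<bar>smooth f x\<bar> \<le> M"
proof -
  from f obtain C where C: "\<And>x. kconv f x \<le> ennreal C" by (auto simp: unif_loc_int_def)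
  have "\<bar>smooth f x\<bar> \<le> 8 * \<bar>C\<bar>" for x
  proof -
    have "ennreal \<bar>smooth f x\<bar> \<le> ennreal 8 * kconv f x"
      unfolding smooth_def by (rule abs_corr_le[OF kernel_tri f])
    also have "\<dots> \<le> ennreal 8 * ennreal \<bar>C\<bar>"
      by (intro mult_left_mono order_trans[OF C] ennreal_leI) auto
    also have "\<dots> = ennreal (8 * \<bar>C\<bar>)" by (simp add: ennreal_mult)
    finally show ?thesis by (simp add: ennreal_le_iff)
  qed
  then show ?thesis by (intro exI[of _ "8 * \<bar>C\<bar>"]) auto
qed

lemma sincf_holomorphic: "(sincf :: complex \<Rightarrow> complex) holomorphic_on UNIV"
proof -
  have "(\<lambda>z::complex. if z = 0 then deriv sin 0 else (sin z - sin 0) / (z - 0)) holomorphic_on UNIV"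
    by (rule pole_lemma_open) (auto intro!: holomorphic_intros)
  moreover have "deriv sin (0::complex) = 1"
    using DERIV_imp_deriv[OF DERIV_sin[of "0::complex"]] by simp
  ultimately show ?thesis by (simp add: sincf_def[abs_def] cong: if_cong)
qed

lemma fejer4_holomorphic: "(fejer4 :: complex \<Rightarrow> complex) holomorphic_on UNIV"
proof -
  have "(sincf \<circ> (\<lambda>z::complex. z / 4)) holomorphic_on UNIV"
    by (rule holomorphic_on_compose_gen[OF _ sincf_holomorphic]) (auto intro!: holomorphic_intros)
  then show ?thesis unfolding fejer4_def[abs_def] o_def by (rule holomorphic_on_power)
qed

lemma norm_sin_le_exp: "norm (sin (z::complex)) \<le> exp \<bar>Im z\<bar>"
proof -
  have "norm (sin z) = norm (exp (\<i> * z) - exp (- (\<i> * z))) / 2"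
    by (simp add: sin_exp_eq norm_divide norm_mult)
  also have "\<dots> \<le> (norm (exp (\<i> * z)) + norm (exp (- (\<i> * z)))) / 2"
    by (intro divide_right_mono norm_triangle_ineq4) auto
  also have "\<dots> = (exp (- Im z) + exp (Im z)) / 2" by (simp add: norm_exp_eq_Re)
  also have "\<dots> \<le> (exp \<bar>Im z\<bar> + exp \<bar>Im z\<bar>) / 2"
    by (intro divide_right_mono add_mono) auto
  finally show ?thesis by simp
qed

text \<open>Four factors of type \<open>1 / 4\<close> give type 1; near the origin the quotient is bounded by compactness.\<close>

lemma fejer4_complex_bound:
  "\<exists>C\<ge>0. \<forall>z::complex. norm (fejer4 z) \<le> C * exp \<bar>Im z\<bar> * kappa (Re z)"
proof -
  have "compact ((sincf :: complex \<Rightarrow> complex) ` cball 0 1)"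
    by (intro compact_continuous_image holomorphic_on_imp_continuous_on
        holomorphic_on_subset[OF sincf_holomorphic]) auto
  then obtain B where B: "\<And>z::complex. norm z \<le> 1 \<Longrightarrow> norm (sincf z) \<le> B"
    using compact_imp_bounded bounded_iff by (metis imageI mem_cball_0)
  (* 2 * B serves inside the unit disc, 2 outside, where 1 + norm w is at most 2 * norm w *)
  define D where "D = max 2 (2 * B)"
  have D: "(1 + norm w) * norm (sincf w) \<le> D * exp \<bar>Im w\<bar>" for w :: complex
  proof (cases "norm w \<le> 1")
    case True
    have "(1 + norm w) * norm (sincf w) \<le> 2 * B"
      using True B[OF True] by (intro mult_mono) auto
    also have "\<dots> \<le> D * 1" by (simp add: D_def)
    also have "\<dots> \<le> D * exp \<bar>Im w\<bar>" by (intro mult_left_mono) (auto simp: D_def)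
    finally show ?thesis .
  next
    case False
    then have w: "norm w > 1" "w \<noteq> 0" by auto
    have "(1 + norm w) * norm (sincf w) \<le> (2 * norm w) * norm (sincf w)"
      using w by (intro mult_right_mono) auto
    also have "\<dots> = 2 * norm (sin w)" using w by (simp add: sincf_def norm_divide)
    also have "\<dots> \<le> 2 * exp \<bar>Im w\<bar>" using norm_sin_le_exp[of w] by simp
    also have "\<dots> \<le> D * exp \<bar>Im w\<bar>" by (intro mult_right_mono) (auto simp: D_def)
    finally show ?thesis .
  qed
  have "norm (fejer4 z) \<le> 16 * D ^ 4 * exp \<bar>Im z\<bar> * kappa (Re z)" for z :: complex
  proof -
    define s where "s = 1 + norm (z / 4)"
    have s: "s \<ge> 1" by (simp add: s_def)
    have "s ^ 4 * norm (fejer4 z) = ((1 + norm (z / 4)) * norm (sincf (z / 4))) ^ 4"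
      by (simp add: s_def fejer4_def norm_power power_mult_distrib)
    also have "\<dots> \<le> (D * exp \<bar>Im (z / 4)\<bar>) ^ 4" by (intro power_mono D) auto
    also have "\<dots> = D ^ 4 * exp \<bar>Im z\<bar>"
      by (simp add: power_mult_distrib exp_of_nat_mult[symmetric])
    finally have 1: "s ^ 4 * norm (fejer4 z) \<le> D ^ 4 * exp \<bar>Im z\<bar>" .
    have "(1 + \<bar>Re z\<bar>)\<^sup>2 \<le> (4 * s)\<^sup>2"
      using abs_Re_le_cmod[of z] by (intro power_mono) (auto simp: s_def norm_divide)
    also have "\<dots> = 16 * s\<^sup>2" by (simp add: power_mult_distrib)
    also have "\<dots> \<le> 16 * s ^ 4" using s by (simp add: power_increasing)
    finally have "(1 + \<bar>Re z\<bar>)\<^sup>2 * norm (fejer4 z) \<le> 16 * s ^ 4 * norm (fejer4 z)"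
      by (intro mult_right_mono) auto
    with 1 have "(1 + \<bar>Re z\<bar>)\<^sup>2 * norm (fejer4 z) \<le> 16 * D ^ 4 * exp \<bar>Im z\<bar>" by simp
    moreover have "(1 + \<bar>Re z\<bar>)\<^sup>2 > 0" by (simp add: add_pos_nonneg)
    ultimately show ?thesis by (simp add: kappa_def field_simps)
  qed
  then show ?thesis by (intro exI[of _ "16 * D ^ 4"]) auto
qed

lemma kappa_shift_le: "kappa (t - a) \<le> (1 + \<bar>a\<bar>)\<^sup>2 * kappa t"
proof -
  have "1 + \<bar>t\<bar> \<le> (1 + \<bar>a\<bar>) * (1 + \<bar>t - a\<bar>)"
  proof -
    have "1 + \<bar>t\<bar> \<le> 1 + \<bar>a\<bar> + \<bar>t - a\<bar> + \<bar>a\<bar> * \<bar>t - a\<bar>"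
      using mult_nonneg_nonneg[OF abs_ge_zero[of a] abs_ge_zero[of "t - a"]] by linarith
    then show ?thesis by (simp add: algebra_simps)
  qed
  then have "(1 + \<bar>t\<bar>)\<^sup>2 \<le> ((1 + \<bar>a\<bar>) * (1 + \<bar>t - a\<bar>))\<^sup>2" by (intro power_mono) auto
  then have "(1 + \<bar>t\<bar>)\<^sup>2 \<le> (1 + \<bar>a\<bar>)\<^sup>2 * (1 + \<bar>t - a\<bar>)\<^sup>2" by (simp add: power_mult_distrib)
  moreover have "(1 + \<bar>t\<bar>)\<^sup>2 > 0" "(1 + \<bar>t - a\<bar>)\<^sup>2 > 0" by (auto simp: add_pos_nonneg)
  ultimately show ?thesis by (simp add: kappa_def field_simps)
qed

lemma integrable_kappa: "integrable lborel kappa"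
  by (rule integrableI_bounded) (auto simp: nn_integral_kappa)

lemma integral_kappa: "(\<integral>t. kappa t \<partial>lborel) = 2"
  by (subst integral_eq_nn_integral) (auto simp: nn_integral_kappa)

text \<open>Enlarging \<open>C\<close> to be at least 1 makes \<open>ln C\<close> nonnegative, which covers circles on which \<open>g\<close>
  vanishes, where the logarithm has the value \<open>0\<close> by convention.\<close>

lemma exponential_type_of_bound:
  assumes le: "\<And>z. norm (g z) \<le> C * exp (s * norm z)" and s: "s \<ge> 0"
  shows "exponential_type s g"
proof -
  define C' where "C' = max 1 C"
  have C': "C' \<ge> 1" "\<And>z. norm (g z) \<le> C' * exp (s * norm z)"
    using le by (auto simp: C'_def intro: order_trans[OF le] mult_right_mono)
  have "eventually (\<lambda>\<rho>::real. ereal (ln (SUP z\<in>sphere 0 \<rho>. cmod (g z)) / \<rho>) \<le> ereal ((ln C' + s * \<rho>) / \<rho>)) at_top"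
    using eventually_gt_at_top[of 0]
  proof eventually_elim
    case (elim \<rho>)
    define S where "S = (SUP z\<in>sphere 0 \<rho>. cmod (g z))"
    have ne: "sphere (0::complex) \<rho> \<noteq> {}" using elim by simp
    have SC: "S \<le> C' * exp (s * \<rho>)"
      unfolding S_def by (rule cSUP_least[OF ne]) (use C'(2) in auto)
    have "ln S \<le> ln C' + s * \<rho>"
    proof (cases "S > 0")
      case True
      then have "ln S \<le> ln (C' * exp (s * \<rho>))" using SC C' by (subst ln_le_cancel_iff) auto
      also have "\<dots> = ln C' + s * \<rho>" using C' by (subst ln_mult) auto
      finally show ?thesis .
    next
      case False
      have "cmod (g (of_real \<rho>)) \<le> S"
        unfolding S_def
      proof (rule cSUP_upper)
        show "bdd_above ((\<lambda>z. cmod (g z)) ` sphere 0 \<rho>)"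
          using C'(2) by (intro bdd_aboveI2[of _ _ "C' * exp (s * \<rho>)"]) auto
      qed (use elim in auto)
      with False have "S = 0" using norm_ge_zero[of "g (of_real \<rho>)"] by linarith
      then show ?thesis using C' s elim by simp
    qed
    then show ?case using elim by (simp add: S_def divide_right_mono)
  qed
  then have "Limsup at_top (\<lambda>\<rho>::real. ereal (ln (SUP z\<in>sphere 0 \<rho>. cmod (g z)) / \<rho>))
      \<le> Limsup at_top (\<lambda>\<rho>::real. ereal ((ln C' + s * \<rho>) / \<rho>))"
    by (rule Limsup_mono)
  also have "\<dots> = ereal s"
  proof (rule lim_imp_Limsup)
    have "((\<lambda>\<rho>::real. (ln C' + s * \<rho>) / \<rho>) \<longlongrightarrow> s) at_top" by real_asymp
    then show "((\<lambda>\<rho>::real. ereal ((ln C' + s * \<rho>) / \<rho>)) \<longlongrightarrow> ereal s) at_top" by (rule tendsto_ereal)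
  qed simp
  finally show ?thesis by (simp add: exponential_type_def)
qed

text \<open>The extension is the integral of \<open>fejer4 (t - z) * H t\<close>. Truncated to \<open>[- n, n]\<close> it is holomorphic
  by differentiation under the integral, and the truncations converge locally uniformly.\<close>

lemma entire_extension:
  fixes H :: "real \<Rightarrow> real"
  assumes H: "continuous_on UNIV H" and M: "\<And>x. \<bar>H x\<bar> \<le> M"
  shows "\<exists>g C. g holomorphic_on UNIV \<and> (\<forall>z. norm (g z) \<le> C * exp (norm z))
      \<and> (\<forall>x. g (of_real x) = of_real (corr jackson H x))"
proof -
  have M0: "M \<ge> 0" using M[of 0] by simp
  have [measurable]: "H \<in> borel_measurable borel" using H by (rule borel_measurable_continuous_onI)
  obtain C where C: "C \<ge> 0" "\<And>z::complex. norm (fejer4 z) \<le> C * exp \<bar>Im z\<bar> * kappa (Re z)"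
    using fejer4_complex_bound by blast
  have fc: "continuous_on UNIV (fejer4 :: complex \<Rightarrow> complex)"
    by (rule holomorphic_on_imp_continuous_on[OF fejer4_holomorphic])
  have [measurable]: "(fejer4 :: complex \<Rightarrow> complex) \<in> borel_measurable borel"
    using fc by (rule borel_measurable_continuous_onI)
  define k where "k z t = fejer4 (of_real t - z) * of_real (H t)" for z :: complex and t :: real
  have k_meas [measurable]: "k z \<in> borel_measurable borel" for z unfolding k_def[abs_def] by measurable
  have k_cont: "continuous_on A (k z)" for z A
    unfolding k_def[abs_def]
    by (intro continuous_intros continuous_on_compose2[OF fc] continuous_on_compose2[OF H]) auto
  have k_bound: "norm (k z t) \<le> C * M * exp \<bar>Im z\<bar> * kappa (t - Re z)" for z t
  proof -
    have "norm (k z t) \<le> (C * exp \<bar>Im z\<bar> * kappa (t - Re z)) * M"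
      unfolding k_def norm_mult using C(2)[of "of_real t - z"] M[of t] C(1)
      by (intro mult_mono) auto
    then show ?thesis by (simp add: mult_ac)
  qed
  have int_kappa: "integrable lborel (\<lambda>t. kappa (t - a))" for a
    using lborel_integrable_real_affine[OF integrable_kappa, of 1 "-a"] by simp
  have k_int: "integrable lborel (k z)" for z
  proof (rule Bochner_Integration.integrable_bound)
    show "integrable lborel (\<lambda>t. C * M * exp \<bar>Im z\<bar> * kappa (t - Re z))"
      using int_kappa by simp
    show "AE t in lborel. norm (k z t) \<le> norm (C * M * exp \<bar>Im z\<bar> * kappa (t - Re z))"
      using k_bound C(1) M0 by (intro AE_I2) (simp add: abs_mult)
  qed measurable
  define G where "G z = (\<integral>t. k z t \<partial>lborel)" for z
  define F where "F n z = integral (cbox (- real n) (real n)) (k z)" for n z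
  have F_hol: "F n holomorphic_on UNIV" for n
    unfolding F_def
  proof (rule leibniz_rule_holomorphic[where fx="\<lambda>z t. - deriv fejer4 (of_real t - z) * of_real (H t)"])
    fix z :: complex and t :: real
    have outer: "(fejer4 has_field_derivative deriv fejer4 (of_real t - z)) (at (of_real t - z))"
      by (rule holomorphic_derivI[OF fejer4_holomorphic]) auto
    have inner: "((\<lambda>z. of_real t - z) has_field_derivative - 1) (at z)"
      by (auto intro!: derivative_eq_intros)
    have "(fejer4 \<circ> (\<lambda>z. of_real t - z) has_field_derivative deriv fejer4 (of_real t - z) * - 1) (at z)"
      by (rule DERIV_chain[OF outer inner])
    then have "((\<lambda>z. fejer4 (of_real t - z)) has_field_derivative - deriv fejer4 (of_real t - z)) (at z)"
      unfolding o_def by (simp only: mult_minus_right mult_1_right)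
    then show "((\<lambda>z. k z t) has_field_derivative - deriv fejer4 (of_real t - z) * of_real (H t)) (at z within UNIV)"
      unfolding k_def by (rule DERIV_cmult_right)
  next
    show "k z integrable_on cbox (- real n) (real n)" for z
      by (rule integrable_continuous[OF k_cont])
  next
    have "continuous_on UNIV (deriv (fejer4 :: complex \<Rightarrow> complex))"
      by (intro holomorphic_on_imp_continuous_on holomorphic_deriv fejer4_holomorphic) auto
    then have 1: "continuous_on (UNIV \<times> cbox (- real n) (real n)) (\<lambda>x. deriv fejer4 (of_real (snd x) - fst x :: complex))"
      by (rule continuous_on_compose2) (auto intro!: continuous_intros)
    have 2: "continuous_on (UNIV \<times> cbox (- real n) (real n)) (\<lambda>x::complex \<times> real. H (snd x))"
      by (rule continuous_on_compose2[OF H]) (auto intro!: continuous_intros)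
    show "continuous_on (UNIV \<times> cbox (- real n) (real n)) (\<lambda>(z::complex, t). - deriv fejer4 (of_real t - z) * of_real (H t))"
      unfolding case_prod_beta
      by (intro continuous_on_mult continuous_on_minus continuous_on_of_real 1 2)
  qed auto
  (* the truncation error is governed by the tails of kappa *)
  define T where "T n = (\<integral>t. indicator (- {- real n..real n}) t * kappa t \<partial>lborel)" for n
  have T_lim: "T \<longlonglongrightarrow> 0"
  proof -
    have "T \<longlonglongrightarrow> (\<integral>t. 0 \<partial>(lborel :: real measure))"
      unfolding T_def
    proof (rule integral_dominated_convergence[where w=kappa])
      show "AE t in lborel. (\<lambda>n. indicator (- {- real n..real n}) t * kappa t) \<longlonglongrightarrow> 0"
      proof (rule AE_I2)
        fix t :: real
        obtain N where N: "\<bar>t\<bar> \<le> real N" using real_arch_simple by blast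
        have "eventually (\<lambda>n. indicator (- {- real n..real n}) t * kappa t = 0) sequentially"
          using eventually_ge_at_top[of N]
        proof eventually_elim
          case (elim n)
          then have "\<bar>t\<bar> \<le> real n" using N by linarith
          then show ?case by (auto simp: indicator_def abs_le_iff)
        qed
        then show "(\<lambda>n. indicator (- {- real n..real n}) t * kappa t) \<longlonglongrightarrow> 0" by (rule tendsto_eventually)
      qed
    qed (auto simp: integrable_kappa indicator_def)
    then show ?thesis by simp
  qed
  have diff: "norm (F n z - G z) \<le> C * M * exp \<bar>Im z\<bar> * (1 + \<bar>Re z\<bar>)\<^sup>2 * T n" for n z
  proof -
    have si: "set_integrable lborel {- real n..real n} (k z)"
      by (rule borel_integrable_atLeastAtMost'[OF k_cont])
    have Feq: "F n z = (\<integral>t. indicator {- real n..real n} t *\<^sub>R k z t \<partial>lborel)"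
      using set_borel_integral_eq_integral(2)[OF si] by (simp add: F_def set_lebesgue_integral_def)
    have si': "integrable lborel (\<lambda>t. indicator {- real n..real n} t *\<^sub>R k z t)"
      using si by (simp add: set_integrable_def)
    have "G z - F n z = (\<integral>t. k z t - indicator {- real n..real n} t *\<^sub>R k z t \<partial>lborel)"
      unfolding Feq G_def using k_int si' by (rule Bochner_Integration.integral_diff[symmetric])
    also have "\<dots> = (\<integral>t. indicator (- {- real n..real n}) t *\<^sub>R k z t \<partial>lborel)"
      by (intro Bochner_Integration.integral_cong) (auto simp: indicator_def)
    finally have "norm (F n z - G z) = norm (\<integral>t. indicator (- {- real n..real n}) t *\<^sub>R k z t \<partial>lborel)"
      by (simp add: norm_minus_commute)
    also have "\<dots> \<le> (\<integral>t. C * M * exp \<bar>Im z\<bar> * (1 + \<bar>Re z\<bar>)\<^sup>2 * (indicator (- {- real n..real n}) t * kappa t) \<partial>lborel)"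
    proof (rule Bochner_Integration.integral_norm_bound_integral)
      show "integrable lborel (\<lambda>t. indicator (- {- real n..real n}) t *\<^sub>R k z t)"
        using k_int[of z] by (rule integrable_mult_indicator[rotated]) auto
      show "integrable lborel (\<lambda>t. C * M * exp \<bar>Im z\<bar> * (1 + \<bar>Re z\<bar>)\<^sup>2 * (indicator (- {- real n..real n}) t * kappa t))"
        using integrable_mult_indicator[OF _ integrable_kappa, of "- {- real n..real n}"]
        by (intro integrable_mult_right) auto
      fix t
      have "norm (k z t) \<le> C * M * exp \<bar>Im z\<bar> * kappa (t - Re z)" by (rule k_bound)
      also have "\<dots> \<le> C * M * exp \<bar>Im z\<bar> * ((1 + \<bar>Re z\<bar>)\<^sup>2 * kappa t)"
        using C(1) M0 by (intro mult_left_mono kappa_shift_le) auto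
      finally show "norm (indicator (- {- real n..real n}) t *\<^sub>R k z t)
          \<le> C * M * exp \<bar>Im z\<bar> * (1 + \<bar>Re z\<bar>)\<^sup>2 * (indicator (- {- real n..real n}) t * kappa t)"
        by (auto simp: indicator_def mult.assoc)
    qed
    also have "\<dots> = C * M * exp \<bar>Im z\<bar> * (1 + \<bar>Re z\<bar>)\<^sup>2 * T n"
      by (simp add: T_def)
    finally show ?thesis .
  qed
  have T_nonneg: "T n \<ge> 0" for n unfolding T_def by (intro integral_nonneg_AE AE_I2) auto
  have G_hol: "G holomorphic_on UNIV"
  proof (rule holomorphic_uniform_sequence[OF open_UNIV F_hol])
    fix z :: complex
    define R where "R = norm z + 1"
    define K where "K = C * M * exp R * (1 + R)\<^sup>2"
    have "uniform_limit (cball z 1) F G sequentially"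
      unfolding uniform_limit_iff
    proof (intro allI impI)
      fix e :: real assume e: "e > 0"
      have "(\<lambda>n. K * T n) \<longlonglongrightarrow> K * 0" by (intro tendsto_intros T_lim)
      then have "eventually (\<lambda>n. K * T n < e) sequentially" using e by (intro order_tendstoD) auto
      then show "eventually (\<lambda>n. \<forall>w\<in>cball z 1. dist (F n w) (G w) < e) sequentially"
      proof eventually_elim
        case (elim n)
        show ?case
        proof
          fix w assume "w \<in> cball z 1"
          then have w: "norm w \<le> R"
            unfolding R_def using norm_triangle_ineq3[of w z] by (simp add: dist_norm norm_minus_commute)
          have "norm (F n w - G w) \<le> C * M * exp \<bar>Im w\<bar> * (1 + \<bar>Re w\<bar>)\<^sup>2 * T n" by (rule diff)
          also have "\<dots> \<le> K * T n"
            unfolding K_def using C(1) M0 T_nonneg order_trans[OF abs_Im_le_cmod w] order_trans[OF abs_Re_le_cmod w]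
            by (intro mult_right_mono mult_mono power_mono) auto
          finally show "dist (F n w) (G w) < e" using elim by (simp add: dist_norm)
        qed
      qed
    qed
    then show "\<exists>d>0. cball z d \<subseteq> UNIV \<and> uniform_limit (cball z d) F G sequentially"
      by (intro exI[of _ 1]) auto
  qed
  have G_bound: "norm (G z) \<le> 2 * C * M * exp (norm z)" for z
  proof -
    have "norm (G z) \<le> (\<integral>t. C * M * exp \<bar>Im z\<bar> * kappa (t - Re z) \<partial>lborel)"
      unfolding G_def
      by (rule Bochner_Integration.integral_norm_bound_integral[OF k_int]) (use k_bound int_kappa in auto)
    also have "\<dots> = C * M * exp \<bar>Im z\<bar> * (\<integral>t. kappa (t - Re z) \<partial>lborel)" by simp
    also have "(\<integral>t. kappa (t - Re z) \<partial>lborel) = 2"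
      using lborel_integral_real_affine[of 1 kappa "- Re z"] integral_kappa by simp
    also have "C * M * exp \<bar>Im z\<bar> * 2 \<le> C * M * exp (norm z) * 2"
      using C(1) M0 abs_Im_le_cmod[of z] by (intro mult_right_mono mult_left_mono) auto
    finally show ?thesis by (simp add: mult_ac)
  qed
  have G_real: "G (of_real x) = of_real (fejer4_mass * corr jackson H x)" for x
  proof -
    have "k (of_real x) t = of_real (fejer4 (t - x) * H t)" for t
      unfolding k_def fejer4_def
      by (metis (no_types, opaque_lifting) of_real_diff of_real_divide of_real_mult of_real_numeral of_real_power sincf_of_real)
    then have "G (of_real x) = of_real (\<integral>t. fejer4 (t - x) * H t \<partial>lborel)"
      by (simp add: G_def del: of_real_mult)
    also have "(\<integral>t. fejer4 (t - x) * H t \<partial>lborel) = (\<integral>t. fejer4 t * H (x + t) \<partial>lborel)"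
      using lborel_integral_real_affine[of 1 "\<lambda>t. fejer4 (t - x) * H t" x] by simp
    also have "\<dots> = fejer4_mass * corr jackson H x"
      using fejer4_mass_ge by (simp add: corr_def jackson_def)
    finally show ?thesis .
  qed
  show ?thesis
  proof (intro exI conjI allI)
    show "(\<lambda>z. G z / of_real fejer4_mass) holomorphic_on UNIV"
      using fejer4_mass_ge by (intro holomorphic_intros G_hol) auto
    show "norm (G z / of_real fejer4_mass) \<le> 2 * C * M / fejer4_mass * exp (norm z)" for z
      using G_bound[of z] fejer4_mass_ge by (simp add: norm_divide divide_right_mono)
    show "G (of_real x) / of_real fejer4_mass = of_real (corr jackson H x)" for x
      using fejer4_mass_ge by (simp add: G_real)
  qed
qed

theorem entire_approximation:
  assumes f: "unif_loc_int f"
  shows "\<exists>g C. g holomorphic_on UNIV \<and> (\<forall>z. norm (g z) \<le> C * exp (norm z))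
    \<and> (\<forall>x. g (of_real x) \<in> \<real>)
    \<and> (\<forall>x. ennreal \<bar>f x - Re (g (of_real x))\<bar>
        \<le> ennreal \<bar>(defect ^^ r) f x\<bar> + ennreal ((433 ^ r - 1) / 8) * kconv ((defect ^^ r) f) x)"
proof -
  obtain h where h: "unif_loc_int h" and eq: "\<And>x. (residual ^^ r) f x = f x - corr jackson (smooth h) x"
    using iterated_residual_eq[OF f] by blast
  obtain M where M: "\<And>x. \<bar>smooth h x\<bar> \<le> M" using smooth_bounded[OF h] by blast
  obtain g C where g: "g holomorphic_on UNIV" "\<And>z. norm (g z) \<le> C * exp (norm z)"
      "\<And>x. g (of_real x) = of_real (corr jackson (smooth h) x)"
    using entire_extension[OF smooth_continuous[OF h] M] by blast
  have "ennreal \<bar>f x - Re (g (of_real x))\<bar>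
      \<le> ennreal \<bar>(defect ^^ r) f x\<bar> + ennreal ((433 ^ r - 1) / 8) * kconv ((defect ^^ r) f) x" for x
    using iterated_residual_bound[OF f, of r x] unfolding eq by (simp add: g(3))
  then show ?thesis using g by (intro exI[of _ g] exI[of _ C]) auto
qed

section \<open>Averages under a log-Hoelder exponent\<close>

text \<open>The graph of \<open>g \<mapsto> g powr q\<close> lies above its tangent at \<open>a\<close>; Young's inequality in disguise.\<close>

lemma powr_tangent:
  fixes a g q :: real
  assumes "q \<ge> 1" "a > 0" "g \<ge> 0"
  shows "q * a powr (q - 1) * g \<le> g powr q + (q - 1) * a powr q"
proof (cases "q = 1")
  case True
  then show ?thesis using assms by simp
next
  case False
  then have q: "q > 1" using assms by simp
  have "g * a powr (q - 1) \<le> g powr q / q + (a powr (q - 1)) powr (q / (q - 1)) / (q / (q - 1))"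
    by (rule Youngs_inequality) (use q assms in \<open>auto simp: field_simps\<close>)
  also have "(a powr (q - 1)) powr (q / (q - 1)) = a powr q"
    using q by (simp add: powr_powr)
  finally show ?thesis using q by (simp add: field_simps)
qed

text \<open>Jensen's inequality for powers, in a form that presupposes no integrability: integrate the
  tangent inequality.\<close>

lemma (in prob_space) powr_nn_integral_le:
  fixes g :: "'a \<Rightarrow> real"
  assumes [measurable]: "g \<in> borel_measurable M" and nonneg: "\<And>x. g x \<ge> 0"
    and q: "q \<ge> 1" and a: "a \<ge> 0" and le: "ennreal a \<le> (\<integral>\<^sup>+x. ennreal (g x) \<partial>M)"
  shows "ennreal (a powr q) \<le> (\<integral>\<^sup>+x. ennreal (g x powr q) \<partial>M)"
proof (cases "a = 0")
  case True
  then show ?thesis by simp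
next
  case False
  then have a: "a > 0" using a by simp
  have "ennreal (q * a powr q) = ennreal (q * a powr (q - 1)) * ennreal a"
  proof -
    have "a powr q = a powr (q - 1) * a" using a powr_add[of a "q - 1" 1] by simp
    then show ?thesis using a q by (simp add: ennreal_mult[symmetric] mult.assoc)
  qed
  also have "\<dots> \<le> ennreal (q * a powr (q - 1)) * (\<integral>\<^sup>+x. ennreal (g x) \<partial>M)"
    by (intro mult_left_mono le) auto
  also have "\<dots> = (\<integral>\<^sup>+x. ennreal (q * a powr (q - 1) * g x) \<partial>M)"
    using q nonneg by (simp add: nn_integral_cmult[symmetric] ennreal_mult)
  also have "\<dots> \<le> (\<integral>\<^sup>+x. ennreal (g x powr q) + ennreal ((q - 1) * a powr q) \<partial>M)"
    using powr_tangent[OF q a nonneg] q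
    by (intro nn_integral_mono) (simp flip: ennreal_plus add: ennreal_leI)
  also have "\<dots> = (\<integral>\<^sup>+x. ennreal (g x powr q) \<partial>M) + ennreal ((q - 1) * a powr q)"
    by (simp add: nn_integral_add emeasure_space_1)
  finally have *: "ennreal (q * a powr q) \<le> (\<integral>\<^sup>+x. ennreal (g x powr q) \<partial>M) + ennreal ((q - 1) * a powr q)" .
  show ?thesis
  proof (cases "\<integral>\<^sup>+x. ennreal (g x powr q) \<partial>M")
    case (real r)
    then have "q * a powr q \<le> r + (q - 1) * a powr q"
      using * q by (simp flip: ennreal_plus)
    then have "a powr q \<le> r" by (simp add: algebra_simps)
    then show ?thesis using real by (simp add: ennreal_leI)
  qed simp
qed

text \<open>The interval of half-length \<open>d * h\<close> around \<open>y\<close> is parametrised as \<open>y + d * t\<close> with \<open>t\<close> uniform in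
  \<open>[- h, h]\<close>, so that the dilation \<open>d\<close> stays separate from the mixture over \<open>h\<close>.\<close>

definition unif :: "real \<Rightarrow> real measure" where
  "unif h = uniform_measure lborel {-h..h}"

lemma unif_sets [measurable_cong, simp]: "sets (unif h) = sets borel"
  by (simp add: unif_def)

lemma prob_space_unif: "h > 0 \<Longrightarrow> prob_space (unif h)"
  unfolding unif_def by (rule prob_space_uniform_measure) auto

lemma nn_integral_unif:
  assumes "h > 0" and [measurable]: "u \<in> borel_measurable borel"
  shows "(\<integral>\<^sup>+t. u t \<partial>unif h) = (\<integral>\<^sup>+t. u t * indicator {-h..h} t \<partial>lborel) / ennreal (2 * h)"
  unfolding unif_def by (subst nn_integral_uniform_measure) (use assms(1) in auto)

lemma AE_unif: "(\<And>t. \<bar>t\<bar> \<le> h \<Longrightarrow> P t) \<Longrightarrow> AE t in unif h. P t"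
  unfolding unif_def by (rule AE_uniform_measureI) (auto simp: abs_le_iff)

text \<open>The one constant \<open>c\<close> stands for the larger of the two log-Hoelder constants.\<close>

locale log_hoelder =
  fixes p :: "real \<Rightarrow> real" and c p_inf :: real
  assumes p_ge_1: "\<And>x. p x \<ge> 1" and c_nonneg: "c \<ge> 0"
    and local_log: "\<And>x y. x \<noteq> y \<Longrightarrow> \<bar>1 / p x - 1 / p y\<bar> * ln (exp 1 + 1 / \<bar>x - y\<bar>) \<le> c"
    and decay_log: "\<And>x. \<bar>1 / p x - 1 / p_inf\<bar> * ln (exp 1 + \<bar>x\<bar>) \<le> c"
begin

lemma p_pos: "p x > 0"
  using p_ge_1[of x] by simp

lemma p_continuous: "continuous_on UNIV p"
proof -
  have "isCont (\<lambda>x. 1 / p x) x" for x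
    unfolding continuous_at_eps_delta dist_real_def
  proof (intro allI impI)
    fix e :: real assume e: "e > 0"
    show "\<exists>d>0. \<forall>x'. \<bar>x' - x\<bar> < d \<longrightarrow> \<bar>1 / p x' - 1 / p x\<bar> < e"
    (* for distances below exp (- c / e) the logarithm exceeds c / e *)
    proof (intro exI[of _ "exp (- c / e)"] conjI allI impI)
      fix x' assume lt: "\<bar>x' - x\<bar> < exp (- c / e)"
      show "\<bar>1 / p x' - 1 / p x\<bar> < e"
      proof (cases "x' = x")
        case False
        then have pos: "\<bar>x' - x\<bar> > 0" by simp
        have "exp (c / e) = 1 / exp (- c / e)" by (simp add: exp_minus divide_inverse)
        also have "\<dots> < 1 / \<bar>x' - x\<bar>" using lt pos by (intro divide_strict_left_mono) auto
        also have "\<dots> < exp 1 + 1 / \<bar>x' - x\<bar>" by simp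
        finally have "c / e < ln (exp 1 + 1 / \<bar>x' - x\<bar>)"
          using ln_less_cancel_iff[of "exp (c / e)" "exp 1 + 1 / \<bar>x' - x\<bar>"] pos by (simp add: add_pos_pos)
        then have "c < e * ln (exp 1 + 1 / \<bar>x' - x\<bar>)" using e by (simp add: field_simps)
        with local_log[OF False] have "\<bar>1 / p x' - 1 / p x\<bar> * ln (exp 1 + 1 / \<bar>x' - x\<bar>) < e * ln (exp 1 + 1 / \<bar>x' - x\<bar>)"
          by simp
        moreover have "ln (exp 1 + 1 / \<bar>x' - x\<bar>) > 0"
          using pos exp_ge_add_one_self[of 1] divide_pos_pos[OF zero_less_one pos]
          by (intro ln_gt_zero) linarith
        ultimately show ?thesis by simp
      qed (use e in simp)
    qed simp
  qed
  then have "continuous_on UNIV (\<lambda>x. 1 / p x)" by (simp add: continuous_on_eq_continuous_at)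
  then have "continuous_on UNIV (\<lambda>x. 1 / (1 / p x))"
    by (rule continuous_on_divide[OF continuous_on_const]) (use p_pos in \<open>auto simp: less_imp_neq[symmetric]\<close>)
  then show ?thesis by simp
qed

lemma p_measurable [measurable]: "p \<in> borel_measurable borel"
  using p_continuous by (rule borel_measurable_continuous_onI)

text \<open>If the desired bound by \<open>l powr p x\<close> fails, then \<open>l\<close> is so small that the left-hand side is
  at most \<open>exp (- 4 c)\<close> to the power \<open>1 / (1 / p y - 1 / p x)\<close>. By the decay condition this
  exponent is at least \<open>ln (exp 1 + m) / (2 c)\<close> with \<open>m\<close> the smaller of \<open>\<bar>x\<bar>\<close> and \<open>\<bar>y\<bar>\<close>,
  which gives quadratic decay.\<close>

lemma powr_le_of_small:
  assumes l: "0 \<le> l" "l \<le> 1"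
  shows "(exp (- 4 * c) * l) powr p y \<le> l powr p x + kappa x + kappa y"
proof (cases "l = 0 \<or> p x \<le> p y")
  case True
  show ?thesis
  proof (cases "l = 0")
    case False
    have "exp (- 4 * c) * l \<le> 1 * l" using l c_nonneg by (intro mult_right_mono) auto
    then have "(exp (- 4 * c) * l) powr p y \<le> l powr p y"
      using l p_pos[of y] by (intro powr_mono2) auto
    also have "\<dots> \<le> l powr p x" using True False l by (intro powr_mono') auto
    also have "\<dots> \<le> l powr p x + kappa x + kappa y" by (simp add: add.assoc)
    finally show ?thesis .
  qed (simp add: add_nonneg_nonneg)
next
  case False
  then have l0: "l > 0" and pxy: "p y < p x" using l by auto
  define L where "L = - ln l"
  have lL: "l = exp (- L)" using l0 by (simp add: L_def)
  have L: "L \<ge> 0" using l l0 by (simp add: L_def)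
  have e1: "(exp (- 4 * c) * l) powr p y = exp (- (p y * (4 * c + L)))"
    by (simp add: lL exp_add[symmetric] powr_def algebra_simps)
  have e2: "l powr p x = exp (- (p x * L))" by (simp add: lL powr_def)
  show ?thesis
  proof (cases "p x * L \<le> p y * (4 * c + L)")
    case True
    then show ?thesis unfolding e1 e2
      by (simp add: add.assoc add_increasing2)
  next
    case False
    define m where "m = min \<bar>x\<bar> \<bar>y\<bar>"
    define d where "d = 1 / p y - 1 / p x"
    define w where "w = ln (exp 1 + m)"
    have m: "m \<ge> 0" by (simp add: m_def)
    have w: "w \<ge> 0" using m exp_ge_add_one_self[of 1] by (simp add: w_def)
    have d: "d > 0" using pxy p_pos[of x] p_pos[of y] by (simp add: d_def field_simps)
    have "\<bar>1 / p z - 1 / p_inf\<bar> * w \<le> c" if "m \<le> \<bar>z\<bar>" for z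
    proof -
      have "w \<le> ln (exp 1 + \<bar>z\<bar>)" unfolding w_def using that m
        by (subst ln_le_cancel_iff) (auto intro!: add_pos_nonneg)
      then have "\<bar>1 / p z - 1 / p_inf\<bar> * w \<le> \<bar>1 / p z - 1 / p_inf\<bar> * ln (exp 1 + \<bar>z\<bar>)"
        by (intro mult_left_mono) auto
      then show ?thesis using decay_log[of z] by linarith
    qed
    from this[of x] this[of y]
    have "\<bar>1 / p y - 1 / p_inf\<bar> * w + \<bar>1 / p x - 1 / p_inf\<bar> * w \<le> 2 * c" by (simp add: m_def)
    moreover have "d * w \<le> (\<bar>1 / p y - 1 / p_inf\<bar> + \<bar>1 / p x - 1 / p_inf\<bar>) * w"
      using w by (intro mult_right_mono) (auto simp: d_def)
    ultimately have dw: "d * (2 * w) \<le> 4 * c" by (simp add: algebra_simps)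
    have "4 * c * p x < (4 * c + L) * (p x - p y)" using False by (simp add: algebra_simps)
    then have "4 * c < (4 * c + L) * (p x - p y) / p x" using p_pos[of x] by (simp add: less_divide_eq)
    also have "\<dots> = d * (p y * (4 * c + L))"
      using p_pos[of x] p_pos[of y] by (simp add: d_def field_simps)
    finally have "d * (2 * w) < d * (p y * (4 * c + L))" using dw by linarith
    then have "2 * w < p y * (4 * c + L)" using d by simp
    then have "exp (- (p y * (4 * c + L))) \<le> exp (- (2 * w))" by simp
    also have "\<dots> = 1 / (exp 1 + m)\<^sup>2"
    proof -
      have "exp (2 * w) = (exp 1 + m)\<^sup>2"
        using m by (simp add: w_def exp_double add_pos_nonneg)
      then show ?thesis by (simp add: exp_minus divide_inverse)
    qed
    also have "\<dots> \<le> 1 / (1 + m)\<^sup>2"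
      using m exp_ge_add_one_self[of 1] by (intro divide_left_mono power_mono) (auto intro!: mult_pos_pos zero_less_power add_pos_nonneg)
    also have "\<dots> \<le> kappa x + kappa y"
      by (cases "\<bar>x\<bar> \<le> \<bar>y\<bar>") (auto simp: m_def kappa_def min_def)
    finally show ?thesis unfolding e1 by (simp add: add.assoc add_increasing)
  qed
qed

definition modular :: "(real \<Rightarrow> real) \<Rightarrow> ennreal" where
  "modular f = (\<integral>\<^sup>+y. ennreal (\<bar>f y\<bar> powr p y) \<partial>lborel)"

lemma modular_average_le:
  assumes "d > 0" "h > 0" and [measurable]: "g \<in> borel_measurable borel" and "modular g \<le> 1"
  shows "(\<integral>\<^sup>+t. ennreal (\<bar>g (y + d * t)\<bar> powr p (y + d * t)) \<partial>unif h) \<le> ennreal (1 / (2 * h * d))"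
proof -
  let ?g = "\<lambda>t. ennreal (\<bar>g (y + d * t)\<bar> powr p (y + d * t))"
  have "(\<integral>\<^sup>+t. ?g t \<partial>unif h)
     = (\<integral>\<^sup>+t. ?g t * indicator {-h..h} t \<partial>lborel) / ennreal (2 * h)"
    by (rule nn_integral_unif) (use assms in measurable)
  also have "\<dots> \<le> (\<integral>\<^sup>+t. ?g t \<partial>lborel) / ennreal (2 * h)"
    by (intro divide_right_mono_ennreal nn_integral_mono) (auto simp: indicator_def)
  also have "(\<integral>\<^sup>+t. ?g t \<partial>lborel) \<le> ennreal (1 / d)"
  proof -
    have "ennreal d * (\<integral>\<^sup>+t. ?g t \<partial>lborel) \<le> 1"
      using nn_integral_scale[of "\<lambda>t. ennreal (\<bar>g t\<bar> powr p t)" d y] assms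
      by (simp add: modular_def)
    then have "ennreal (1 / d) * (ennreal d * (\<integral>\<^sup>+t. ?g t \<partial>lborel)) \<le> ennreal (1 / d) * 1"
      by (intro mult_left_mono) auto
    then show ?thesis using assms(1)
      by (simp add: mult.assoc[symmetric] ennreal_mult[symmetric])
  qed
  then have "(\<integral>\<^sup>+t. ?g t \<partial>lborel) / ennreal (2 * h)
      \<le> ennreal (1 / d) / ennreal (2 * h)" by (rule divide_right_mono_ennreal)
  also have "\<dots> = ennreal (1 / (2 * h * d))"
    using assms by (simp add: divide_ennreal mult.commute)
  finally show ?thesis .
qed

text \<open>Let \<open>b\<close> be the average of \<open>g x powr p x\<close>. If \<open>b \<le> 1\<close> the claim is immediate from
  \<open>g x \<le> g x powr p x\<close>. Otherwise \<open>b\<close> is at most the reciprocal of the length of the interval,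
  as the modular is at most 1; so the local condition makes \<open>b\<close> to the power \<open>1 / p x - 1 / p y\<close> at most
  \<open>exp c\<close> on the interval, and the oscillation of the exponent is harmless.\<close>

lemma average_large_values:
  assumes dh: "d > 0" "h > 0" and [measurable]: "g \<in> borel_measurable borel"
    and g: "\<And>x. g x = 0 \<or> g x > 1" and mod: "modular g \<le> 1"
    and a: "a \<ge> 0" and le: "ennreal a \<le> (\<integral>\<^sup>+t. ennreal (g (y + d * t)) \<partial>unif h)"
  shows "ennreal ((exp (- c) * a / 2) powr p y) \<le> (\<integral>\<^sup>+t. ennreal (g (y + d * t) powr p (y + d * t)) \<partial>unif h)"
proof -
  interpret prob_space "unif h" by (rule prob_space_unif) fact
  have g0: "g x \<ge> 0" for x using g[of x] by auto
  define I where "I = (\<integral>\<^sup>+t. ennreal (g (y + d * t) powr p (y + d * t)) \<partial>unif h)"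
  have I: "I \<le> ennreal (1 / (2 * h * d))"
    using modular_average_le[OF dh _ mod, of y] g0 by (simp add: I_def)
  then have "I < \<infinity>" using ennreal_less_top le_less_trans infinity_ennreal_def by metis
  then obtain b where b: "I = ennreal b" "b \<ge> 0" by (cases I) auto
  have bh: "b \<le> 1 / (2 * h * d)" using I b dh by (simp add: ennreal_le_iff)
  have "exp (- c) * a / 2 \<le> b powr (1 / p y)"
  proof (cases "b \<le> 1")
    case True
    have "ennreal a \<le> I"
      unfolding I_def
    proof (rule order_trans[OF le], rule nn_integral_mono)
      fix t
      show "ennreal (g (y + d * t)) \<le> ennreal (g (y + d * t) powr p (y + d * t))"
        using g[of "y + d * t"] powr_mono[of 1 "p (y + d * t)" "g (y + d * t)"] p_ge_1[of "y + d * t"]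
        by (auto intro!: ennreal_leI)
    qed
    then have "a \<le> b" using b by (simp add: ennreal_le_iff)
    have "exp (- c) * a \<le> 1 * a" using a c_nonneg by (intro mult_right_mono) auto
    then have "exp (- c) * a / 2 \<le> 1 * a" using a by simp
    also have "\<dots> \<le> b powr 1" using \<open>a \<le> b\<close> b by simp
    also have "\<dots> \<le> b powr (1 / p y)" using True b p_ge_1[of y] by (intro powr_mono') auto
    finally show ?thesis .
  next
    case False
    then have b1: "b > 1" by simp
    (* s is, up to the factor 2, the bound to be proved for a; above the level s the power
       p x can be afforded because s powr p x dominates b *)
    define s where "s = exp c * b powr (1 / p y)"
    have s: "s > 0" using b1 by (simp add: s_def)
    have pw: "g x \<le> s + s * (g x powr p x / b)" if "\<bar>x - y\<bar> \<le> d * h" for x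
    proof (cases "g x \<le> s")
      case True
      then show ?thesis using s b1 by (simp add: add_increasing2)
    next
      case False
      have "b \<le> s powr p x"
      proof (cases "x = y")
        case True
        have "b = (b powr (1 / p y)) powr p y" using b1 p_pos[of y] by (simp add: powr_powr)
        also have "\<dots> \<le> s powr p y"
          using c_nonneg p_pos[of y] by (intro powr_mono2) (auto simp: s_def mult_le_cancel_right1)
        finally show ?thesis using True by simp
      next
        case xy: False
        have "b \<le> exp 1 + 1 / \<bar>x - y\<bar>"
        proof -
          have "1 / (2 * h * d) \<le> 1 / (d * h)" using dh by (simp add: field_simps)
          also have "\<dots> \<le> 1 / \<bar>x - y\<bar>" using that xy by (intro divide_left_mono) auto
          also have "\<dots> \<le> exp 1 + 1 / \<bar>x - y\<bar>" by simp
          finally show ?thesis using bh by linarith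
        qed
        then have "ln b \<le> ln (exp 1 + 1 / \<bar>x - y\<bar>)" using b1 by (subst ln_le_cancel_iff) auto
        then have "\<bar>1 / p x - 1 / p y\<bar> * ln b \<le> \<bar>1 / p x - 1 / p y\<bar> * ln (exp 1 + 1 / \<bar>x - y\<bar>)"
          by (intro mult_left_mono) auto
        also have "\<dots> \<le> c" by (rule local_log[OF xy])
        finally have "(1 / p x - 1 / p y) * ln b \<le> c"
          using mult_right_mono[OF abs_ge_self, of "ln b" "1 / p x - 1 / p y"] b1
          by (meson ln_ge_zero less_imp_le order_trans)
        then have "p x * ((1 / p x - 1 / p y) * ln b) \<le> p x * c"
          using p_pos[of x] by (intro mult_left_mono) auto
        then have "ln b \<le> p x * (c + ln b / p y)"
          using p_pos[of x] by (simp add: algebra_simps)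
        then have "exp (ln b) \<le> exp (p x * (c + ln b / p y))" by simp
        also have "\<dots> = s powr p x"
          using b1 by (simp add: s_def powr_def exp_add[symmetric] mult.commute)
        finally show ?thesis using b1 by simp
      qed
      then have "1 / s powr p x \<le> 1 / b" using frac_le[of 1 1 b "s powr p x"] b1 by simp
      have "g x / s = (g x / s) powr 1" using False s by simp
      also have "\<dots> \<le> (g x / s) powr p x" using False s p_ge_1 by (intro powr_mono) auto
      also have "\<dots> = g x powr p x * (1 / s powr p x)" using g0 s by (simp add: powr_divide)
      also have "\<dots> \<le> g x powr p x * (1 / b)" by (intro mult_left_mono \<open>1 / s powr p x \<le> 1 / b\<close>) simp
      finally have "g x \<le> s * (g x powr p x / b)" using s by (simp add: field_simps)
      then show ?thesis using s by simp
    qed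
    have "ennreal a \<le> (\<integral>\<^sup>+t. ennreal s + ennreal (s / b) * ennreal (g (y + d * t) powr p (y + d * t)) \<partial>unif h)"
    proof (rule order_trans[OF le], rule nn_integral_mono_AE, rule AE_unif)
      fix t :: real assume t: "\<bar>t\<bar> \<le> h"
      have "\<bar>y + d * t - y\<bar> \<le> d * h" using dh t by (simp add: abs_mult)
      from pw[OF this] show "ennreal (g (y + d * t)) \<le> ennreal s + ennreal (s / b) * ennreal (g (y + d * t) powr p (y + d * t))"
        using s b1 by (simp add: ennreal_mult[symmetric] ennreal_leI flip: ennreal_plus)
    qed
    also have "\<dots> = ennreal s + ennreal (s / b) * I"
      unfolding I_def by (subst nn_integral_add) (auto simp: nn_integral_cmult emeasure_space_1)
    also have "\<dots> = ennreal (2 * s)"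
      using b b1 s by (simp add: ennreal_mult[symmetric] flip: ennreal_plus)
    finally have "a \<le> 2 * s" using s by (simp add: ennreal_le_iff)
    then have "exp (- c) * a / 2 \<le> exp (- c) * s" by simp
    also have "\<dots> = b powr (1 / p y)" by (simp add: s_def mult.assoc[symmetric] exp_add[symmetric])
    finally show ?thesis .
  qed
  then have "(exp (- c) * a / 2) powr p y \<le> (b powr (1 / p y)) powr p y"
    using a p_pos[of y] by (intro powr_mono2) auto
  also have "\<dots> = b" using b p_pos[of y] by (simp add: powr_powr)
  finally show ?thesis using b by (simp add: I_def[symmetric] ennreal_leI)
qed

text \<open>The key estimate: split \<open>\<psi>\<close> at height 1 and treat the large values by
  \<open>average_large_values\<close>, the small ones by Jensen's inequality and \<open>powr_le_of_small\<close>.\<close>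

lemma average_powr_le:
  assumes dh: "d > 0" "h > 0" and [measurable]: "\<psi> \<in> borel_measurable borel" and mod: "modular \<psi> \<le> 1"
    and a: "a \<ge> 0" and le: "ennreal a \<le> (\<integral>\<^sup>+t. ennreal \<bar>\<psi> (y + d * t)\<bar> \<partial>unif h)"
  shows "ennreal ((exp (- 4 * c) / 4 * a) powr p y)
    \<le> (\<integral>\<^sup>+t. ennreal (\<bar>\<psi> (y + d * t)\<bar> powr p (y + d * t) + kappa (y + d * t)) \<partial>unif h) + ennreal (kappa y)"
proof -
  interpret prob_space "unif h" by (rule prob_space_unif) fact
  define g l where "g x = (if \<bar>\<psi> x\<bar> > 1 then \<bar>\<psi> x\<bar> else 0)" and "l x = (if \<bar>\<psi> x\<bar> > 1 then 0 else \<bar>\<psi> x\<bar>)" for x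
  have [measurable]: "g \<in> borel_measurable borel" "l \<in> borel_measurable borel"
    unfolding g_def[abs_def] l_def[abs_def] by measurable
  have gl: "\<bar>\<psi> x\<bar> = g x + l x" "0 \<le> g x" "0 \<le> l x" "l x \<le> 1"
    and glp: "\<bar>\<psi> x\<bar> powr p x = g x powr p x + l x powr p x" for x
    by (auto simp: g_def l_def)
  have modg: "modular g \<le> 1"
    unfolding modular_def
    by (rule order_trans[OF nn_integral_mono mod[unfolded modular_def]]) (use gl glp in \<open>auto intro!: ennreal_leI\<close>)
  define Ag Al where "Ag = (\<integral>\<^sup>+t. ennreal (g (y + d * t)) \<partial>unif h)" and "Al = (\<integral>\<^sup>+t. ennreal (l (y + d * t)) \<partial>unif h)"
  have "Al \<le> (\<integral>\<^sup>+t. 1 \<partial>unif h)"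
    unfolding Al_def by (intro nn_integral_mono) (use gl in \<open>auto simp: ennreal_le_1\<close>)
  then have Al1: "Al \<le> 1" by (simp add: emeasure_space_1)
  have "Ag \<le> (\<integral>\<^sup>+t. ennreal (\<bar>g (y + d * t)\<bar> powr p (y + d * t)) \<partial>unif h)"
    unfolding Ag_def
  proof (rule nn_integral_mono)
    fix t
    show "ennreal (g (y + d * t)) \<le> ennreal (\<bar>g (y + d * t)\<bar> powr p (y + d * t))"
      using powr_mono[of 1 "p (y + d * t)" "\<bar>\<psi> (y + d * t)\<bar>"] p_ge_1[of "y + d * t"]
      by (auto simp: g_def intro!: ennreal_leI)
  qed
  also have "\<dots> \<le> ennreal (1 / (2 * h * d))" by (rule modular_average_le[OF dh _ modg]) measurable
  finally have "Ag < \<infinity>" using ennreal_less_top le_less_trans infinity_ennreal_def by metis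
  then obtain ag where ag: "Ag = ennreal ag" "ag \<ge> 0" by (cases Ag) auto
  have "Al < \<infinity>" using Al1 by (auto intro: le_less_trans)
  then obtain al where al: "Al = ennreal al" "al \<ge> 0" by (cases Al) auto
  let ?Il = "(\<integral>\<^sup>+t. ennreal (l (y + d * t) powr p (y + d * t) + kappa (y + d * t)) + ennreal (kappa y) \<partial>unif h)"
  let ?Ig = "(\<integral>\<^sup>+t. ennreal (g (y + d * t) powr p (y + d * t)) \<partial>unif h)"
  let ?I = "(\<integral>\<^sup>+t. ennreal (\<bar>\<psi> (y + d * t)\<bar> powr p (y + d * t) + kappa (y + d * t)) \<partial>unif h)"
  have "ennreal a \<le> Ag + Al"
    unfolding Ag_def Al_def using le gl by (subst nn_integral_add[symmetric]) (auto simp flip: ennreal_plus)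
  then have "a \<le> ag + al" using ag al by (simp add: ennreal_le_iff flip: ennreal_plus)
  define B where "B = exp (- 4 * c)"
  have B: "B > 0" "B \<le> exp (- c)" using c_nonneg by (auto simp: B_def)
  (* large values lose exp (- c) and a factor 2, small ones exp (- 4 * c); B accounts for both *)
  define X Y where "X = exp (- c) * ag / 2" and "Y = B * al"
  have XY: "X \<ge> 0" "Y \<ge> 0" using ag al B by (auto simp: X_def Y_def)
  have "B / 4 * a \<le> max X Y"
  proof -
    have "B / 4 * a \<le> B / 4 * (ag + al)" using \<open>a \<le> ag + al\<close> B by (intro mult_left_mono) auto
    also have "\<dots> = (B * ag / 2 + B * al / 2) / 2" by (simp add: algebra_simps)
    also have "\<dots> \<le> (X + Y) / 2"
      unfolding X_def Y_def using B ag al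
      by (intro divide_right_mono add_mono mult_right_mono) auto
    also have "\<dots> \<le> max X Y" by (simp add: max_def)
    finally show ?thesis .
  qed
  then have "(B / 4 * a) powr p y \<le> (max X Y) powr p y"
    using B a p_pos[of y] by (intro powr_mono2) auto
  also have "\<dots> \<le> X powr p y + Y powr p y" by (simp add: max_def)
  finally have "ennreal ((B / 4 * a) powr p y) \<le> ennreal (X powr p y) + ennreal (Y powr p y)"
    by (simp add: ennreal_leI flip: ennreal_plus)
  also have "ennreal (X powr p y) \<le> ?Ig"
    unfolding X_def
    by (rule average_large_values[OF dh _ _ modg ag(2)]) (use ag in \<open>auto simp: Ag_def g_def\<close>)
  also have "ennreal (Y powr p y) \<le> ?Il"
  proof -
    have "ennreal (Y powr p y) \<le> (\<integral>\<^sup>+t. ennreal ((B * l (y + d * t)) powr p y) \<partial>unif h)"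
    proof (rule powr_nn_integral_le)
      show "ennreal Y \<le> (\<integral>\<^sup>+t. ennreal (B * l (y + d * t)) \<partial>unif h)"
        using al B gl by (simp add: Y_def ennreal_mult nn_integral_cmult Al_def)
    qed (use XY B gl p_ge_1 in auto)
    also have "\<dots> \<le> ?Il"
      using powr_le_of_small[OF gl(3,4)] unfolding B_def
      by (intro nn_integral_mono) (simp add: ennreal_leI flip: ennreal_plus)
    finally show ?thesis .
  qed
  also have "?Ig
      + ?Il
     = ?I + ennreal (kappa y)"
  proof -
    have "?Il
       = (\<integral>\<^sup>+t. ennreal (l (y + d * t) powr p (y + d * t) + kappa (y + d * t)) \<partial>unif h) + ennreal (kappa y)"
      by (subst nn_integral_add) (auto simp: emeasure_space_1)
    moreover have "?Ig
      + (\<integral>\<^sup>+t. ennreal (l (y + d * t) powr p (y + d * t) + kappa (y + d * t)) \<partial>unif h)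
      = ?I"
      by (subst nn_integral_add[symmetric]) (auto simp: glp add.assoc simp flip: ennreal_plus)
    ultimately show ?thesis by (simp add: add.assoc[symmetric])
  qed
  finally show ?thesis by (simp add: B_def add_left_mono add_right_mono)
qed

end

section \<open>Boundedness of the majorant operator\<close>

lemma nn_integral_kernel_mixture:
  assumes "d > 0" and [measurable]: "u \<in> borel_measurable borel"
  shows "(\<integral>\<^sup>+t. ennreal (kappa t) * u (y + d * t) \<partial>lborel)
    = (\<integral>\<^sup>+h. ennreal (2 / (1 + h) ^ 3) * (\<integral>\<^sup>+t. u (y + d * t) * indicator {-h..h} t \<partial>lborel) * indicator {0<..} h \<partial>lborel)"
proof -
  let ?A = "\<lambda>h. (\<integral>\<^sup>+t. u (y + d * t) * indicator {-h..h} t \<partial>lborel)"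
  have [measurable]: "Measurable.pred (borel \<Otimes>\<^sub>M borel) (\<lambda>z::real\<times>real. snd z \<in> {\<bar>fst z\<bar>..})"
    "Measurable.pred (borel \<Otimes>\<^sub>M borel) (\<lambda>z::real\<times>real. fst z \<in> {\<bar>snd z\<bar>..})"
    unfolding atLeast_iff by measurable
  have "(\<integral>\<^sup>+t. ennreal (kappa t) * u (y + d * t) \<partial>lborel)
     = (\<integral>\<^sup>+t. (\<integral>\<^sup>+h. ennreal (2 / (1 + h) ^ 3) * indicator {\<bar>t\<bar>..} h * u (y + d * t) \<partial>lborel) \<partial>lborel)"
    by (simp add: kappa_eq_mixture nn_integral_multc)
  also have "\<dots> = (\<integral>\<^sup>+h. (\<integral>\<^sup>+t. ennreal (2 / (1 + h) ^ 3) * indicator {\<bar>t\<bar>..} h * u (y + d * t) \<partial>lborel) \<partial>lborel)"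
    by (rule lborel_pair.Fubini') measurable
  also have "\<dots> = (\<integral>\<^sup>+h. (\<integral>\<^sup>+t. ennreal (2 / (1 + h) ^ 3) * (u (y + d * t) * indicator {-h..h} t) \<partial>lborel) \<partial>lborel)"
    by (intro nn_integral_cong) (auto simp: indicator_def)
  also have "\<dots> = (\<integral>\<^sup>+h. ennreal (2 / (1 + h) ^ 3) * ?A h \<partial>lborel)"
    by (subst nn_integral_cmult) auto
  also have "\<dots> = (\<integral>\<^sup>+h. ennreal (2 / (1 + h) ^ 3) * ?A h * indicator {0<..} h \<partial>lborel)"
  proof (rule nn_integral_cong_AE, rule eventually_mono[OF AE_lborel_singleton[of 0]])
    fix h :: real assume "h \<noteq> 0"
    then show "ennreal (2 / (1 + h) ^ 3) * ?A h
        = ennreal (2 / (1 + h) ^ 3) * ?A h * indicator {0<..} h"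
      by (cases "h > 0") auto
  qed
  finally show ?thesis .
qed

text \<open>The law of \<open>h\<close> for which the uniform distribution on \<open>[- h, h]\<close> averages to \<open>kappa / 2\<close>.\<close>

definition mixing :: "real measure" where
  "mixing = density lborel (\<lambda>h. ennreal (2 * h / (1 + h) ^ 3) * indicator {0<..} h)"

lemma sets_mixing [measurable_cong, simp]: "sets mixing = sets borel"
  by (simp add: mixing_def)

lemma nn_integral_mixing:
  assumes [measurable]: "u \<in> borel_measurable borel"
  shows "(\<integral>\<^sup>+h. u h \<partial>mixing) = (\<integral>\<^sup>+h. ennreal (2 * h / (1 + h) ^ 3) * u h * indicator {0<..} h \<partial>lborel)"
  unfolding mixing_def by (subst nn_integral_density) (auto intro!: nn_integral_cong simp: mult_ac)

lemma prob_space_mixing: "prob_space mixing"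
proof
  have "(\<integral>\<^sup>+h. 1 \<partial>mixing) = (\<integral>\<^sup>+h. ennreal (2 * h / (1 + h) ^ 3) * indicator {0..} h \<partial>lborel)"
    by (subst nn_integral_mixing)
       (auto intro!: nn_integral_cong_AE eventually_mono[OF AE_lborel_singleton[of 0]] simp: indicator_def)
  then show "emeasure mixing (space mixing) = 1"
    by (simp add: nn_integral_mixing_density)
qed

lemma AE_mixing: "(\<And>h. h > 0 \<Longrightarrow> P h) \<Longrightarrow> AE h in mixing. P h"
  unfolding mixing_def by (subst AE_density) (auto simp: indicator_def)

text \<open>The average under \<open>unif h\<close>, written so that measurability in \<open>h\<close> is evident.\<close>

definition cavg :: "real \<Rightarrow> (real \<Rightarrow> ennreal) \<Rightarrow> real \<Rightarrow> real \<Rightarrow> ennreal" where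
  "cavg d u y h = (\<integral>\<^sup>+t. u (y + d * t) * indicator {-h..h} t \<partial>lborel) / ennreal (2 * h)"

lemma cavg_measurable [measurable]:
  assumes [measurable]: "u \<in> borel_measurable borel"
  shows "cavg d u y \<in> borel_measurable borel"
proof -
  have [measurable]: "Measurable.pred (borel \<Otimes>\<^sub>M borel) (\<lambda>z::real\<times>real. snd z \<in> {- fst z..fst z})"
    unfolding atLeastAtMost_iff by measurable
  show ?thesis unfolding cavg_def[abs_def] by measurable
qed

lemma nn_integral_kernel_eq_mixing:
  assumes "d > 0" and [measurable]: "u \<in> borel_measurable borel"
  shows "(\<integral>\<^sup>+t. ennreal (kappa t) * u (y + d * t) \<partial>lborel) = 2 * (\<integral>\<^sup>+h. cavg d u y h \<partial>mixing)"
proof -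
  have "(\<integral>\<^sup>+t. ennreal (kappa t) * u (y + d * t) \<partial>lborel)
    = (\<integral>\<^sup>+h. 2 * (ennreal (2 * h / (1 + h) ^ 3) * cavg d u y h * indicator {0<..} h) \<partial>lborel)"
    unfolding nn_integral_kernel_mixture[OF assms]
  proof (rule nn_integral_cong)
    fix h :: real
    show "ennreal (2 / (1 + h) ^ 3) * (\<integral>\<^sup>+t. u (y + d * t) * indicator {-h..h} t \<partial>lborel) * indicator {0<..} h
      = 2 * (ennreal (2 * h / (1 + h) ^ 3) * cavg d u y h * indicator {0<..} h)"
    proof (cases "h > 0")
      case True
      define J where "J = (\<integral>\<^sup>+t. u (y + d * t) * indicator {-h..h} t \<partial>lborel)"
      have "2 * (ennreal (2 * h / (1 + h) ^ 3) * (J / ennreal (2 * h)))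
          = 2 * ennreal (2 * h / (1 + h) ^ 3) / ennreal (2 * h) * J"
        by (simp add: ennreal_times_divide ennreal_divide_times mult_ac)
      also have "2 * ennreal (2 * h / (1 + h) ^ 3) / ennreal (2 * h) = ennreal (2 * (2 * h / (1 + h) ^ 3) / (2 * h))"
      proof -
        have "2 * ennreal (2 * h / (1 + h) ^ 3) = ennreal (2 * (2 * h / (1 + h) ^ 3))"
          using ennreal_mult[of 2 "2 * h / (1 + h) ^ 3"] True by simp
        also have "\<dots> / ennreal (2 * h) = ennreal (2 * (2 * h / (1 + h) ^ 3) / (2 * h))"
          by (rule divide_ennreal) (use True in auto)
        finally show ?thesis .
      qed
      also have "2 * (2 * h / (1 + h) ^ 3) / (2 * h) = 2 / (1 + h) ^ 3" using True by simp
      finally show ?thesis using True by (simp add: J_def cavg_def)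
    qed simp
  qed
  also have "\<dots> = 2 * (\<integral>\<^sup>+h. cavg d u y h \<partial>mixing)"
    by (subst nn_integral_mixing) (auto simp: nn_integral_cmult)
  finally show ?thesis .
qed

text \<open>The operator \<open>kconv\<close> conjugated with a dilation: if \<open>P x = \<psi> (d * x)\<close> for
  all \<open>x\<close>, then \<open>dil d \<psi> y = kconv P (y / d)\<close>.\<close>

definition dil :: "real \<Rightarrow> (real \<Rightarrow> real) \<Rightarrow> real \<Rightarrow> ennreal" where
  "dil d \<psi> y = (\<integral>\<^sup>+t. ennreal (kappa t * \<bar>\<psi> (y + d * t)\<bar>) \<partial>lborel)"

lemma dil_measurable [measurable]:
  assumes [measurable]: "\<psi> \<in> borel_measurable borel"
  shows "dil d \<psi> \<in> borel_measurable borel"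
  unfolding dil_def[abs_def] by measurable

lemma nn_integral_dil:
  assumes [measurable]: "\<psi> \<in> borel_measurable borel"
  shows "(\<integral>\<^sup>+y. dil d \<psi> y \<partial>lborel) = 2 * (\<integral>\<^sup>+x. ennreal \<bar>\<psi> x\<bar> \<partial>lborel)"
proof -
  have "(\<integral>\<^sup>+y. dil d \<psi> y \<partial>lborel) = (\<integral>\<^sup>+t. (\<integral>\<^sup>+y. ennreal (kappa t * \<bar>\<psi> (y + d * t)\<bar>) \<partial>lborel) \<partial>lborel)"
    unfolding dil_def by (rule lborel_pair.Fubini') measurable
  also have "\<dots> = (\<integral>\<^sup>+t. ennreal (kappa t) * (\<integral>\<^sup>+x. ennreal \<bar>\<psi> x\<bar> \<partial>lborel) \<partial>lborel)"
  proof (rule nn_integral_cong)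
    fix t
    have "(\<integral>\<^sup>+y. ennreal (kappa t * \<bar>\<psi> (y + d * t)\<bar>) \<partial>lborel) = ennreal (kappa t) * (\<integral>\<^sup>+y. ennreal \<bar>\<psi> (d * t + y)\<bar> \<partial>lborel)"
      by (simp add: ennreal_mult nn_integral_cmult add.commute)
    also have "(\<integral>\<^sup>+y. ennreal \<bar>\<psi> (d * t + y)\<bar> \<partial>lborel) = (\<integral>\<^sup>+x. ennreal \<bar>\<psi> x\<bar> \<partial>lborel)"
      by (rule nn_integral_shift[of "\<lambda>x. ennreal \<bar>\<psi> x\<bar>"]) measurable
    finally show "(\<integral>\<^sup>+y. ennreal (kappa t * \<bar>\<psi> (y + d * t)\<bar>) \<partial>lborel) = ennreal (kappa t) * (\<integral>\<^sup>+x. ennreal \<bar>\<psi> x\<bar> \<partial>lborel)" .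
  qed
  also have "\<dots> = 2 * (\<integral>\<^sup>+x. ennreal \<bar>\<psi> x\<bar> \<partial>lborel)"
    by (simp add: nn_integral_multc nn_integral_kappa)
  finally show ?thesis .
qed

context log_hoelder
begin

lemma dil_bound:
  assumes d: "d > 0" and [measurable]: "\<psi> \<in> borel_measurable borel"
  shows "dil d \<psi> y \<le> 2 + ennreal (1 / d) * modular \<psi>"
proof -
  have "dil d \<psi> y \<le> (\<integral>\<^sup>+t. ennreal (kappa t) + ennreal (\<bar>\<psi> (y + d * t)\<bar> powr p (y + d * t)) \<partial>lborel)"
    unfolding dil_def
  proof (rule nn_integral_mono)
    fix t
    define s where "s = \<bar>\<psi> (y + d * t)\<bar>"
    have "kappa t * s \<le> kappa t + s powr p (y + d * t)"
    proof (cases "s \<le> 1")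
      case True
      then have "kappa t * s \<le> kappa t * 1" by (intro mult_left_mono) (auto simp: s_def)
      then show ?thesis by (simp add: add_increasing2)
    next
      case False
      have "kappa t * s \<le> 1 * s" using False by (intro mult_right_mono kappa_le_1) auto
      also have "\<dots> \<le> s powr p (y + d * t)" using False powr_mono[of 1 "p (y + d * t)" s] p_ge_1 by simp
      finally show ?thesis by (simp add: add_increasing)
    qed
    then show "ennreal (kappa t * \<bar>\<psi> (y + d * t)\<bar>) \<le> ennreal (kappa t) + ennreal (\<bar>\<psi> (y + d * t)\<bar> powr p (y + d * t))"
      by (simp add: s_def ennreal_leI flip: ennreal_plus)
  qed
  also have "\<dots> = 2 + (\<integral>\<^sup>+t. ennreal (\<bar>\<psi> (y + d * t)\<bar> powr p (y + d * t)) \<partial>lborel)"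
    by (subst nn_integral_add) (auto simp: nn_integral_kappa)
  also have "(\<integral>\<^sup>+t. ennreal (\<bar>\<psi> (y + d * t)\<bar> powr p (y + d * t)) \<partial>lborel) = ennreal (1 / d) * modular \<psi>"
  proof -
    have "modular \<psi> = ennreal d * (\<integral>\<^sup>+t. ennreal (\<bar>\<psi> (y + d * t)\<bar> powr p (y + d * t)) \<partial>lborel)"
      unfolding modular_def using nn_integral_scale[of "\<lambda>t. ennreal (\<bar>\<psi> t\<bar> powr p t)" d y] d by simp
    then show ?thesis using d by (simp add: mult.assoc[symmetric] ennreal_mult[symmetric])
  qed
  finally show ?thesis .
qed

lemma dil_finite:
  assumes "d > 0" "\<psi> \<in> borel_measurable borel" "modular \<psi> < \<infinity>"
  shows "dil d \<psi> y < \<infinity>"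
  using assms(3) by (intro le_less_trans[OF dil_bound[OF assms(1,2)]]) (simp add: ennreal_mult_less_top)

text \<open>Jensen's inequality for \<open>mixing\<close> applied to the interval averages, each of which obeys
  \<open>average_powr_le\<close>.\<close>

lemma dil_powr_le:
  assumes d: "d > 0" and [measurable]: "\<psi> \<in> borel_measurable borel" and mod: "modular \<psi> \<le> 1"
    and a: "a \<ge> 0" and le: "ennreal a \<le> dil d \<psi> y"
  shows "ennreal ((exp (- 4 * c) / 8 * a) powr p y)
    \<le> dil d (\<lambda>x. \<bar>\<psi> x\<bar> powr p x + kappa x) y + ennreal (kappa y)"
proof -
  interpret prob_space mixing by (rule prob_space_mixing)
  define u where "u x = ennreal \<bar>\<psi> x\<bar>" for x
  define v where "v x = ennreal (\<bar>\<psi> x\<bar> powr p x + kappa x)" for x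
  have [measurable]: "u \<in> borel_measurable borel" "v \<in> borel_measurable borel"
    unfolding u_def[abs_def] v_def[abs_def] by measurable
  (* the constant of average_powr_le; a / 2 enters below as kappa has mass 2 *)
  define B where "B = exp (- 4 * c) / 4"
  have B: "B > 0" by (simp add: B_def)
  have unifavg: "cavg d w y h = (\<integral>\<^sup>+t. w (y + d * t) \<partial>unif h)" if "h > 0" "w \<in> borel_measurable borel" for w h
    unfolding cavg_def using that by (subst nn_integral_unif) auto
  have ufin: "cavg d u y h < \<infinity>" if h: "h > 0" for h
  proof -
    interpret U: prob_space "unif h" by (rule prob_space_unif) fact
    have "cavg d u y h = (\<integral>\<^sup>+t. u (y + d * t) \<partial>unif h)" by (rule unifavg[OF h]) measurable
    also have "\<dots> \<le> (\<integral>\<^sup>+t. 1 + ennreal (\<bar>\<psi> (y + d * t)\<bar> powr p (y + d * t)) \<partial>unif h)"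
    proof (rule nn_integral_mono)
      fix t
      define s where "s = \<bar>\<psi> (y + d * t)\<bar>"
      have "s \<le> 1 + s powr p (y + d * t)"
        using powr_mono[of 1 "p (y + d * t)" s] p_ge_1 by (cases "s \<le> 1") (auto simp: add_increasing2)
      then have "ennreal s \<le> ennreal (1 + s powr p (y + d * t))" by (rule ennreal_leI)
      also have "\<dots> = 1 + ennreal (s powr p (y + d * t))" by simp
      finally show "u (y + d * t) \<le> 1 + ennreal (\<bar>\<psi> (y + d * t)\<bar> powr p (y + d * t))"
        by (simp add: u_def s_def)
    qed
    also have "\<dots> = 1 + (\<integral>\<^sup>+t. ennreal (\<bar>\<psi> (y + d * t)\<bar> powr p (y + d * t)) \<partial>unif h)"
      by (subst nn_integral_add) (auto simp: U.emeasure_space_1)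
    also have "\<dots> \<le> 1 + ennreal (1 / (2 * h * d))"
      by (intro add_left_mono modular_average_le[OF d h _ mod]) measurable
    also have "\<dots> < \<infinity>" by simp
    finally show ?thesis .
  qed
  define g where "g h = B * enn2real (cavg d u y h)" for h
  have [measurable]: "g \<in> borel_measurable borel" unfolding g_def[abs_def] by measurable
  have g: "ennreal (g h) = ennreal B * cavg d u y h" if "h > 0" for h
    using ufin[OF that] B by (simp add: g_def ennreal_mult ennreal_enn2real_if)
  have key: "ennreal (g h powr p y) \<le> cavg d v y h + ennreal (kappa y)" if h: "h > 0" for h
  proof -
    have "ennreal (enn2real (cavg d u y h)) \<le> (\<integral>\<^sup>+t. ennreal \<bar>\<psi> (y + d * t)\<bar> \<partial>unif h)"
      using ufin[OF h] unifavg[OF h, of u] by (simp add: ennreal_enn2real_if u_def)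
    from average_powr_le[OF d h _ mod _ this] show ?thesis
      using unifavg[OF h, of v] by (simp add: g_def B_def v_def)
  qed
  have half: "ennreal (a / 2) \<le> (\<integral>\<^sup>+h. cavg d u y h \<partial>mixing)"
  proof -
    have "ennreal a \<le> 2 * (\<integral>\<^sup>+h. cavg d u y h \<partial>mixing)"
      using le nn_integral_kernel_eq_mixing[OF d, of u y] by (simp add: dil_def u_def ennreal_mult)
    then have "ennreal (1/2) * ennreal a \<le> ennreal (1/2) * (ennreal 2 * (\<integral>\<^sup>+h. cavg d u y h \<partial>mixing))"
      by (intro mult_left_mono) auto
    then show ?thesis using a
      by (simp only: mult.assoc[symmetric] ennreal_mult[symmetric]) simp
  qed
  have "ennreal ((B * (a / 2)) powr p y) \<le> (\<integral>\<^sup>+h. ennreal (g h powr p y) \<partial>mixing)"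
  proof (rule powr_nn_integral_le)
    have "ennreal (B * (a / 2)) = ennreal B * ennreal (a / 2)" by (rule ennreal_mult) (use a B in auto)
    also have "\<dots> \<le> ennreal B * (\<integral>\<^sup>+h. cavg d u y h \<partial>mixing)" by (intro mult_left_mono half) auto
    also have "\<dots> = (\<integral>\<^sup>+h. ennreal B * cavg d u y h \<partial>mixing)" by (simp add: nn_integral_cmult)
    also have "\<dots> = (\<integral>\<^sup>+h. ennreal (g h) \<partial>mixing)"
      by (rule nn_integral_cong_AE, rule AE_mixing) (simp add: g)
    finally show "ennreal (B * (a / 2)) \<le> (\<integral>\<^sup>+h. ennreal (g h) \<partial>mixing)" .
  qed (use a B p_ge_1 in \<open>auto simp: g_def\<close>)
  also have "\<dots> \<le> (\<integral>\<^sup>+h. cavg d v y h + ennreal (kappa y) \<partial>mixing)"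
    by (rule nn_integral_mono_AE, rule AE_mixing) (rule key)
  also have "\<dots> = (\<integral>\<^sup>+h. cavg d v y h \<partial>mixing) + ennreal (kappa y)"
    by (subst nn_integral_add) (auto simp: emeasure_space_1)
  also have "(\<integral>\<^sup>+h. cavg d v y h \<partial>mixing) \<le> 2 * (\<integral>\<^sup>+h. cavg d v y h \<partial>mixing)"
    by (simp add: mult_2)
  also have "2 * (\<integral>\<^sup>+h. cavg d v y h \<partial>mixing) = dil d (\<lambda>x. \<bar>\<psi> x\<bar> powr p x + kappa x) y"
    using nn_integral_kernel_eq_mixing[OF d, of v y] by (simp add: dil_def v_def ennreal_mult)
  finally show ?thesis by (simp add: B_def add_right_mono)
qed

lemma modular_dil_le:
  assumes d: "d > 0" and [measurable]: "\<psi> \<in> borel_measurable borel" and mod: "modular \<psi> \<le> 1"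
  shows "modular (\<lambda>y. exp (- 4 * c) / 8 * enn2real (dil d \<psi> y)) \<le> 8"
proof -
  have fin: "dil d \<psi> y < \<infinity>" for y
    using mod by (intro dil_finite d) (auto intro: le_less_trans)
  have "modular (\<lambda>y. exp (- 4 * c) / 8 * enn2real (dil d \<psi> y))
      \<le> (\<integral>\<^sup>+y. dil d (\<lambda>x. \<bar>\<psi> x\<bar> powr p x + kappa x) y + ennreal (kappa y) \<partial>lborel)"
    unfolding modular_def
  proof (rule nn_integral_mono)
    fix y
    have "ennreal ((exp (- 4 * c) / 8 * enn2real (dil d \<psi> y)) powr p y)
        \<le> dil d (\<lambda>x. \<bar>\<psi> x\<bar> powr p x + kappa x) y + ennreal (kappa y)"
      by (rule dil_powr_le[OF d _ mod]) (use fin[of y] in \<open>auto simp: ennreal_enn2real_if\<close>)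
    then show "ennreal (\<bar>exp (- 4 * c) / 8 * enn2real (dil d \<psi> y)\<bar> powr p y)
        \<le> dil d (\<lambda>x. \<bar>\<psi> x\<bar> powr p x + kappa x) y + ennreal (kappa y)"
      by (simp add: abs_mult)
  qed
  also have "\<dots> = 2 * (\<integral>\<^sup>+x. ennreal \<bar>\<bar>\<psi> x\<bar> powr p x + kappa x\<bar> \<partial>lborel) + 2"
    by (subst nn_integral_add) (auto simp: nn_integral_dil nn_integral_kappa)
  also have "(\<integral>\<^sup>+x. ennreal \<bar>\<bar>\<psi> x\<bar> powr p x + kappa x\<bar> \<partial>lborel) = modular \<psi> + 2"
    unfolding modular_def nn_integral_kappa[symmetric] by (subst nn_integral_add[symmetric]) auto
  also have "2 * (modular \<psi> + 2) + 2 \<le> 2 * (1 + 2) + 2"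
    by (intro add_mono mult_left_mono mod) auto
  finally show ?thesis by simp
qed

lemma modular_scale_down:
  assumes k: "k \<ge> 1" and [measurable]: "f \<in> borel_measurable borel"
  shows "modular (\<lambda>y. f y / k) \<le> ennreal (1 / k) * modular f"
proof -
  have "modular (\<lambda>y. f y / k) \<le> (\<integral>\<^sup>+y. ennreal (1 / k) * ennreal (\<bar>f y\<bar> powr p y) \<partial>lborel)"
    unfolding modular_def
  proof (rule nn_integral_mono)
    fix y
    have "(1 / k) powr p y \<le> (1 / k) powr 1" using k p_ge_1[of y] by (intro powr_mono') auto
    then have "(1 / k) powr p y * \<bar>f y\<bar> powr p y \<le> (1 / k) * \<bar>f y\<bar> powr p y"
      using k by (intro mult_right_mono) auto
    moreover have "\<bar>f y / k\<bar> powr p y = (1 / k) powr p y * \<bar>f y\<bar> powr p y"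
      using k by (subst powr_mult[symmetric]) auto
    ultimately show "ennreal (\<bar>f y / k\<bar> powr p y) \<le> ennreal (1 / k) * ennreal (\<bar>f y\<bar> powr p y)"
      using k by (simp add: ennreal_mult[symmetric] ennreal_leI)
  qed
  then show ?thesis by (simp add: nn_integral_cmult modular_def)
qed

text \<open>The sum of the two terms is at most \<open>N\<close> times their maximum, so the modulars add: 1 for
  \<open>\<psi>\<close> and 8 for \<open>modular_dil_le\<close>. Dividing by a further 10 makes the modular at most
  \<open>9 / 10\<close>, and 80 is \<open>8 * 10\<close>.\<close>

lemma modular_of_pointwise:
  assumes d: "d > 0" and [measurable]: "\<psi> \<in> borel_measurable borel" "D \<in> borel_measurable borel"
    and mod: "modular \<psi> \<le> 1" and ab: "a \<ge> 0" "b \<ge> 0" "a + b \<le> N" "N > 0"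
    and le: "\<And>y. ennreal \<bar>D y\<bar> \<le> ennreal a * ennreal \<bar>\<psi> y\<bar> + ennreal b * dil d \<psi> y"
  shows "modular (\<lambda>y. D y / (80 * N * exp (4 * c))) < 1"
proof -
  define B where "B = exp (- 4 * c) / 8"
  have "exp (- 4 * c) \<le> 1" using c_nonneg by simp
  then have B: "B > 0" "B \<le> 1" unfolding B_def by (simp, linarith)
  define K where "K y = enn2real (dil d \<psi> y)" for y
  have [measurable]: "K \<in> borel_measurable borel" unfolding K_def[abs_def] by measurable
  have K: "K y \<ge> 0" for y by (simp add: K_def)
  have Kd: "dil d \<psi> y = ennreal (K y)" for y
  proof -
    have "dil d \<psi> y < \<infinity>" using mod by (intro dil_finite d) (auto intro: le_less_trans)
    then show ?thesis by (simp add: K_def ennreal_enn2real_if)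
  qed
  define X where "X y = B * D y / N" for y
  have [measurable]: "X \<in> borel_measurable borel" unfolding X_def[abs_def] by measurable
  have "modular X \<le> (\<integral>\<^sup>+y. ennreal (\<bar>\<psi> y\<bar> powr p y) + ennreal (\<bar>B * K y\<bar> powr p y) \<partial>lborel)"
    unfolding modular_def
  proof (rule nn_integral_mono)
    fix y
    define m where "m = max \<bar>\<psi> y\<bar> (K y)"
    have "\<bar>D y\<bar> \<le> a * \<bar>\<psi> y\<bar> + b * K y"
      using le[of y] ab K[of y] unfolding Kd
      by (simp add: ennreal_mult[symmetric] ennreal_le_iff flip: ennreal_plus)
    also have "\<dots> \<le> a * m + b * m" using ab by (intro add_mono mult_left_mono) (auto simp: m_def)
    also have "\<dots> = (a + b) * m" by (simp add: algebra_simps)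
    also have "\<dots> \<le> N * m" using ab K[of y] by (intro mult_right_mono) (auto simp: m_def)
    finally have "\<bar>D y\<bar> / N \<le> m" using ab by (simp add: divide_le_eq mult.commute)
    then have "B * (\<bar>D y\<bar> / N) \<le> B * m" using B by (intro mult_left_mono) auto
    moreover have "\<bar>X y\<bar> = B * (\<bar>D y\<bar> / N)" using B ab by (simp add: X_def abs_mult)
    ultimately have "\<bar>X y\<bar> \<le> B * m" by simp
    also have "B * m = max (B * \<bar>\<psi> y\<bar>) (B * K y)" using B by (simp add: m_def max_mult_distrib_left)
    also have "\<dots> \<le> max \<bar>\<psi> y\<bar> (B * K y)" using B by (intro max.mono) (auto simp: mult_left_le_one_le)
    finally have "\<bar>X y\<bar> powr p y \<le> (max \<bar>\<psi> y\<bar> (B * K y)) powr p y"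
      using p_pos[of y] by (intro powr_mono2) auto
    also have "\<dots> \<le> \<bar>\<psi> y\<bar> powr p y + \<bar>B * K y\<bar> powr p y"
      using B K[of y] by (simp add: max_def)
    finally show "ennreal (\<bar>X y\<bar> powr p y) \<le> ennreal (\<bar>\<psi> y\<bar> powr p y) + ennreal (\<bar>B * K y\<bar> powr p y)"
      by (simp add: ennreal_leI flip: ennreal_plus)
  qed
  also have "\<dots> = modular \<psi> + modular (\<lambda>y. B * K y)"
    unfolding modular_def by (rule nn_integral_add) measurable
  also have "\<dots> \<le> 1 + 8"
    unfolding B_def K_def by (intro add_mono mod modular_dil_le[OF d _ mod]) measurable
  finally have "modular X \<le> 9" by simp
  then have "ennreal (1 / 10) * modular X \<le> ennreal (1 / 10) * ennreal 9" by (intro mult_left_mono) auto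
  also have "\<dots> = ennreal (9 / 10)" by (subst ennreal_mult[symmetric]) auto
  also have "\<dots> < 1" unfolding ennreal_1[symmetric] by (subst ennreal_less_iff) auto
  finally have "ennreal (1 / 10) * modular X < 1" .
  moreover have "modular (\<lambda>y. X y / 10) \<le> ennreal (1 / 10) * modular X"
    by (rule modular_scale_down) auto
  moreover have "(\<lambda>y. X y / 10) = (\<lambda>y. D y / (80 * N * exp (4 * c)))"
    using ab by (simp add: X_def B_def fun_eq_iff exp_minus field_simps)
  ultimately show ?thesis by (metis le_less_trans)
qed

end

section \<open>Transfer to the Steklov means and conclusion\<close>

lemma AE_shift:
  assumes "AE x in lborel. P x"
  shows "AE t in lborel. P (a + t :: real)"
proof -
  from assms obtain N where N: "N \<in> null_sets lborel" "{x \<in> space lborel. \<not> P x} \<subseteq> N"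
    by (auto simp: eventually_ae_filter)
  have "Measurable.pred borel (\<lambda>x. x \<notin> N)" using N(1) by (auto simp: null_sets_def)
  then have "AE t in lborel. a + 1 * t \<notin> N"
    using AE_not_in[OF N(1)] by (intro AE_borel_affine) auto
  then show ?thesis by eventually_elim (use N(2) in auto)
qed

lemma borel_measurable_lebesgue_of_AE:
  fixes f g :: "real \<Rightarrow> real"
  assumes g: "g \<in> borel_measurable borel" and ae: "AE x in lborel. f x = g x"
  shows "f \<in> borel_measurable lebesgue"
proof (rule borel_measurable_AE)
  show "g \<in> borel_measurable lebesgue" using g by (simp add: measurable_completion)
  show "AE x in lebesgue. g x = f x" using AE_completion[OF ae] by (simp add: eq_commute)
qed

text \<open>Here the Lebesgue measurable \<open>f\<close> is exchanged for a Borel version \<open>F\<close> in rescaled coordinates; the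
  Steklov mean does not see the difference at any point.\<close>

lemma steklov_eq_avg:
  assumes d: "d > 0" and F: "F \<in> borel_measurable borel" and ae: "AE x in lborel. f x = F (x / d)"
  shows "steklov d f x = avg F (x / d)"
proof -
  note [measurable] = F
  have ae': "AE t in lborel. f (x + t) = F ((x + t) / d)" by (rule AE_shift[OF ae])
  have m: "(\<lambda>t. f (x + t)) \<in> borel_measurable lebesgue"
    by (rule borel_measurable_lebesgue_of_AE[OF _ ae']) measurable
  have "steklov d f x = 1 / d * (\<integral>t. indicator {0..d} t *\<^sub>R f (x + t) \<partial>lebesgue)"
    by (simp add: steklov_def set_lebesgue_integral_def)
  also have "(\<integral>t. indicator {0..d} t *\<^sub>R f (x + t) \<partial>lebesgue) = (\<integral>t. indicator {0..d} t *\<^sub>R F ((x + t) / d) \<partial>lebesgue)"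
  proof (rule integral_cong_AE)
    show "(\<lambda>t. indicator {0..d} t *\<^sub>R f (x + t)) \<in> borel_measurable lebesgue"
      by (intro borel_measurable_scaleR m measurable_completion) measurable
    show "(\<lambda>t. indicator {0..d} t *\<^sub>R F ((x + t) / d)) \<in> borel_measurable lebesgue"
      by (intro measurable_completion) measurable
    show "AE t in lebesgue. indicator {0..d} t *\<^sub>R f (x + t) = indicator {0..d} t *\<^sub>R F ((x + t) / d)"
      using AE_completion[OF ae'] by eventually_elim simp
  qed
  also have "\<dots> = (\<integral>t. indicator {0..d} t *\<^sub>R F ((x + t) / d) \<partial>lborel)"
    by (rule integral_completion) measurable
  also have "\<dots> = d * (\<integral>t. indicator {0..d} (d * t) *\<^sub>R F ((x + d * t) / d) \<partial>lborel)"
    using lborel_integral_real_affine[of d "\<lambda>t. indicator {0..d} t *\<^sub>R F ((x + t) / d)" 0] d by simp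
  also have "(\<integral>t. indicator {0..d} (d * t) *\<^sub>R F ((x + d * t) / d) \<partial>lborel) = avg F (x / d)"
    unfolding avg_def corr_def
    using d by (intro Bochner_Integration.integral_cong)
       (auto simp: unit_ind_def indicator_def add_divide_distrib zero_le_mult_iff)
  finally show ?thesis using d by simp
qed

lemma iterated_id_minus_steklov:
  assumes d: "d > 0" and F: "unif_loc_int F" and ae: "AE x in lborel. f x = F (x / d)"
  shows "AE x in lborel. (id_minus_steklov d ^^ r) f x = (defect ^^ r) F (x / d)"
proof (induction r)
  case 0
  then show ?case using ae by simp
next
  case (Suc r)
  have m: "(defect ^^ r) F \<in> borel_measurable borel"
    using iterated_residual_bound[OF F, of r] unif_loc_int_measurable by blast
  show ?case
    using Suc
  proof eventually_elim
    case (elim x)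
    then show ?case
      using steklov_eq_avg[OF d m Suc, of x] by (simp add: id_minus_steklov_def defect_def)
  qed
qed

lemma (in log_hoelder) var_modular_eq:
  assumes "AE x in lborel. f x = g x"
  shows "var_modular p (\<lambda>y. f y / l) = modular (\<lambda>y. g y / l)"
  unfolding var_modular_def modular_def nn_integral_completion
  by (rule nn_integral_cong_AE) (use assms in eventually_elim, simp)

lemma (in log_hoelder) modular_small_scale:
  assumes [measurable]: "f \<in> borel_measurable borel" and l: "l > 0" and fin: "modular (\<lambda>y. f y / l) < \<infinity>"
  shows "\<exists>m>0. modular (\<lambda>y. f y / m) < 1"
proof -
  obtain b where b: "modular (\<lambda>y. f y / l) = ennreal b" "b \<ge> 0"
    using fin by (cases "modular (\<lambda>y. f y / l)") auto
  define k where "k = b + 1"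
  have "modular (\<lambda>y. f y / l / k) \<le> ennreal (1 / k) * modular (\<lambda>y. f y / l)"
    by (rule modular_scale_down) (use b in \<open>auto simp: k_def\<close>)
  also have "\<dots> = ennreal (b / k)"
    using b by (simp add: ennreal_mult[symmetric] k_def)
  also have "\<dots> < 1"
    unfolding ennreal_1[symmetric] using b by (subst ennreal_less_iff) (auto simp: k_def)
  finally show ?thesis
    using l b by (intro exI[of _ "l * k"]) (simp add: k_def divide_divide_eq_left)
qed

lemma (in log_hoelder) modular_combine:
  assumes [measurable]: "u \<in> borel_measurable borel" "v \<in> borel_measurable borel"
    and m: "m > 0" "n > 0" and "modular (\<lambda>y. u y / m) < \<infinity>" "modular (\<lambda>y. v y / n) < \<infinity>"
  shows "modular (\<lambda>y. (u y - v y) / (2 * max m n)) < \<infinity>"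
proof -
  have "modular (\<lambda>y. (u y - v y) / (2 * max m n))
      \<le> (\<integral>\<^sup>+y. ennreal (\<bar>u y / m\<bar> powr p y) + ennreal (\<bar>v y / n\<bar> powr p y) \<partial>lborel)"
    unfolding modular_def
  proof (rule nn_integral_mono)
    fix y
    define s where "s = max m n"
    have s: "s > 0" "m \<le> s" "n \<le> s" using m by (auto simp: s_def)
    have "\<bar>(u y - v y) / (2 * s)\<bar> \<le> (\<bar>u y\<bar> / s + \<bar>v y\<bar> / s) / 2"
      using s abs_triangle_ineq4[of "u y" "v y"] by (simp add: abs_mult field_simps)
    also have "\<dots> \<le> (\<bar>u y / m\<bar> + \<bar>v y / n\<bar>) / 2"
      using s m by (intro divide_right_mono add_mono) (auto simp: abs_divide intro!: divide_left_mono)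
    also have "\<dots> \<le> max \<bar>u y / m\<bar> \<bar>v y / n\<bar>"
    proof -
      have "(a + b) / 2 \<le> max a b" for a b :: real by (simp add: max_def)
      then show ?thesis .
    qed
    finally have "\<bar>(u y - v y) / (2 * s)\<bar> powr p y \<le> (max \<bar>u y / m\<bar> \<bar>v y / n\<bar>) powr p y"
      using p_pos[of y] by (intro powr_mono2) auto
    also have "\<dots> \<le> \<bar>u y / m\<bar> powr p y + \<bar>v y / n\<bar> powr p y" by (simp add: max_def)
    finally show "ennreal (\<bar>(u y - v y) / (2 * max m n)\<bar> powr p y)
        \<le> ennreal (\<bar>u y / m\<bar> powr p y) + ennreal (\<bar>v y / n\<bar> powr p y)"
      by (simp add: s_def ennreal_leI flip: ennreal_plus)
  qed
  also have "\<dots> = modular (\<lambda>y. u y / m) + modular (\<lambda>y. v y / n)"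
    unfolding modular_def by (rule nn_integral_add) measurable
  also have "\<dots> < \<infinity>" using assms(5,6) by simp
  finally show ?thesis .
qed

lemma ennreal_rescale:
  assumes "m > 0" "b \<ge> 0"
  shows "ennreal (1 / m) * ennreal b * ennreal m = ennreal b"
proof -
  have "ennreal (1 / m) * ennreal b * ennreal m = ennreal (1 / m * b) * ennreal m"
    by (subst ennreal_mult) (use assms in auto)
  also have "\<dots> = ennreal (1 / m * b * m)"
    by (rule ennreal_mult[symmetric]) (use assms in auto)
  finally show ?thesis using assms by simp
qed

lemma ess_sup_exponent_real_ge_0:
  assumes "\<And>x. p x \<ge> 1" "ess_sup_exponent p < \<infinity>"
  shows "real_of_ereal (ess_sup_exponent p) \<ge> 0"
proof -
  have "AE x in lebesgue. ereal (p x) \<le> ess_sup_exponent p"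
    unfolding ess_sup_exponent_def by (rule esssup_AE)
  then have "\<exists>x. ereal (p x) \<le> ess_sup_exponent p"
    by (rule contrapos_pp) (simp add: AE_iff_null null_sets_def)
  then obtain x where "ereal (p x) \<le> ess_sup_exponent p" ..
  moreover have "0 \<le> ereal (p x)" using assms(1)[of x] by simp
  ultimately have "0 \<le> ess_sup_exponent p" by (rule order_trans[rotated])
  then show ?thesis by (rule real_of_ereal_pos)
qed

text \<open>Here \<open>544 = 8 * 68\<close> and \<open>68 = 2 * 34\<close>; the growth rate \<open>433\<close> of the constructed constant stays
  below it, and the numerical factors leave ample room.\<close>

lemma const11_lower:
  assumes q: "q \<ge> 0" and c: "c \<ge> 0" and r: "r \<ge> 1"
  shows "80 * 433 ^ r * exp (4 * c) \<le> const11 r q c"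
proof -
  have s: "(\<Sum>k. 1 / 2 ^ (k + 2)) \<ge> (0::real)"
  proof (rule suminf_nonneg)
    have "summable (\<lambda>k. (1/4) * (1/2::real) ^ k)" by (intro summable_mult summable_geometric) simp
    then show "summable (\<lambda>k. 1 / 2 ^ (k + 2) :: real)" by (simp add: power_add power_one_over mult.commute)
  qed simp
  have p2: "2 powr (q + 1) \<ge> (2::real)" using q powr_mono[of 1 "q + 1" 2] by simp
  have p3: "3 powr q \<ge> (1::real)" using q by (simp add: ge_one_powr_ge_zero)
  have "2 * 1 * (1 + 2 * 1 * (0 + 2)) * exp (8 * c) \<le> const5 q c"
    unfolding const5_def using s p2 p3 by (intro mult_mono add_mono mult_nonneg_nonneg add_nonneg_nonneg) auto
  then have c5: "10 * exp (8 * c) \<le> const5 q c" by simp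
  have c8: "68 ^ r / 2 \<le> const8 r"
  proof (cases "r = 1")
    case False
    have "(68::real) ^ r / 2 \<le> 68 ^ r" by simp
    also have "\<dots> = 2 ^ r * 34 ^ r" by (simp flip: power_mult_distrib)
    also have "\<dots> \<le> const8 r" using False by (simp add: const8_def)
    finally show ?thesis .
  qed (simp add: const8_def)
  have "80 * 433 ^ r * exp (4 * c) \<le> 80 * 544 ^ r * exp (16 * c)"
    using c by (intro mult_mono power_mono) auto
  also have "\<dots> \<le> 900 * 544 ^ r * exp (16 * c)" by simp
  also have "\<dots> = 30 * 3 * 8 ^ r * (10 * exp (8 * c)) * (2 * exp (8 * c)) * (68 ^ r / 2)"
  proof -
    have "exp (16 * c) = exp (8 * c) * exp (8 * c)" by (simp flip: exp_add)
    moreover have "(544::real) ^ r = 8 ^ r * 68 ^ r" by (simp flip: power_mult_distrib)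
    ultimately show ?thesis by simp
  qed
  also have "\<dots> \<le> 30 * pi * 8 ^ r * const5 q c * const7 c * const8 r"
    unfolding const7_def using c5 c8 pi_gt3
    by (intro mult_mono mult_nonneg_nonneg) (auto intro: order_trans[OF _ c5])
  finally show ?thesis by (simp add: const11_def)
qed

lemma var_norm_le:
  assumes "m > 0" "var_modular p (\<lambda>y. f y / m) < 1"
  shows "var_norm p f \<le> m"
  unfolding var_norm_def by (rule cInf_lower) (use assms in \<open>auto intro!: bdd_belowI[of _ 0]\<close>)

text \<open>The infimum defining \<open>best_approx\<close> is over reals, so a lower bound for all norms is needed; the value
  \<open>Inf {}\<close> takes care of functions whose norm is an infimum over the empty set.\<close>

lemma best_approx_le:
  assumes g: "g \<in> exp_type_class s p" and m: "m > 0"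
    and le: "var_modular p (\<lambda>y. (f y - Re (g (of_real y))) / m) < 1"
  shows "best_approx s p f \<le> m"
proof -
  have "bdd_below ((\<lambda>g. var_norm p (\<lambda>x. f x - Re (g (of_real x)))) ` exp_type_class s p)"
  proof (rule bdd_belowI2)
    fix g
    define S where "S = {\<eta>. \<eta> > 0 \<and> var_modular p (\<lambda>y. (f y - Re (g (of_real y))) / \<eta>) < 1}"
    have norm_eq: "var_norm p (\<lambda>x. f x - Re (g (of_real x))) = Inf S"
      by (simp add: var_norm_def S_def)
    show "min 0 (Inf {}) \<le> var_norm p (\<lambda>x. f x - Re (g (of_real x)))"
    proof (cases "S = {}")
      case True
      show ?thesis unfolding norm_eq True by simp
    next
      case False
      then have "0 \<le> Inf S" by (rule cInf_greatest) (auto simp: S_def)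
      then show ?thesis unfolding norm_eq by simp
    qed
  qed
  then have "best_approx s p f \<le> var_norm p (\<lambda>x. f x - Re (g (of_real x)))"
    unfolding best_approx_def by (rule cINF_lower) (rule g)
  also have "\<dots> \<le> m" by (rule var_norm_le[OF m le])
  finally show ?thesis .
qed

text \<open>By \<open>dil_bound\<close>: a function of finite modular is the sum of a bounded and an integrable one.\<close>

lemma (in log_hoelder) unif_loc_int_dilate:
  assumes d: "d > 0" and [measurable]: "f \<in> borel_measurable borel" and l: "l > 0"
    and fin: "modular (\<lambda>y. f y / l) < \<infinity>"
  shows "unif_loc_int (\<lambda>x. f (d * x))"
proof -
  define C where "C = ennreal l * (2 + ennreal (1 / d) * modular (\<lambda>y. f y / l))"
  have "C < \<infinity>" using fin by (simp add: C_def ennreal_mult_less_top)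
  then obtain c' where c': "C = ennreal c'" by (cases C) auto
  have "kconv (\<lambda>x. f (d * x)) x \<le> C" for x
  proof -
    have "kconv (\<lambda>x. f (d * x)) x = (\<integral>\<^sup>+t. ennreal l * ennreal (kappa t * \<bar>f (d * x + d * t) / l\<bar>) \<partial>lborel)"
      unfolding kconv_def using l
      by (intro nn_integral_cong) (simp add: ennreal_mult[symmetric] distrib_left)
    also have "\<dots> = ennreal l * dil d (\<lambda>y. f y / l) (d * x)"
      unfolding dil_def by (rule nn_integral_cmult) measurable
    also have "\<dots> \<le> C" unfolding C_def by (intro mult_left_mono dil_bound d) auto
    finally show ?thesis .
  qed
  then show ?thesis unfolding unif_loc_int_def c' by (intro conjI exI allI) measurable
qed

lemma (in log_hoelder) modular_of_kconv_bound:
  assumes d: "d > 0" and P: "unif_loc_int P" and [measurable]: "D \<in> borel_measurable borel"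
    and m: "m > 0" and mod: "modular (\<lambda>y. P (y / d) / m) < 1" and b: "b \<ge> 0" "1 + b \<le> N"
    and le: "\<And>y. ennreal \<bar>D y\<bar> \<le> ennreal \<bar>P (y / d)\<bar> + ennreal b * kconv P (y / d)"
  shows "modular (\<lambda>y. D y / (80 * N * exp (4 * c) * m)) < 1"
proof -
  note [measurable] = unif_loc_int_measurable[OF P]
  let ?\<psi> = "\<lambda>y. P (y / d) / m"
  have pw: "ennreal \<bar>D y / m\<bar> \<le> ennreal 1 * ennreal \<bar>?\<psi> y\<bar> + ennreal b * dil d ?\<psi> y" for y
  proof -
    have "kconv P (y / d) = (\<integral>\<^sup>+t. ennreal m * ennreal (kappa t * \<bar>?\<psi> (y + d * t)\<bar>) \<partial>lborel)"
      unfolding kconv_def using m d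
      by (intro nn_integral_cong) (simp add: ennreal_mult[symmetric] add_divide_distrib)
    also have "\<dots> = ennreal m * dil d ?\<psi> y"
      unfolding dil_def by (rule nn_integral_cmult) measurable
    finally have "ennreal (1 / m) * ennreal \<bar>D y\<bar>
        \<le> ennreal (1 / m) * (ennreal \<bar>P (y / d)\<bar> + ennreal b * (ennreal m * dil d ?\<psi> y))"
      using le[of y] by (intro mult_left_mono) auto
    also have "\<dots> = ennreal (1 / m) * ennreal \<bar>P (y / d)\<bar> + (ennreal (1 / m) * ennreal b * ennreal m) * dil d ?\<psi> y"
      by (simp only: distrib_left mult.assoc)
    also have "ennreal (1 / m) * ennreal b * ennreal m = ennreal b"
      using m b by (intro ennreal_rescale) auto
    finally show ?thesis using m by (simp add: ennreal_mult[symmetric])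
  qed
  have "modular (\<lambda>y. D y / m / (80 * N * exp (4 * c))) < 1"
    by (rule modular_of_pointwise[OF d _ _ _ _ _ _ _ pw]) (use mod b in auto)
  then show ?thesis by (simp add: divide_divide_eq_left mult.commute)
qed

text \<open>The Steklov mean has a kernel dominated by \<open>4 kappa\<close>. Hence the iterated differences of
  \<open>f\<close> have finite norm, and the set defining their norm is nonempty.\<close>

lemma (in log_hoelder) modular_defect:
  assumes d: "d > 0" and F: "unif_loc_int F" and m: "m > 0" and mod: "modular (\<lambda>y. F (y / d) / m) < 1"
  shows "\<exists>n>0. modular (\<lambda>y. defect F (y / d) / n) < 1"
proof -
  note [measurable] = unif_loc_int_measurable[OF unif_loc_int_defect[OF F]]
  have "ennreal \<bar>defect F y\<bar> \<le> ennreal \<bar>F y\<bar> + ennreal \<bar>avg F y\<bar>" for y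
    unfolding defect_def by (simp flip: ennreal_plus add: ennreal_leI)
  also have "ennreal \<bar>F y\<bar> + ennreal \<bar>avg F y\<bar> \<le> ennreal \<bar>F y\<bar> + ennreal 4 * kconv F y" for y
    unfolding avg_def by (intro add_left_mono abs_corr_le[OF kernel_unit_ind F])
  finally have "modular (\<lambda>y. defect F (y / d) / (80 * 5 * exp (4 * c) * m)) < 1"
    by (intro modular_of_kconv_bound[OF d F _ m mod, of _ 4]) auto
  then show ?thesis using m by (intro exI[of _ "80 * 5 * exp (4 * c) * m"]) simp
qed

theorem theorem3p6:
  fixes p f :: "real \<Rightarrow> real" and r :: nat and \<sigma> c\<^sub>1 c\<^sub>2 :: real
  assumes "p \<in> P_Log"
    and "log_constants p c\<^sub>1 c\<^sub>2"
    and "r \<ge> 1"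
    and "\<sigma> > 0"
    and "f \<in> Lp_var p"
  shows "best_approx \<sigma> p f
    \<le> const11 r (real_of_ereal (ess_sup_exponent p)) (max c\<^sub>1 c\<^sub>2)
        * var_norm p ((id_minus_steklov (1 / \<sigma>) ^^ r) f)"
proof -
  define c where "c = max c\<^sub>1 c\<^sub>2"
  define d where "d = 1 / \<sigma>"
  have d: "d > 0" using assms(4) by (simp add: d_def)
  have p1: "p x \<ge> 1" for x using assms(1) by (simp add: P_Log_def)
  obtain p_inf where p_inf: "\<And>x. \<bar>1 / p x - 1 / p_inf\<bar> * ln (exp 1 + \<bar>x\<bar>) \<le> c\<^sub>2"
    using assms(2) by (auto simp: log_constants_def)
  interpret log_hoelder p c p_inf
  proof
    show "p x \<ge> 1" for x by (rule p1)
    show "c \<ge> 0" using assms(2) by (auto simp: log_constants_def c_def)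
    show "\<bar>1 / p x - 1 / p y\<bar> * ln (exp 1 + 1 / \<bar>x - y\<bar>) \<le> c" if "x \<noteq> y" for x y
    proof -
      have "\<bar>1 / p x - 1 / p y\<bar> * ln (exp 1 + 1 / \<bar>x - y\<bar>) \<le> c\<^sub>1"
        using assms(2) that by (simp add: log_constants_def)
      then show ?thesis unfolding c_def by (rule order_trans) simp
    qed
    show "\<bar>1 / p x - 1 / p_inf\<bar> * ln (exp 1 + \<bar>x\<bar>) \<le> c" for x
      using p_inf[of x] unfolding c_def by (rule order_trans) simp
  qed
  obtain f0 where f0 [measurable]: "f0 \<in> borel_measurable borel" and ae: "AE x in lborel. f x = f0 x"
    using assms(5) completion_ex_borel_measurable_real[of f lborel] by (auto simp: Lp_var_def)
  obtain l where l: "l > 0" and fin: "modular (\<lambda>y. f0 y / l) < \<infinity>"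
    using assms(5) var_modular_eq[OF ae] by (auto simp: Lp_var_def)
  (* coordinates in which the Steklov step is 1 and the exponential type is 1 *)
  define F where "F x = f0 (d * x)" for x
  have F: "unif_loc_int F" unfolding F_def[abs_def] by (rule unif_loc_int_dilate[OF d f0 l fin])
  have F_eq: "F (x / d) = f0 x" for x using d by (simp add: F_def)
  define \<Phi> where "\<Phi> = (defect ^^ r) F"
  define \<phi> where "\<phi> x = \<Phi> (x / d)" for x
  have \<Phi>: "unif_loc_int \<Phi>" unfolding \<Phi>_def using iterated_residual_bound[OF F] by blast
  have [measurable]: "\<phi> \<in> borel_measurable borel"
    unfolding \<phi>_def[abs_def] using unif_loc_int_measurable[OF \<Phi>] by measurable
  have ae\<phi>: "AE x in lborel. (id_minus_steklov d ^^ r) f x = \<phi> x"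
    unfolding \<phi>_def \<Phi>_def by (rule iterated_id_minus_steklov[OF d F]) (use ae F_eq in simp)
  obtain m where m: "m > 0" "modular (\<lambda>y. \<phi> y / m) < 1"
  proof -
    have "\<exists>m>0. modular (\<lambda>y. (defect ^^ n) F (y / d) / m) < 1" for n
    proof (induction n)
      case 0
      show ?case using modular_small_scale[OF f0 l fin] by (simp add: F_eq)
    next
      case (Suc n)
      then show ?case
        using modular_defect[OF d, of "(defect ^^ n) F"] iterated_residual_bound[OF F, of n] by auto
    qed
    then show ?thesis using that unfolding \<phi>_def \<Phi>_def by blast
  qed
  obtain G C where G: "G holomorphic_on UNIV" "\<And>z. norm (G z) \<le> C * exp (norm z)"
      "\<And>x. G (of_real x) \<in> \<real>"
      "\<And>x. ennreal \<bar>F x - Re (G (of_real x))\<bar> \<le> ennreal \<bar>\<Phi> x\<bar> + ennreal ((433 ^ r - 1) / 8) * kconv \<Phi> x"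
    using entire_approximation[OF F, of r] unfolding \<Phi>_def by blast
  define g where "g z = G (of_real \<sigma> * z)" for z
  have g_real: "g (of_real x) = G (of_real (x / d))" for x
    by (simp add: g_def d_def mult.commute)
  have g_hol: "g holomorphic_on UNIV"
    unfolding g_def using holomorphic_on_compose_gen[OF _ G(1), of "\<lambda>z. of_real \<sigma> * z" UNIV]
    by (auto simp: o_def intro!: holomorphic_intros)
  have g_type: "exponential_type \<sigma> g"
  proof (rule exponential_type_of_bound)
    show "norm (g z) \<le> C * exp (\<sigma> * norm z)" for z
      using G(2)[of "of_real \<sigma> * z"] assms(4) by (simp add: g_def norm_mult)
  qed (use assms(4) in simp)
  have g_meas [measurable]: "(\<lambda>x. Re (g (of_real x))) \<in> borel_measurable borel"
  proof (rule borel_measurable_continuous_onI)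
    show "continuous_on UNIV (\<lambda>x::real. Re (g (of_real x)))"
      by (intro continuous_intros continuous_on_compose2[OF holomorphic_on_imp_continuous_on[OF g_hol]]) auto
  qed
  define D where "D x = f0 x - Re (g (of_real x))" for x
  have [measurable]: "D \<in> borel_measurable borel" unfolding D_def[abs_def] by measurable
  have main: "modular (\<lambda>y. D y / (80 * 433 ^ r * exp (4 * c) * \<eta>)) < 1"
    if \<eta>: "\<eta> > 0" "modular (\<lambda>y. \<phi> y / \<eta>) < 1" for \<eta>
  proof (rule modular_of_kconv_bound[OF d \<Phi> _ \<eta>(1)])
    show "ennreal \<bar>D y\<bar> \<le> ennreal \<bar>\<Phi> (y / d)\<bar> + ennreal ((433 ^ r - 1) / 8) * kconv \<Phi> (y / d)" for y
      using G(4)[of "y / d"] unfolding D_def g_real F_eq .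
    have "(433 ^ r :: real) \<ge> 1" by simp
    then show "1 + (433 ^ r - 1) / 8 \<le> (433 ^ r :: real)" "0 \<le> (433 ^ r - 1) / (8::real)"
      by (simp_all add: field_simps)
  qed (use \<eta>(2) in \<open>simp_all add: \<phi>_def\<close>)
  define K where "K = 80 * 433 ^ r * exp (4 * c)"
  have K: "K > 0" by (simp add: K_def)
  (* g has finite norm because both f and f - g do *)
  have g_in: "g \<in> exp_type_class \<sigma> p"
  proof -
    have "modular (\<lambda>y. D y / (K * m)) < \<infinity>"
      using main[OF m] by (auto simp: K_def intro: less_trans)
    from modular_combine[OF f0 _ l _ fin this]
    have "modular (\<lambda>y. Re (g (of_real y)) / (2 * max l (K * m))) < \<infinity>"
      using K m by (simp add: D_def)
    then have "(\<lambda>x. Re (g (of_real x))) \<in> Lp_var p"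
      unfolding Lp_var_def using l var_modular_eq[of "\<lambda>x. Re (g (of_real x))" "\<lambda>x. Re (g (of_real x))"]
      by (auto intro!: exI[of _ "2 * max l (K * m)"] measurable_completion)
    then show ?thesis
      using g_hol g_type G(3) by (simp add: exp_type_class_def g_real del: of_real_divide)
  qed
  have aeD: "AE x in lborel. f x - Re (g (of_real x)) = D x"
    using ae by eventually_elim (simp add: D_def)
  define S where "S = {\<eta>. \<eta> > 0 \<and> var_modular p (\<lambda>y. (id_minus_steklov d ^^ r) f y / \<eta>) < 1}"
  have S: "S = {\<eta>. \<eta> > 0 \<and> modular (\<lambda>y. \<phi> y / \<eta>) < 1}"
    by (simp add: S_def var_modular_eq[OF ae\<phi>])
  (* the infimum defining the norm may fail to be attained, so every admissible value is compared *)
  have "best_approx \<sigma> p f / K \<le> Inf S"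
  proof (rule cInf_greatest)
    show "S \<noteq> {}" using m by (auto simp: S)
    fix \<eta> assume "\<eta> \<in> S"
    then have \<eta>: "\<eta> > 0" "modular (\<lambda>y. \<phi> y / \<eta>) < 1" by (auto simp: S)
    have "best_approx \<sigma> p f \<le> K * \<eta>"
      using K \<eta> main[OF \<eta>] by (intro best_approx_le[OF g_in]) (simp_all add: var_modular_eq[OF aeD] K_def)
    then show "best_approx \<sigma> p f / K \<le> \<eta>" using K by (simp add: divide_le_eq mult.commute)
  qed
  then have "best_approx \<sigma> p f \<le> K * Inf S" using K by (simp add: divide_le_eq mult.commute)
  also have "\<dots> \<le> const11 r (real_of_ereal (ess_sup_exponent p)) c * Inf S"
  proof (rule mult_right_mono)
    have "real_of_ereal (ess_sup_exponent p) \<ge> 0"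
      using assms(1) by (intro ess_sup_exponent_real_ge_0) (auto simp: P_Log_def)
    then show "K \<le> const11 r (real_of_ereal (ess_sup_exponent p)) c"
      unfolding K_def by (rule const11_lower[OF _ c_nonneg assms(3)])
    show "0 \<le> Inf S" by (rule cInf_greatest) (use m in \<open>auto simp: S\<close>)
  qed
  finally show ?thesis by (simp add: var_norm_def S_def c_def d_def)
qed

end
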